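(* Let $d=2$ or $d\ge 5$ be fixed. For a positive integer $E$, let $\mathcal N=\mathcal N(E)=\#\{\lambda\in\mathbb Z^d:|\lambda|^2=E\}$ and let $f$ be the random Gaussian Laplace eigenfunction with eigenvalue $4\pi^2E$ on $\mathbb T^d=\mathbb R^d/\mathbb Z^d$ (defined in the context), with Leray nodal measure $\mathcal L(f)$. Then, as $\mathcal N\to\infty$, $$\operatorname{Var}(\mathcal L(f))\sim\frac{1}{4\pi\mathcal N},$$ i.e. for every sequence of positive integers $E$ along which $\mathcal N(E)\to\infty$ one has $4\pi\,\mathcal N\cdot\operatorname{Var}(\mathcal L(f))\to 1$.
   Context: $\mathbb T^d=\mathbb R^d/\mathbb Z^d$ carries Lebesgue (probability) measure $\operatorname{meas}$. Let $\Lambda=\{\lambda\in\mathbb Z^d:|\lambda|^2=E\}$ with $E\ge1$ and $\mathcal N=\#\Lambda$, and let $\Lambda/\pm$ be a set of representatives of $\Lambda$ modulo $\lambda\mapsto-\lambda$. The random eigenfunction is $$f(x)=\sqrt{\tfrac{2}{\mathcal N}}\sum_{\lambda\in\Lambda/\pm}\bigl(b_\lambda\cos 2\pi\langle\lambda,x\rangle-c_\lambda\sin2\pi\langle\lambda,x\rangle\bigr),$$ where $b_\lambda,c_\lambda$ ($\lambda\in\Lambda/\pm$) are independent standard real Gaussians $N(0,1)$. The Leray measure of the nodal set of $f$ is $$\mathcal L(f)=\lim_{\epsilon\to0^+}\frac1{2\epsilon}\operatorname{meas}\{x\in\mathbb T^d:|f(x)|<\epsilon\},$$ which is defined whenever there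 is no $x$ with $f(x)=0$ and $\nabla f(x)=0$; this is the case for almost every $f$. The variance is with respect to the Gaussian randomness of $f$. *)

theory Defs
  imports "HOL-Probability.Probability"
begin

definition frequencies :: "nat \<Rightarrow> (real ^ 'n::finite) set" where
  "frequencies E = {l. (\<forall>i. l $ i \<in> \<int>) \<and> (norm l)\<^sup>2 = real E}"

definition freq_count :: "'n::finite itself \<Rightarrow> nat \<Rightarrow> nat" where
  "freq_count _ E = card (frequencies E :: (real ^ 'n) set)"

(* R contains exactly one element of each pair {l, -l}; for E > 0 the two are distinct. *)
definition representatives :: "nat \<Rightarrow> (real ^ 'n::finite) set \<Rightarrow> bool" where
  "representatives E R \<longleftrightarrow>
     R \<subseteq> frequencies E \<and> (\<forall>l\<in>frequencies E. l \<in> R \<longleftrightarrow> - l \<notin> R)"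

definition eigenfunction ::
  "nat \<Rightarrow> (real ^ 'n::finite) set \<Rightarrow> (real ^ 'n \<Rightarrow> real) \<Rightarrow> (real ^ 'n \<Rightarrow> real) \<Rightarrow> real ^ 'n \<Rightarrow> real"
where
  "eigenfunction E R b c x =
     sqrt (2 / real (freq_count TYPE('n) E)) *
     (\<Sum>l\<in>R. b l * cos (2 * pi * (l \<bullet> x)) - c l * sin (2 * pi * (l \<bullet> x)))"

(* The torus is represented by its fundamental domain [0,1)^d, on which lborel is the
   probability measure, and functions on the torus by Z^d-periodic functions on R^d.
   When the limit does not exist, Lim returns a fixed unspecified real; for the random
   eigenfunctions below this concerns only a null set of coefficients. *)
definition leray_measure :: "(real ^ 'n::finite \<Rightarrow> real) \<Rightarrow> real" where
  "leray_measure f =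
     Lim (at_right 0)
       (\<lambda>\<epsilon>. 1 / (2 * \<epsilon>) *
          measure lborel {x. (\<forall>i. 0 \<le> x $ i \<and> x $ i < 1) \<and> \<bar>f x\<bar> < \<epsilon>})"

(* Joint independence of all the b l and c l together is expressed over the disjoint sum R <+> R. *)
definition gaussian_coefficients ::
  "'w measure \<Rightarrow> 'a set \<Rightarrow> ('a \<Rightarrow> 'w \<Rightarrow> real) \<Rightarrow> ('a \<Rightarrow> 'w \<Rightarrow> real) \<Rightarrow> bool"
where
  "gaussian_coefficients M R b c \<longleftrightarrow>
     prob_space M \<and>
     prob_space.indep_vars M (\<lambda>_. borel) (case_sum b c) (R <+> R) \<and>
     (\<forall>l\<in>R. distributed M lborel (b l) std_normal_density \<and>
             distributed M lborel (c l) std_normal_density)"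

end

theory Submission
  imports Defs "HOL-Number_Theory.Number_Theory" "HOL-Library.Discrete_Functions"
begin

text \<open>
  Let \<open>u(x, y) = covariance E x y\<close> be the covariance of the Gaussian field \<open>f\<close>. The approximations
  \<open>L\<^sub>\<epsilon> = meas {\<bar>f\<bar> < \<epsilon>} / (2 \<epsilon>)\<close> have mean tending to \<open>1 / sqrt (2 \<pi>)\<close> and mixed second moments tending
  to \<open>\<integral>\<integral> (1 - u\<^sup>2) powr (-1/2) / (2 \<pi>)\<close>, with an error that is a power of \<open>\<epsilon>\<close> because even
  \<open>(1 - u\<^sup>2) powr (-3/4)\<close> is integrable. This rate gives convergence in mean square and, along
  \<open>\<epsilon> = (n + 1) powr (-8)\<close>, almost surely; monotonicity of \<open>\<epsilon> \<mapsto> \<epsilon> L\<^sub>\<epsilon>\<close> fills the gaps. So the Leray measure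
  exists almost surely without any discussion of singular zeros, and its variance is
  \<open>(\<integral>\<integral> (1 - u\<^sup>2) powr (-1/2) - 1) / (2 \<pi>)\<close>.

  Expanding the integrand, the term \<open>u\<^sup>2 / 2\<close> contributes \<open>1 / (2 N)\<close>, and everything else is \<open>O(\<integral> u\<^sup>4)\<close>:
  near a point with \<open>\<bar>u\<bar>\<close> close to \<open>1\<close>, the function \<open>1 - \<bar>u\<bar>\<close> is strongly convex on a cube of side
  comparable to \<open>1 / sqrt E\<close>, so the singular integral over that cube is at most a constant times its volume.

  Finally \<open>N * \<integral> u\<^sup>4\<close> is \<open>N powr (-3)\<close> times the number of quadruples of frequencies with sum zero. It tends to \<open>0\<close> once a
  hyperplane section of the sphere contains \<open>o(N)\<close> lattice points. In dimension two a section has at most two points.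
  In dimension \<open>d \<ge> 5\<close> it has \<open>O(E powr ((d - 3) / 2 + 1/3))\<close> points, by fixing \<open>d - 3\<close> coordinates and
  counting lattice points on a circle, while \<open>N\<close> is at least of order \<open>E powr ((d - 2) / 2 - 1/16)\<close>. The latter
  rests on many representations of integers prime to \<open>6\<close> as sums of four squares, one for each
  solution of \<open>a\<^sup>2 + b\<^sup>2 \<equiv> -1\<close>.
\<close>

section \<open>Lower bounds for sums of four squares\<close>

text \<open>The arithmetic has a margin that tolerates crude bounds. A hyperplane section is
  \<open>O(E powr (d/2 - 7/6))\<close>, so any lower bound \<open>c * E powr (d/2 - 1 - e)\<close>
  for \<open>N\<close> with \<open>e < 1/6\<close> suffices; \<open>e = 1/16\<close> is the price of
  bounding the number of prime factors of \<open>k\<close> by a multiple of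
  \<open>k powr (1/16)\<close>. Four squares alone cannot give such a bound, since
  \<open>2 * 4 ^ j\<close> has only 24 representations; a fifth coordinate is spent on making the
  remaining number prime to \<open>6\<close>, as the divisions by \<open>2\<close> and
  \<open>3\<close> in the quaternion lattice require. On the analytic side put
  \<open>\<tau> = sqrt (1 - u\<^sup>2)\<close>. The normalised two-point strip probability differs
  from \<open>1 / (2 * pi * \<tau>)\<close> by a relative error of at most
  \<open>min 1 (x\<^sup>2)\<close>, where \<open>x = (\<epsilon> + \<delta>) / \<tau>\<close>, and
  this is at most \<open>sqrt x\<close>. The price is the weight \<open>\<tau> powr (-3/2)\<close>,
  hence the exponent \<open>3/4\<close>. The cube estimate integrates
  \<open>(1 - u\<^sup>2) powr (-p)\<close> whenever \<open>2 * p < d\<close>, so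
  \<open>p = 3/4\<close> is still admissible for \<open>d = 2\<close>.\<close>

text \<open>
  Modulo \<open>k\<close> the condition reads \<open>z + i w = (a + i b) * cnj (x + i y)\<close>. If \<open>a\<^sup>2 + b\<^sup>2 \<equiv> -1\<close>, the lattice is a
  one-sided ideal in the quaternions with integer coordinates, and norms of its elements are divisible by \<open>k\<close>.
\<close>

definition quat_lattice :: "int \<Rightarrow> int \<Rightarrow> int \<Rightarrow> int \<Rightarrow> int \<Rightarrow> int \<Rightarrow> int \<Rightarrow> bool" where
  "quat_lattice k a b x y z w \<longleftrightarrow> k dvd z - (a * x + b * y) \<and> k dvd w - (b * x - a * y)"

lemma quat_lattice_add:
  assumes "quat_lattice k a b x y z w" "quat_lattice k a b x' y' z' w'"
  shows "quat_lattice k a b (x + x') (y + y') (z + z') (w + w')"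
  using dvd_add[of k "z - (a * x + b * y)" "z' - (a * x' + b * y')"]
    dvd_add[of k "w - (b * x - a * y)" "w' - (b * x' - a * y')"] assms
  by (simp add: quat_lattice_def algebra_simps)

lemma quat_lattice_scale:
  assumes "quat_lattice k a b x y z w"
  shows "quat_lattice k a b (c * x) (c * y) (c * z) (c * w)"
  using dvd_mult[of k "z - (a * x + b * y)" c] dvd_mult[of k "w - (b * x - a * y)" c] assms
  by (simp add: quat_lattice_def algebra_simps)

lemma quat_lattice_unscale:
  assumes "quat_lattice k a b (c * x) (c * y) (c * z) (c * w)" and "coprime k c"
  shows "quat_lattice k a b x y z w"
proof -
  have "k dvd c * (z - (a * x + b * y))" "k dvd c * (w - (b * x - a * y))"
    using assms(1) by (simp_all add: quat_lattice_def algebra_simps)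
  then show ?thesis
    using assms(2) by (simp add: quat_lattice_def coprime_dvd_mult_right_iff)
qed

text \<open>Right multiplication of \<open>x + y i + z j + w k\<close> by the unit \<open>i\<close>;
  up to sign it only exchanges the two congruences.\<close>

lemma quat_lattice_I:
  assumes "quat_lattice k a b x y z w"
  shows "quat_lattice k a b (- y) x w (- z)"
proof -
  have "w - (a * (- y) + b * x) = w - (b * x - a * y)" "- z - (b * (- y) - a * x) = - (z - (a * x + b * y))"
    by simp_all
  then show ?thesis using assms by (simp only: quat_lattice_def dvd_minus_iff)
qed

text \<open>Right multiplication by the unit \<open>-j\<close>. This is where stability of the
  lattice depends on \<open>a\<^sup>2 + b\<^sup>2\<close> being \<open>-1\<close> modulo
  \<open>k\<close>.\<close>

lemma quat_lattice_J:
  assumes k: "k dvd a\<^sup>2 + b\<^sup>2 + 1" and "quat_lattice k a b x y z w"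
  shows "quat_lattice k a b z w (- x) (- y)"
proof -
  obtain s t r where s: "z - (a * x + b * y) = k * s" and t: "w - (b * x - a * y) = k * t"
    and r: "a\<^sup>2 + b\<^sup>2 + 1 = k * r"
    using assms by (auto simp: quat_lattice_def dvd_def)
  have "- x - (a * z + b * w) = - x * (a\<^sup>2 + b\<^sup>2 + 1) - a * (z - (a * x + b * y)) - b * (w - (b * x - a * y))"
    by (simp add: power2_eq_square algebra_simps)
  also have "\<dots> = k * (- x * r - a * s - b * t)"
    unfolding s t r by (simp add: algebra_simps)
  finally have 1: "k dvd - x - (a * z + b * w)" by simp
  have "- y - (b * z - a * w) = - y * (a\<^sup>2 + b\<^sup>2 + 1) - b * (z - (a * x + b * y)) + a * (w - (b * x - a * y))"
    by (simp add: power2_eq_square algebra_simps)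
  also have "\<dots> = k * (- y * r - b * s + a * t)"
    unfolding s t r by (simp add: algebra_simps)
  finally have "k dvd - y - (b * z - a * w)" by simp
  with 1 show ?thesis by (simp add: quat_lattice_def)
qed

lemma quat_lattice_K:
  assumes k: "k dvd a\<^sup>2 + b\<^sup>2 + 1" and "quat_lattice k a b x y z w"
  shows "quat_lattice k a b (- w) z (- y) x"
  using quat_lattice_I[OF quat_lattice_J[OF assms]] by simp

text \<open>Modulo \<open>k\<close>, \<open>z\<^sup>2 + w\<^sup>2\<close> is
  \<open>(a\<^sup>2 + b\<^sup>2) * (x\<^sup>2 + y\<^sup>2)\<close>, which is
  \<open>- (x\<^sup>2 + y\<^sup>2)\<close>.\<close>

lemma quat_lattice_norm:
  assumes k: "k dvd a\<^sup>2 + b\<^sup>2 + 1" and "quat_lattice k a b x y z w"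
  shows "k dvd x\<^sup>2 + y\<^sup>2 + z\<^sup>2 + w\<^sup>2"
proof -
  obtain s t r where s: "z - (a * x + b * y) = k * s" and t: "w - (b * x - a * y) = k * t"
    and r: "a\<^sup>2 + b\<^sup>2 + 1 = k * r"
    using assms by (auto simp: quat_lattice_def dvd_def)
  have "x\<^sup>2 + y\<^sup>2 + z\<^sup>2 + w\<^sup>2 = (a\<^sup>2 + b\<^sup>2 + 1) * (x\<^sup>2 + y\<^sup>2)
    + (z - (a * x + b * y)) * (z + (a * x + b * y)) + (w - (b * x - a * y)) * (w + (b * x - a * y))"
    by (simp add: power2_eq_square algebra_simps)
  also have "\<dots> = k * (r * (x\<^sup>2 + y\<^sup>2) + s * (z + (a * x + b * y)) + t * (w + (b * x - a * y)))"
    unfolding s t r by (simp add: algebra_simps)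
  finally show ?thesis by simp
qed

text \<open>Right multiplication by the quaternion
  \<open>\<alpha> + \<beta> i - \<gamma> j + \<delta> k\<close>; norms therefore multiply. The minus
  sign at \<open>\<gamma>\<close> comes from \<open>quat_lattice_J\<close>.\<close>

lemma quat_lattice_comb:
  assumes k: "k dvd a\<^sup>2 + b\<^sup>2 + 1" and v: "quat_lattice k a b x y z w"
  shows "quat_lattice k a b (\<alpha> * x - \<beta> * y + \<gamma> * z - \<delta> * w) (\<alpha> * y + \<beta> * x + \<gamma> * w + \<delta> * z)
           (\<alpha> * z + \<beta> * w - \<gamma> * x - \<delta> * y) (\<alpha> * w - \<beta> * z - \<gamma> * y + \<delta> * x)"
  using quat_lattice_add[OF quat_lattice_add[OF quat_lattice_scale[OF v, of \<alpha>]
        quat_lattice_scale[OF quat_lattice_I[OF v], of \<beta>]]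
      quat_lattice_add[OF quat_lattice_scale[OF quat_lattice_J[OF k v], of \<gamma>]
        quat_lattice_scale[OF quat_lattice_K[OF k v], of \<delta>]]]
  by (simp add: algebra_simps)

text \<open>An even norm forces an even coordinate sum, so the coordinates can be paired off by
  parity. Multiplying by \<open>1 + i\<close>, \<open>1 - j\<close> or \<open>1 + k\<close>, of norm
  2, according to the pairing makes all four coordinates even, and halving them divides the norm by
  4. Since \<open>k\<close> is odd, halving stays inside the lattice.\<close>

lemma quat_lattice_half:
  assumes k: "k dvd a\<^sup>2 + b\<^sup>2 + 1" "odd k" and v: "quat_lattice k a b x y z w"
    and n: "x\<^sup>2 + y\<^sup>2 + z\<^sup>2 + w\<^sup>2 = 2 * n"
  shows "\<exists>x y z w. quat_lattice k a b x y z w \<and> x\<^sup>2 + y\<^sup>2 + z\<^sup>2 + w\<^sup>2 = n"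
proof -
  have cop: "coprime k 2" using k(2) by (simp add: coprime_right_2_iff_odd)
  have halve: ?thesis
    if v': "quat_lattice k a b X Y Z W" and "even X" "even Y" "even Z" "even W"
      and eq: "X\<^sup>2 + Y\<^sup>2 + Z\<^sup>2 + W\<^sup>2 = 2 * (x\<^sup>2 + y\<^sup>2 + z\<^sup>2 + w\<^sup>2)" for X Y Z W
  proof -
    obtain x' y' z' w' where *: "X = 2 * x'" "Y = 2 * y'" "Z = 2 * z'" "W = 2 * w'"
      using \<open>even X\<close> \<open>even Y\<close> \<open>even Z\<close> \<open>even W\<close> by (auto elim!: evenE)
    have "x'\<^sup>2 + y'\<^sup>2 + z'\<^sup>2 + w'\<^sup>2 = n" using eq n * by (simp add: power_mult_distrib)
    then show ?thesis using quat_lattice_unscale[OF _ cop] v' * by blast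
  qed
  have "even (x\<^sup>2 + y\<^sup>2 + z\<^sup>2 + w\<^sup>2)" using n by simp
  then have ev: "even (x + y + z + w)" by simp
  consider "even (x - y)" "even (z + w)" | "even (x + z)" "even (y + w)" | "even (x - w)" "even (y + z)"
    using ev by (cases "even x"; cases "even y"; cases "even z"; cases "even w") simp_all
  then show ?thesis
  proof cases
    case 1
    show ?thesis
      by (rule halve[OF quat_lattice_comb[OF k(1) v, of 1 1 0 0]])
        (use 1 in \<open>auto simp: power2_eq_square algebra_simps\<close>)
  next
    case 2
    show ?thesis
      by (rule halve[OF quat_lattice_comb[OF k(1) v, of 1 0 1 0]])
        (use 2 in \<open>auto simp: power2_eq_square algebra_simps\<close>)
  next
    case 3
    show ?thesis
      by (rule halve[OF quat_lattice_comb[OF k(1) v, of 1 0 0 1]])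
        (use 3 in \<open>auto simp: power2_eq_square algebra_simps\<close>)
  qed
qed

lemma residue_mod_3:
  fixes x :: int
  obtains r where "r \<in> {-1, 0, 1}" "3 dvd x - r"
proof -
  have "x mod 3 = 0 \<or> x mod 3 = 1 \<or> x mod 3 = 2" by presburger
  then show ?thesis
  proof (elim disjE)
    assume "x mod 3 = 0"
    then have "3 dvd x - 0" by presburger
    then show ?thesis by (intro that[of 0]) auto
  next
    assume "x mod 3 = 1"
    then have "3 dvd x - 1" by presburger
    then show ?thesis by (intro that[of 1]) auto
  next
    assume "x mod 3 = 2"
    then have "3 dvd x - (-1)" by presburger
    then show ?thesis by (intro that[of "-1"]) auto
  qed
qed

text \<open>Multiplication by the conjugate of the reduction of \<open>(x, y, z, w)\<close> modulo \<open>3\<close>, as in Lagrange's descent.\<close>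

lemma quat_lattice_third:
  assumes k: "k dvd a\<^sup>2 + b\<^sup>2 + 1" "\<not> 3 dvd k" and v: "quat_lattice k a b x y z w"
    and n: "x\<^sup>2 + y\<^sup>2 + z\<^sup>2 + w\<^sup>2 = 3 * k"
  shows "\<exists>x y z w. quat_lattice k a b x y z w \<and> x\<^sup>2 + y\<^sup>2 + z\<^sup>2 + w\<^sup>2 = k"
proof -
  have "prime (3::int)" by simp
  then have cop: "coprime k 3" using k(2) by (metis coprime_commute prime_imp_coprime)
  obtain \<alpha> where \<alpha>: "\<alpha> \<in> {-1, 0, 1}" "3 dvd x - \<alpha>" by (rule residue_mod_3)
  \<comment> \<open>Residues of \<open>- y\<close> and \<open>- w\<close> are taken so that
    \<open>\<alpha>\<close>, \<open>\<beta>'\<close>, \<open>\<gamma>\<close>,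
    \<open>\<delta>'\<close> are exactly the coefficients with which
    \<open>quat_lattice_comb\<close> multiplies by the conjugate of the reduction.\<close>
  obtain \<beta>' where \<beta>: "\<beta>' \<in> {-1, 0, 1}" "3 dvd - y - \<beta>'" by (rule residue_mod_3)
  obtain \<gamma> where \<gamma>: "\<gamma> \<in> {-1, 0, 1}" "3 dvd z - \<gamma>" by (rule residue_mod_3)
  obtain \<delta>' where \<delta>: "\<delta>' \<in> {-1, 0, 1}" "3 dvd - w - \<delta>'" by (rule residue_mod_3)
  obtain p q r s where "x - \<alpha> = 3 * p" "- y - \<beta>' = 3 * q" "z - \<gamma> = 3 * r" "- w - \<delta>' = 3 * s"
    using \<alpha>(2) \<beta>(2) \<gamma>(2) \<delta>(2) by (auto elim!: dvdE)
  then have p: "x = \<alpha> + 3 * p" and q: "y = - \<beta>' - 3 * q" and r: "z = \<gamma> + 3 * r" and s: "w = - \<delta>' - 3 * s"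
    by linarith+
  define m where "m = \<alpha>\<^sup>2 + \<beta>'\<^sup>2 + \<gamma>\<^sup>2 + \<delta>'\<^sup>2"
  have nm: "3 * k = m + 3 * (2 * (\<alpha> * p + \<beta>' * q + \<gamma> * r + \<delta>' * s) + 3 * (p\<^sup>2 + q\<^sup>2 + r\<^sup>2 + s\<^sup>2))"
  proof -
    have "3 * k = (\<alpha> + 3 * p)\<^sup>2 + (- \<beta>' - 3 * q)\<^sup>2 + (\<gamma> + 3 * r)\<^sup>2 + (- \<delta>' - 3 * s)\<^sup>2"
      by (simp only: n[symmetric] p q r s)
    then show ?thesis unfolding m_def by (simp add: power2_eq_square algebra_simps)
  qed
  then have "m = 3 * (k - (2 * (\<alpha> * p + \<beta>' * q + \<gamma> * r + \<delta>' * s) + 3 * (p\<^sup>2 + q\<^sup>2 + r\<^sup>2 + s\<^sup>2)))"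
    by (simp only: right_diff_distrib)
  then have "3 dvd m" by simp
  have sq: "0 \<le> t\<^sup>2 \<and> t\<^sup>2 \<le> 1 \<and> (t\<^sup>2 = 0 \<longrightarrow> t = 0)" if "t \<in> {-1, 0, 1}" for t :: int
    using that by auto
  note sqs = sq[OF \<alpha>(1)] sq[OF \<beta>(1)] sq[OF \<gamma>(1)] sq[OF \<delta>(1)]
  have "0 \<le> m" "m \<le> 4" using sqs unfolding m_def by linarith+
  with \<open>3 dvd m\<close> have "m = 0 \<or> m = 3" by presburger
  \<comment> \<open>If \<open>m = 0\<close>, all coordinates are divisible by 3, so 9 divides the
    norm \<open>3 * k\<close>, against the assumption that 3 does not divide
    \<open>k\<close>.\<close>
  moreover have "m \<noteq> 0"
  proof
    assume "m = 0"
    then have "\<alpha>\<^sup>2 = 0" "\<beta>'\<^sup>2 = 0" "\<gamma>\<^sup>2 = 0" "\<delta>'\<^sup>2 = 0" using sqs unfolding m_def by linarith+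
    with sqs have "\<alpha> = 0" "\<beta>' = 0" "\<gamma> = 0" "\<delta>' = 0" by blast+
    then have "k = 3 * (p\<^sup>2 + q\<^sup>2 + r\<^sup>2 + s\<^sup>2)" using nm \<open>m = 0\<close> by simp
    then show False using k(2) by simp
  qed
  ultimately have m3: "m = 3" by simp
  let ?X = "\<alpha> * x - \<beta>' * y + \<gamma> * z - \<delta>' * w"
  let ?Y = "\<alpha> * y + \<beta>' * x + \<gamma> * w + \<delta>' * z"
  let ?Z = "\<alpha> * z + \<beta>' * w - \<gamma> * x - \<delta>' * y"
  let ?W = "\<alpha> * w - \<beta>' * z - \<gamma> * y + \<delta>' * x"
  have "?X = m + 3 * (\<alpha> * p + \<beta>' * q + \<gamma> * r + \<delta>' * s)"
    unfolding m_def by (simp only: p q r s) (simp add: power2_eq_square algebra_simps)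
  then have "?X = 3 * (1 + (\<alpha> * p + \<beta>' * q + \<gamma> * r + \<delta>' * s))" using m3 by simp
  then obtain X where X: "?X = 3 * X" by blast
  have "?Y = 3 * (- \<alpha> * q + \<beta>' * p - \<gamma> * s + \<delta>' * r)"
    by (simp only: p q r s) (simp add: algebra_simps)
  then obtain Y where Y: "?Y = 3 * Y" by blast
  have "?Z = 3 * (\<alpha> * r - \<beta>' * s - \<gamma> * p + \<delta>' * q)"
    by (simp only: p q r s) (simp add: algebra_simps)
  then obtain Z where Z: "?Z = 3 * Z" by blast
  have "?W = 3 * (- \<alpha> * s - \<beta>' * r + \<gamma> * q + \<delta>' * p)"
    by (simp only: p q r s) (simp add: algebra_simps)
  then obtain W where W: "?W = 3 * W" by blast
  have "quat_lattice k a b (3 * X) (3 * Y) (3 * Z) (3 * W)"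
    using quat_lattice_comb[OF k(1) v, of \<alpha> \<beta>' \<gamma> \<delta>'] unfolding X Y Z W .
  then have "quat_lattice k a b X Y Z W" using cop by (rule quat_lattice_unscale)
  moreover have "(3 * X)\<^sup>2 + (3 * Y)\<^sup>2 + (3 * Z)\<^sup>2 + (3 * W)\<^sup>2 = m * (x\<^sup>2 + y\<^sup>2 + z\<^sup>2 + w\<^sup>2)"
    unfolding X[symmetric] Y[symmetric] Z[symmetric] W[symmetric] m_def
    by (simp add: power2_eq_square algebra_simps)
  then have "X\<^sup>2 + Y\<^sup>2 + Z\<^sup>2 + W\<^sup>2 = k" using n m3 by (simp add: power_mult_distrib)
  ultimately show ?thesis by blast
qed

text \<open>Pigeonhole: with \<open>m\<close> the integer square root of \<open>k\<close>, the box
  \<open>{0..m}\<close> to the fourth power has more than \<open>k\<^sup>2\<close> points, while the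
  two congruences distinguish only \<open>k\<^sup>2\<close> classes. The difference of two points in
  one class has coordinates bounded by \<open>m\<close>, so its norm is at most
  \<open>4 * m\<^sup>2\<close>.\<close>

lemma quat_lattice_short:
  assumes "k > 0"
  shows "\<exists>x y z w. quat_lattice k a b x y z w \<and> x\<^sup>2 + y\<^sup>2 + z\<^sup>2 + w\<^sup>2 \<in> {0<..4 * k}"
proof -
  define m where "m = floor_sqrt (nat k)"
  have "int (m\<^sup>2) \<le> int (nat k)" "int (nat k) < int ((Suc m)\<^sup>2)"
    unfolding of_nat_le_iff of_nat_less_iff m_def by (rule floor_sqrt_power2_le Suc_floor_sqrt_power2_gt)+
  then have m1: "(int m)\<^sup>2 \<le> k" and m2: "k < (int m + 1)\<^sup>2"
    using assms by (simp_all add: add.commute)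
  define B where "B = {0..int m} \<times> {0..int m} \<times> {0..int m} \<times> {0..int m}"
  define f where "f = (\<lambda>(x, y, z, w). ((z - (a * x + b * y)) mod k, (w - (b * x - a * y)) mod k))"
  have "f ` B \<subseteq> {0..<k} \<times> {0..<k}" using assms by (auto simp: f_def)
  then have "card (f ` B) \<le> card ({0..<k} \<times> {0..<k})" by (intro card_mono) auto
  also have "\<dots> = nat k * nat k" by (simp add: card_cartesian_product)
  also have "\<dots> < card B"
  proof -
    have "int (nat k * nat k) = k\<^sup>2" using assms by (simp add: power2_eq_square)
    also have "\<dots> < ((int m + 1)\<^sup>2)\<^sup>2" using m2 assms by (intro power_strict_mono) auto
    also have "\<dots> = int (card B)"
      by (simp add: B_def card_cartesian_product power2_eq_square algebra_simps)
    finally show ?thesis by linarith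
  qed
  finally have "\<not> inj_on f B" by (rule pigeonhole)
  then obtain v v' where "v \<in> B" "v' \<in> B" "v \<noteq> v'" "f v = f v'" unfolding inj_on_def by blast
  then obtain x y z w x' y' z' w' where in1: "(x, y, z, w) \<in> B" and in2: "(x', y', z', w') \<in> B"
    and ne: "(x, y, z, w) \<noteq> (x', y', z', w')" and eq: "f (x, y, z, w) = f (x', y', z', w')"
    by (cases v, cases v') blast
  have "quat_lattice k a b (x - x') (y - y') (z - z') (w - w')"
    using eq by (simp add: f_def quat_lattice_def mod_eq_dvd_iff algebra_simps)
  moreover have "(x - x')\<^sup>2 + (y - y')\<^sup>2 + (z - z')\<^sup>2 + (w - w')\<^sup>2 > 0"
    using ne by (smt (verit) zero_le_power2 zero_less_power2)
  moreover have "(x - x')\<^sup>2 + (y - y')\<^sup>2 + (z - z')\<^sup>2 + (w - w')\<^sup>2 \<le> 4 * k"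
  proof -
    have *: "(s - t)\<^sup>2 \<le> k" if "s \<in> {0..int m}" "t \<in> {0..int m}" for s t
    proof -
      have "\<bar>s - t\<bar> \<le> \<bar>int m\<bar>" using that by auto
      then have "(s - t)\<^sup>2 \<le> (int m)\<^sup>2" by (rule abs_le_square_iff[THEN iffD1])
      then show ?thesis using m1 by linarith
    qed
    have "(x - x')\<^sup>2 \<le> k" "(y - y')\<^sup>2 \<le> k" "(z - z')\<^sup>2 \<le> k" "(w - w')\<^sup>2 \<le> k"
      using in1 in2 by (auto simp: B_def intro!: *)
    then show ?thesis by linarith
  qed
  ultimately show ?thesis by auto
qed

text \<open>A short vector has norm \<open>k\<close>, \<open>2 * k\<close>, \<open>3 * k\<close> or
  \<open>4 * k\<close>; the excess factor is removed by halving once or twice, or by dividing by 3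
  once.\<close>

lemma quat_lattice_exists_norm:
  assumes k: "k > 0" "odd k" "\<not> 3 dvd k" and ab: "k dvd a\<^sup>2 + b\<^sup>2 + 1"
  shows "\<exists>x y z w. quat_lattice k a b x y z w \<and> x\<^sup>2 + y\<^sup>2 + z\<^sup>2 + w\<^sup>2 = k"
proof -
  obtain x y z w where v: "quat_lattice k a b x y z w"
    and s: "x\<^sup>2 + y\<^sup>2 + z\<^sup>2 + w\<^sup>2 > 0" "x\<^sup>2 + y\<^sup>2 + z\<^sup>2 + w\<^sup>2 \<le> 4 * k"
    using quat_lattice_short[OF k(1), of a b] by auto
  obtain j where j: "x\<^sup>2 + y\<^sup>2 + z\<^sup>2 + w\<^sup>2 = k * j" using quat_lattice_norm[OF ab v] by auto
  have "0 < j" "j \<le> 4" using s k(1) unfolding j by (auto simp: zero_less_mult_iff)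
  then consider "j = 1" | "j = 2" | "j = 3" | "j = 4" by linarith
  then show ?thesis
  proof cases
    case 1
    then show ?thesis using v j by auto
  next
    case 2
    then show ?thesis using quat_lattice_half[OF ab k(2) v] j by simp
  next
    case 3
    then show ?thesis using quat_lattice_third[OF ab k(3) v] j by simp
  next
    case 4
    then have "x\<^sup>2 + y\<^sup>2 + z\<^sup>2 + w\<^sup>2 = 2 * (2 * k)" using j by simp
    then obtain x y z w where "quat_lattice k a b x y z w" "x\<^sup>2 + y\<^sup>2 + z\<^sup>2 + w\<^sup>2 = 2 * k"
      using quat_lattice_half[OF ab k(2) v] by blast
    then show ?thesis using quat_lattice_half[OF ab k(2)] by blast
  qed
qed

text \<open>The lattice is generated as an ideal by any of its elements of norm \<open>k\<close>, so that element determines \<open>(1, 0, a, b)\<close>.\<close>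

lemma quat_lattice_norm_unique:
  assumes ab: "k dvd a\<^sup>2 + b\<^sup>2 + 1" "k dvd a'\<^sup>2 + b'\<^sup>2 + 1"
    and v: "quat_lattice k a b x y z w" "quat_lattice k a' b' x y z w"
    and n: "x\<^sup>2 + y\<^sup>2 + z\<^sup>2 + w\<^sup>2 = k" and "k > 0"
  shows "k dvd a' - a" "k dvd b' - b"
proof -
  \<comment> \<open>In the sign convention of \<open>quat_lattice_comb\<close>, this is the
    conjugate of \<open>(x, y, z, w)\<close> times \<open>(1, 0, a', b')\<close>. Membership in the
    second lattice makes it divisible by \<open>k\<close>, so multiplying
    \<open>(x, y, z, w)\<close> by the integral quotient gives \<open>(1, 0, a', b')\<close>, which
    by stability lies in the first lattice as well.\<close>
  define \<alpha> \<beta> \<gamma> \<delta> where "\<alpha> = x + a' * z + b' * w" and "\<beta> = - y + a' * w - b' * z"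
    and "\<gamma> = z - a' * x - b' * y" and "\<delta> = - w - a' * y + b' * x"
  have "quat_lattice k a' b' z w (- x) (- y)" using quat_lattice_J[OF ab(2) v(2)] .
  then have "k dvd - x - (a' * z + b' * w)" "k dvd - y - (b' * z - a' * w)" by (auto simp: quat_lattice_def)
  moreover have "k dvd z - (a' * x + b' * y)" "k dvd w - (b' * x - a' * y)"
    using v(2) by (auto simp: quat_lattice_def)
  moreover have "\<alpha> = - (- x - (a' * z + b' * w))" "\<beta> = - y - (b' * z - a' * w)"
    "\<gamma> = z - (a' * x + b' * y)" "\<delta> = - (w - (b' * x - a' * y))"
    by (simp_all add: \<alpha>_def \<beta>_def \<gamma>_def \<delta>_def)
  ultimately have "k dvd \<alpha>" "k dvd \<beta>" "k dvd \<gamma>" "k dvd \<delta>" by (simp_all only: dvd_minus_iff)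
  then obtain p q r s where p: "\<alpha> = k * p" and q: "\<beta> = k * q" and r: "\<gamma> = k * r" and s: "\<delta> = k * s"
    by (auto elim!: dvdE)
  have kk: "k * X = k * X' \<Longrightarrow> X = X'" for X X' using \<open>k > 0\<close> by simp
  have "k * (p * x - q * y + r * z - s * w) = \<alpha> * x - \<beta> * y + \<gamma> * z - \<delta> * w"
    unfolding p q r s by (simp add: algebra_simps)
  also have "\<dots> = k * 1" unfolding n[symmetric] \<alpha>_def \<beta>_def \<gamma>_def \<delta>_def
    by (simp add: power2_eq_square algebra_simps)
  finally have 1: "p * x - q * y + r * z - s * w = 1" by (rule kk)
  have "k * (p * y + q * x + r * w + s * z) = \<alpha> * y + \<beta> * x + \<gamma> * w + \<delta> * z"
    unfolding p q r s by (simp add: algebra_simps)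
  also have "\<dots> = k * 0" unfolding \<alpha>_def \<beta>_def \<gamma>_def \<delta>_def
    by (simp add: power2_eq_square algebra_simps)
  finally have 2: "p * y + q * x + r * w + s * z = 0" by (rule kk)
  have "k * (p * z + q * w - r * x - s * y) = \<alpha> * z + \<beta> * w - \<gamma> * x - \<delta> * y"
    unfolding p q r s by (simp add: algebra_simps)
  also have "\<dots> = k * a'" unfolding n[symmetric] \<alpha>_def \<beta>_def \<gamma>_def \<delta>_def
    by (simp add: power2_eq_square algebra_simps)
  finally have 3: "p * z + q * w - r * x - s * y = a'" by (rule kk)
  have "k * (p * w - q * z - r * y + s * x) = \<alpha> * w - \<beta> * z - \<gamma> * y + \<delta> * x"
    unfolding p q r s by (simp add: algebra_simps)
  also have "\<dots> = k * b'" unfolding n[symmetric] \<alpha>_def \<beta>_def \<gamma>_def \<delta>_def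
    by (simp add: power2_eq_square algebra_simps)
  finally have 4: "p * w - q * z - r * y + s * x = b'" by (rule kk)
  have "quat_lattice k a b 1 0 a' b'"
    using quat_lattice_comb[OF ab(1) v(1), of p q r s] unfolding 1 2 3 4 .
  then show "k dvd a' - a" "k dvd b' - b" by (simp_all add: quat_lattice_def)
qed

section \<open>From solutions of a^2 + b^2 = -1 modulo k to representations of k by four
  squares\<close>

definition four_square_reps :: "int \<Rightarrow> (int \<times> int \<times> int \<times> int) set" where
  "four_square_reps k = {(x, y, z, w). x\<^sup>2 + y\<^sup>2 + z\<^sup>2 + w\<^sup>2 = k}"

definition minus_one_reps :: "int \<Rightarrow> (int \<times> int) set" where
  "minus_one_reps k = {(a, b). 0 \<le> a \<and> a < k \<and> 0 \<le> b \<and> b < k \<and> k dvd a\<^sup>2 + b\<^sup>2 + 1}"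

lemma abs_le_of_square_le:
  fixes x k :: int
  assumes "x\<^sup>2 \<le> k"
  shows "\<bar>x\<bar> \<le> k"
proof -
  have "\<bar>x\<bar> \<le> \<bar>x\<bar>\<^sup>2"
  proof (cases "x = 0")
    case False
    then show ?thesis by (intro self_le_power) linarith+
  qed simp
  then show ?thesis using assms by simp
qed

lemma finite_four_square_reps: "finite (four_square_reps k)"
proof (rule finite_subset)
  show "four_square_reps k \<subseteq> {-k..k} \<times> {-k..k} \<times> {-k..k} \<times> {-k..k}"
  proof
    fix v assume v: "v \<in> four_square_reps k"
    obtain x y z w where [simp]: "v = (x, y, z, w)" by (cases v)
    have "0 \<le> x\<^sup>2" "0 \<le> y\<^sup>2" "0 \<le> z\<^sup>2" "0 \<le> w\<^sup>2" by simp_all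
    moreover have "x\<^sup>2 + y\<^sup>2 + z\<^sup>2 + w\<^sup>2 = k" using v by (simp add: four_square_reps_def)
    ultimately have "x\<^sup>2 \<le> k" "y\<^sup>2 \<le> k" "z\<^sup>2 \<le> k" "w\<^sup>2 \<le> k" by linarith+
    from this[THEN abs_le_of_square_le]
    show "v \<in> {-k..k} \<times> {-k..k} \<times> {-k..k} \<times> {-k..k}" by (auto simp: abs_le_iff)
  qed
qed simp

text \<open>A choice of a norm \<open>k\<close> element in the lattice of each solution is
  injective, because such an element determines the solution modulo \<open>k\<close>.\<close>

lemma card_minus_one_reps_le:
  assumes "k > 0" "odd k" "\<not> 3 dvd k"
  shows "card (minus_one_reps k) \<le> card (four_square_reps k)"
proof -
  define P where "P = (\<lambda>(a, b) (x, y, z, w). quat_lattice k a b x y z w \<and> x\<^sup>2 + y\<^sup>2 + z\<^sup>2 + w\<^sup>2 = k)"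
  have "\<exists>v. P ab v" if "ab \<in> minus_one_reps k" for ab
  proof -
    obtain a b where [simp]: "ab = (a, b)" by (cases ab)
    from that have "k dvd a\<^sup>2 + b\<^sup>2 + 1" by (simp add: minus_one_reps_def)
    from quat_lattice_exists_norm[OF assms this] obtain x y z w where
      "quat_lattice k a b x y z w \<and> x\<^sup>2 + y\<^sup>2 + z\<^sup>2 + w\<^sup>2 = k" by blast
    then have "P ab (x, y, z, w)" by (simp add: P_def)
    then show ?thesis ..
  qed
  then have "\<forall>ab\<in>minus_one_reps k. \<exists>v. P ab v" by blast
  from bchoice[OF this] obtain g where g: "\<And>ab. ab \<in> minus_one_reps k \<Longrightarrow> P ab (g ab)" by blast
  have "inj_on g (minus_one_reps k)"
  proof (rule inj_onI)
    fix s t assume st: "s \<in> minus_one_reps k" "t \<in> minus_one_reps k" and eq: "g s = g t"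
    obtain a b a' b' where [simp]: "s = (a, b)" "t = (a', b')" by (cases s, cases t)
    obtain x y z w where v: "g s = (x, y, z, w)" by (cases "g s")
    have ab: "0 \<le> a" "a < k" "0 \<le> b" "b < k" "k dvd a\<^sup>2 + b\<^sup>2 + 1"
      "0 \<le> a'" "a' < k" "0 \<le> b'" "b' < k" "k dvd a'\<^sup>2 + b'\<^sup>2 + 1"
      using st by (simp_all add: minus_one_reps_def)
    have Q: "quat_lattice k a b x y z w" "quat_lattice k a' b' x y z w" "x\<^sup>2 + y\<^sup>2 + z\<^sup>2 + w\<^sup>2 = k"
      using g[OF st(1)] g[OF st(2)] eq v by (simp_all add: P_def)
    have "k dvd a' - a" "k dvd b' - b"
      using quat_lattice_norm_unique[OF ab(5,10) Q assms(1)] .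
    then have "a' mod k = a mod k" "b' mod k = b mod k" by (simp_all add: mod_eq_dvd_iff)
    then show "s = t" using ab by simp
  qed
  moreover have "g ` minus_one_reps k \<subseteq> four_square_reps k"
    using g by (fastforce simp: P_def four_square_reps_def)
  ultimately show ?thesis using finite_four_square_reps by (rule card_inj_on_le)
qed

section \<open>Lower bound for the number of solutions of a^2 + b^2 = -1 modulo k\<close>

lemma finite_minus_one_reps: "finite (minus_one_reps k)"
  by (rule finite_subset[of _ "{0..<k} \<times> {0..<k}"]) (auto simp: minus_one_reps_def)

text \<open>The affine form with a sign \<open>s\<close> serves both value sets of the next
  pigeonhole argument, the squares and the numbers \<open>-1 - b\<^sup>2\<close>.\<close>

lemma inj_on_square_residues:
  assumes "prime (p::int)" "odd p" and that: "s = 1 \<or> s = -1"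
  shows "inj_on (\<lambda>a. (c + s * a\<^sup>2) mod p) {0..p div 2}"
proof (rule inj_onI)
  fix a b assume ab: "a \<in> {0..p div 2}" "b \<in> {0..p div 2}"
    and eq: "(c + s * a\<^sup>2) mod p = (c + s * b\<^sup>2) mod p"
  have "p dvd s * ((a - b) * (a + b))"
    using eq unfolding mod_eq_dvd_iff by (simp add: power2_eq_square algebra_simps)
  then have "p dvd (a - b) * (a + b)" using that by auto
  then consider "p dvd a - b" | "p dvd a + b" using assms by (auto simp: prime_dvd_mult_iff)
  then show "a = b"
  proof cases
    case 1
    then have "a mod p = b mod p" by (simp add: mod_eq_dvd_iff)
    moreover have "a < p" "b < p" using ab prime_gt_0_int[OF assms(1)] by auto
    ultimately show ?thesis using ab by simp
  next
    case 2
    have "0 \<le> a + b" "a + b < p" using ab assms(2) by (auto elim!: oddE)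
    then have "a + b = 0" using 2 zdvd_imp_le[of p "a + b"] by force
    then show ?thesis using ab by simp
  qed
qed

text \<open>The squares and the values \<open>-1 - b\<^sup>2\<close> each occupy
  \<open>(p + 1) / 2\<close> residue classes, too many to be disjoint.\<close>

lemma minus_one_sum_two_squares_mod_prime:
  assumes "prime (p::int)" "odd p"
  shows "\<exists>a b. p dvd a\<^sup>2 + b\<^sup>2 + 1"
proof -
  have "p > 1" using assms(1) by (simp add: prime_gt_1_int)
  define A where "A = (\<lambda>a. (0 + 1 * a\<^sup>2) mod p) ` {0..p div 2}"
  define B where "B = (\<lambda>a. (-1 + (-1) * a\<^sup>2) mod p) ` {0..p div 2}"
  have cA: "card A = nat (p div 2 + 1)" and cB: "card B = nat (p div 2 + 1)"
    unfolding A_def B_def by (subst card_image[OF inj_on_square_residues[OF assms]]; simp)+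
  have "A \<union> B \<subseteq> {0..<p}" using \<open>p > 1\<close> by (auto simp: A_def B_def)
  then have "card (A \<union> B) \<le> card {0..<p}" by (intro card_mono) auto
  then have "card (A \<union> B) \<le> nat p" by simp
  moreover have "nat p < card A + card B" unfolding cA cB using \<open>p > 1\<close> by linarith
  moreover have "finite A" "finite B" by (simp_all add: A_def B_def)
  ultimately have "A \<inter> B \<noteq> {}" using card_Un_disjoint[of A B] by fastforce
  then obtain a b where "a\<^sup>2 mod p = (-1 + (-1) * b\<^sup>2) mod p" by (auto simp: A_def B_def)
  then have "p dvd a\<^sup>2 + b\<^sup>2 + 1" unfolding mod_eq_dvd_iff by (simp add: algebra_simps)
  then show ?thesis by blast
qed

lemma card_sqrt_minus_one_le:
  assumes "prime (p::int)"
  shows "card {t \<in> {0..<p}. p dvd 1 + t\<^sup>2} \<le> 2"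
proof (cases "{t \<in> {0..<p}. p dvd 1 + t\<^sup>2} = {}")
  case False
  then obtain u where u: "u \<in> {0..<p}" "p dvd 1 + u\<^sup>2" by auto
  have "{t \<in> {0..<p}. p dvd 1 + t\<^sup>2} \<subseteq> {u, (- u) mod p}"
  proof
    fix t assume t: "t \<in> {t \<in> {0..<p}. p dvd 1 + t\<^sup>2}"
    have "p dvd (1 + t\<^sup>2) - (1 + u\<^sup>2)" using t u by (intro dvd_diff) auto
    then have "p dvd (t - u) * (t - (- u))" by (simp add: power2_eq_square algebra_simps)
    then have "p dvd t - u \<or> p dvd t - (- u)" using assms by (simp add: prime_dvd_mult_iff)
    then have "t mod p = u mod p \<or> t mod p = (- u) mod p" by (simp only: mod_eq_dvd_iff)
    then show "t \<in> {u, (- u) mod p}" using t u by simp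
  qed
  then have "card {t \<in> {0..<p}. p dvd 1 + t\<^sup>2} \<le> card {u, (- u) mod p}" by (intro card_mono) auto
  also have "\<dots> \<le> 2" by (simp add: card_insert_if)
  finally show ?thesis .
qed (simp only: card.empty)

text \<open>The linear map of multiplication by \<open>a + i b\<close> has determinant
  \<open>a\<^sup>2 + b\<^sup>2\<close>, which is \<open>-1\<close> modulo \<open>p\<close>, so it is
  invertible modulo \<open>p\<close>.\<close>

lemma dvd_both_of_norm_unit:
  fixes p :: int
  assumes "p dvd a\<^sup>2 + b\<^sup>2 + 1" and "p dvd a * c - b * d" "p dvd a * d + b * c"
  shows "p dvd c" "p dvd d"
proof -
  have "p dvd c * (a\<^sup>2 + b\<^sup>2 + 1) - a * (a * c - b * d) - b * (a * d + b * c)"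
    by (rule dvd_diff[OF dvd_diff[OF dvd_mult[OF assms(1)] dvd_mult[OF assms(2)]] dvd_mult[OF assms(3)]])
  then show "p dvd c" by (simp add: power2_eq_square algebra_simps)
  have "p dvd d * (a\<^sup>2 + b\<^sup>2 + 1) + b * (a * c - b * d) - a * (a * d + b * c)"
    by (rule dvd_diff[OF dvd_add[OF dvd_mult[OF assms(1)] dvd_mult[OF assms(2)]] dvd_mult[OF assms(3)]])
  then show "p dvd d" by (simp add: power2_eq_square algebra_simps)
qed

text \<open>Rotating one solution by the rational points \<open>((1 - t\<^sup>2) / (1 + t\<^sup>2), 2 t / (1 + t\<^sup>2))\<close> of the
  unit circle gives almost all solutions.\<close>

lemma card_minus_one_reps_prime:
  assumes "prime (p::int)" "odd p"
  shows "nat p - 2 \<le> card (minus_one_reps p)"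
proof -
  have p1: "p > 1" using assms(1) by (simp add: prime_gt_1_int)
  obtain a b where ab: "p dvd a\<^sup>2 + b\<^sup>2 + 1" using minus_one_sum_two_squares_mod_prime[OF assms] by blast
  define T where "T = {t \<in> {0..<p}. \<not> p dvd 1 + t\<^sup>2}"
  have "\<exists>i. p dvd (1 + t\<^sup>2) * i - 1" if "t \<in> T" for t
  proof -
    have "coprime (1 + t\<^sup>2) p" using that assms(1) by (metis (no_types, lifting) T_def coprime_commute mem_Collect_eq prime_imp_coprime)
    then show ?thesis using cong_solve_coprime_int[of "1 + t\<^sup>2" p] by (auto simp: cong_iff_dvd_diff)
  qed
  then obtain iv where iv: "\<And>t. t \<in> T \<Longrightarrow> p dvd (1 + t\<^sup>2) * iv t - 1" by metis
  define c d where "c = (\<lambda>t. (1 - t\<^sup>2) * iv t)" and "d = (\<lambda>t. 2 * t * iv t)"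
  define g where "g = (\<lambda>t. ((a * c t - b * d t) mod p, (a * d t + b * c t) mod p))"
  have "g ` T \<subseteq> minus_one_reps p"
  proof (rule image_subsetI)
    fix t assume t: "t \<in> T"
    obtain x y where xy: "g t = (x, y)" by (metis surj_pair)
    obtain r where r: "(1 + t\<^sup>2) * iv t - 1 = p * r" using iv[OF t] by auto
    obtain q where q: "a\<^sup>2 + b\<^sup>2 + 1 = p * q" using ab by auto
    have "(c t)\<^sup>2 + (d t)\<^sup>2 = ((1 + t\<^sup>2) * iv t)\<^sup>2"
      by (simp add: c_def d_def power2_eq_square algebra_simps)
    also have "(1 + t\<^sup>2) * iv t = 1 + p * r" using r by simp
    finally have cd: "(c t)\<^sup>2 + (d t)\<^sup>2 = (1 + p * r)\<^sup>2" .
    have "(a * c t - b * d t)\<^sup>2 + (a * d t + b * c t)\<^sup>2 + 1 = (a\<^sup>2 + b\<^sup>2 + 1 - 1) * ((c t)\<^sup>2 + (d t)\<^sup>2) + 1"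
      by (simp add: power2_eq_square algebra_simps)
    also have "\<dots> = p * (q * (1 + p * r)\<^sup>2 - r * (2 + p * r))"
      unfolding cd q by (simp add: power2_eq_square algebra_simps)
    finally have "p dvd (a * c t - b * d t)\<^sup>2 + (a * d t + b * c t)\<^sup>2 + 1" by simp
    moreover have "[x\<^sup>2 + y\<^sup>2 + 1 = (a * c t - b * d t)\<^sup>2 + (a * d t + b * c t)\<^sup>2 + 1] (mod p)"
      using xy by (intro cong_add cong_pow cong_refl) (auto simp: g_def cong_def)
    ultimately have "p dvd x\<^sup>2 + y\<^sup>2 + 1" using cong_dvd_iff by blast
    then show "g t \<in> minus_one_reps p"
      using xy p1 by (auto simp: minus_one_reps_def g_def)
  qed
  moreover have "inj_on g T"
  proof (rule inj_onI)
    fix t u assume t: "t \<in> T" and u: "u \<in> T" and eq: "g t = g u"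
    have "p dvd a * (c t - c u) - b * (d t - d u)" "p dvd a * (d t - d u) + b * (c t - c u)"
      using eq by (auto simp: g_def mod_eq_dvd_iff algebra_simps)
    from dvd_both_of_norm_unit[OF ab this] have cd: "p dvd c t - c u" "p dvd d t - d u" .
    obtain r where r: "c t - c u = p * r" using cd by auto
    obtain s where s: "d t - d u = p * s" using cd by auto
    obtain v where v: "(1 + t\<^sup>2) * iv t - 1 = p * v" using iv[OF t] by auto
    obtain w where w: "(1 + u\<^sup>2) * iv u - 1 = p * w" using iv[OF u] by auto
    \<comment> \<open>Modulo \<open>p\<close>, \<open>c t + 1\<close> is \<open>2 * iv t\<close> and
      \<open>d t\<close> is \<open>t\<close> times \<open>2 * iv t\<close>. The point of the circle
      therefore recovers its parameter by the division \<open>d t / (c t + 1)\<close>.\<close>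
    have "2 * iv t - 2 * iv u = (c t - c u) + ((1 + t\<^sup>2) * iv t - 1) - ((1 + u\<^sup>2) * iv u - 1)"
      by (simp add: c_def algebra_simps)
    also have "\<dots> = p * (r + v - w)" unfolding r v w by (simp add: algebra_simps)
    finally have i: "2 * iv u = 2 * iv t - p * (r + v - w)" by simp
    have "(t - u) * 2 * iv t = d t - d u - u * (2 * iv t - 2 * iv u)"
      by (simp add: d_def algebra_simps)
    also have "\<dots> = p * (s - u * (r + v - w))" unfolding s i by (simp add: algebra_simps)
    finally have "p dvd (t - u) * 2 * iv t" by simp
    moreover have "\<not> p dvd iv t"
    proof
      assume "p dvd iv t"
      then have "p dvd (1 + t\<^sup>2) * iv t - ((1 + t\<^sup>2) * iv t - 1)"
        by (intro dvd_diff[OF dvd_mult iv[OF t]])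
      then show False using p1 by simp
    qed
    moreover have "\<not> p dvd 2" using p1 assms(2) zdvd_imp_le[of p 2] by (auto elim!: oddE)
    ultimately have "p dvd t - u" using assms(1) by (simp only: prime_dvd_mult_iff) blast
    then have "t mod p = u mod p" by (simp add: mod_eq_dvd_iff)
    then show "t = u" using t u by (simp add: T_def)
  qed
  ultimately have le: "card T \<le> card (minus_one_reps p)"
    using finite_minus_one_reps by (metis card_inj_on_le)
  have "T = {0..<p} - {t \<in> {0..<p}. p dvd 1 + t\<^sup>2}" by (auto simp: T_def)
  then have "card T = nat p - card {t \<in> {0..<p}. p dvd 1 + t\<^sup>2}"
    by (metis (no_types, lifting) card_Diff_subset card_atLeastLessThan_int diff_zero finite_atLeastLessThan_int finite_subset mem_Collect_eq subsetI)
  then show ?thesis using le card_sqrt_minus_one_le[OF assms(1)] by linarith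
qed

text \<open>Solutions modulo \<open>m * p\<close> are grouped by their reduction modulo
  \<open>m\<close>; the pair of leading digits \<open>\<alpha>\<close>, \<open>\<beta>\<close>
  parametrises the fibre over a given solution.\<close>

lemma card_minus_one_reps_lift:
  assumes "m > 0" "p > 0"
    and lift: "\<And>a b. (a, b) \<in> minus_one_reps m \<Longrightarrow>
      C \<le> card {(\<alpha>, \<beta>). (\<alpha>, \<beta>) \<in> {0..<p} \<times> {0..<p} \<and> m * p dvd (a + m * \<alpha>)\<^sup>2 + (b + m * \<beta>)\<^sup>2 + 1}"
  shows "C * card (minus_one_reps m) \<le> card (minus_one_reps (m * p))"
proof -
  define T where "T = (\<lambda>(a, b). {(\<alpha>, \<beta>). (\<alpha>, \<beta>) \<in> {0..<p} \<times> {0..<p} \<and> m * p dvd (a + m * \<alpha>)\<^sup>2 + (b + m * \<beta>)\<^sup>2 + 1})"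
  define g where "g = (\<lambda>((a, b), (\<alpha>, \<beta>)). (a + m * \<alpha>, b + m * \<beta>))"
  have fT: "finite (T s)" for s
    by (rule finite_subset[of _ "{0..<p} \<times> {0..<p}"]) (auto simp: T_def split: prod.splits)
  have "C * card (minus_one_reps m) = (\<Sum>s\<in>minus_one_reps m. C)" by simp
  also have "\<dots> \<le> (\<Sum>s\<in>minus_one_reps m. card (T s))"
    using lift by (intro sum_mono) (auto simp: T_def)
  also have "\<dots> = card (Sigma (minus_one_reps m) T)"
    using fT finite_minus_one_reps by (subst card_SigmaI) auto
  also have "\<dots> \<le> card (minus_one_reps (m * p))"
  proof (rule card_inj_on_le[OF _ _ finite_minus_one_reps])
    have key: "a = c \<and> \<alpha> = \<gamma>" if "a + m * \<alpha> = c + m * \<gamma>" "0 \<le> a" "a < m" "0 \<le> c" "c < m" for a \<alpha> c \<gamma>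
    proof -
      have "(a + m * \<alpha>) mod m = (c + m * \<gamma>) mod m" by (simp only: that(1))
      then have "a mod m = c mod m" by simp
      then have "a = c" using that(2-5) by simp
      then show ?thesis using that(1) assms(1) by simp
    qed
    show "inj_on g (Sigma (minus_one_reps m) T)"
    proof (rule inj_onI)
      fix s t assume st: "s \<in> Sigma (minus_one_reps m) T" "t \<in> Sigma (minus_one_reps m) T" and eq: "g s = g t"
      obtain a b \<alpha> \<beta> where s: "s = ((a, b), (\<alpha>, \<beta>))" by (metis surj_pair)
      obtain c d \<gamma> \<delta> where t: "t = ((c, d), (\<gamma>, \<delta>))" by (metis surj_pair)
      show "s = t"
        using key[of a \<alpha> c \<gamma>] key[of b \<beta> d \<delta>] st eq by (simp add: s t g_def minus_one_reps_def)
    qed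
    show "g ` Sigma (minus_one_reps m) T \<subseteq> minus_one_reps (m * p)"
    proof (rule image_subsetI)
      fix s assume s': "s \<in> Sigma (minus_one_reps m) T"
      obtain a b \<alpha> \<beta> where s: "s = ((a, b), (\<alpha>, \<beta>))" by (metis surj_pair)
      have bd: "0 \<le> x + m * y \<and> x + m * y < m * p" if "0 \<le> x" "x < m" "0 \<le> y" "y < p" for x y
      proof -
        have "x + m * y < m * (y + 1)" using that by (simp add: algebra_simps)
        also have "\<dots> \<le> m * p" using that by (intro mult_left_mono) auto
        finally show ?thesis using that by simp
      qed
      show "g s \<in> minus_one_reps (m * p)"
        using s' bd[of a \<alpha>] bd[of b \<beta>] by (simp add: s g_def T_def minus_one_reps_def)
    qed
  qed
  finally show ?thesis .
qed

text \<open>Hensel lifting. As \<open>p\<close> divides \<open>m\<close>, the quadratic terms in the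
  digits vanish modulo \<open>m * p\<close>, which leaves the condition that \<open>p\<close>
  divides \<open>x + 2 * (a * \<alpha> + b * \<beta>)\<close>. Since
  \<open>a\<^sup>2 + b\<^sup>2\<close> is \<open>-1\<close> modulo \<open>p\<close>, one of
  \<open>a\<close>, \<open>b\<close> is invertible; the other digit is free and takes
  \<open>p\<close> values.\<close>

lemma card_minus_one_reps_mult_dvd:
  assumes p: "prime (p::int)" "odd p" and m: "m > 0" "p dvd m"
  shows "nat p * card (minus_one_reps m) \<le> card (minus_one_reps (m * p))"
proof (rule card_minus_one_reps_lift)
  have p1: "p > 1" using p(1) by (simp add: prime_gt_1_int)
  then show "0 < p" by simp
  show "0 < m" by fact
  have lin: "\<exists>\<alpha>\<in>{0..<p}. p dvd x + 2 * (a * \<alpha> + b * \<beta>)" if "\<not> p dvd a" for x a b \<beta>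
  proof -
    have "\<not> p dvd 2" using p1 p(2) zdvd_imp_le[of p 2] by (auto elim!: oddE)
    then have "\<not> p dvd 2 * a" using that p(1) by (simp add: prime_dvd_mult_iff)
    then have "coprime (2 * a) p" using p(1) by (metis coprime_commute prime_imp_coprime)
    then obtain y where "[2 * a * y = 1] (mod p)" using cong_solve_coprime_int by blast
    then obtain q where q: "2 * a * y - 1 = p * q" by (auto simp: cong_iff_dvd_diff)
    define \<alpha> where "\<alpha> = (- (x + 2 * b * \<beta>) * y) mod p"
    have "p dvd \<alpha> - (- (x + 2 * b * \<beta>) * y)" unfolding \<alpha>_def by (simp flip: mod_eq_dvd_iff)
    then obtain r where r: "\<alpha> = - (x + 2 * b * \<beta>) * y + p * r" by (metis dvd_def add.commute diff_add_cancel)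
    have "x + 2 * (a * \<alpha> + b * \<beta>) = (x + 2 * b * \<beta>) * (1 - 2 * a * y) + p * (2 * a * r)"
      unfolding r by (simp add: algebra_simps)
    also have "\<dots> = p * (2 * a * r - (x + 2 * b * \<beta>) * q)" using q by (simp add: algebra_simps)
    finally have "p dvd x + 2 * (a * \<alpha> + b * \<beta>)" by simp
    moreover have "\<alpha> \<in> {0..<p}" using p1 by (simp add: \<alpha>_def)
    ultimately show ?thesis by blast
  qed
  fix a b assume "(a, b) \<in> minus_one_reps m"
  then obtain x where x: "a\<^sup>2 + b\<^sup>2 + 1 = m * x" by (auto simp: minus_one_reps_def)
  let ?T = "{(\<alpha>, \<beta>). (\<alpha>, \<beta>) \<in> {0..<p} \<times> {0..<p} \<and> m * p dvd (a + m * \<alpha>)\<^sup>2 + (b + m * \<beta>)\<^sup>2 + 1}"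
  have fT: "finite ?T" by (rule finite_subset[of _ "{0..<p} \<times> {0..<p}"]) auto
  obtain e where e: "m = p * e" using m(2) by auto
  have mem: "(\<alpha>, \<beta>) \<in> ?T" if "\<alpha> \<in> {0..<p}" "\<beta> \<in> {0..<p}" "p dvd x + 2 * (a * \<alpha> + b * \<beta>)" for \<alpha> \<beta>
  proof -
    have "(a + m * \<alpha>)\<^sup>2 + (b + m * \<beta>)\<^sup>2 + 1 = m * (x + 2 * (a * \<alpha> + b * \<beta>)) + m * m * (\<alpha>\<^sup>2 + \<beta>\<^sup>2)"
      using x by (simp add: power2_eq_square algebra_simps)
    also have "m * p dvd \<dots>"
      by (rule dvd_add[OF mult_dvd_mono[OF dvd_refl that(3)] dvd_mult2[OF mult_dvd_mono[OF dvd_refl m(2)]]])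
    finally show ?thesis using that by simp
  qed
  have "\<not> (p dvd a \<and> p dvd b)"
  proof
    assume "p dvd a \<and> p dvd b"
    then have "p dvd (a\<^sup>2 + b\<^sup>2 + 1) - (a * a + b * b)" using x m(2) by (intro dvd_diff) auto
    then show False using p1 by (simp add: power2_eq_square)
  qed
  then show "nat p \<le> card ?T"
  proof (cases "p dvd a")
    case False
    then have "\<forall>\<beta>. \<exists>\<alpha>. \<alpha> \<in> {0..<p} \<and> p dvd x + 2 * (a * \<alpha> + b * \<beta>)" using lin by blast
    then obtain h where h: "\<And>\<beta>. h \<beta> \<in> {0..<p} \<and> p dvd x + 2 * (a * h \<beta> + b * \<beta>)" by metis
    have "card ((\<lambda>\<beta>. (h \<beta>, \<beta>)) ` {0..<p}) \<le> card ?T"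
      using h by (intro card_mono[OF fT] image_subsetI mem) auto
    then show ?thesis by (subst (asm) card_image) (auto simp: inj_on_def)
  next
    case True
    then have "\<forall>\<beta>. \<exists>\<alpha>. \<alpha> \<in> {0..<p} \<and> p dvd x + 2 * (b * \<alpha> + a * \<beta>)"
      using lin \<open>\<not> (p dvd a \<and> p dvd b)\<close> by blast
    then obtain h where h: "\<And>\<beta>. h \<beta> \<in> {0..<p} \<and> p dvd x + 2 * (b * h \<beta> + a * \<beta>)" by metis
    have "card ((\<lambda>\<beta>. (\<beta>, h \<beta>)) ` {0..<p}) \<le> card ?T"
      using h by (intro card_mono[OF fT] image_subsetI mem) (auto simp: add.commute)
    then show ?thesis by (subst (asm) card_image) (auto simp: inj_on_def)
  qed
qed

text \<open>Chinese remainder theorem: the lifts of a solution modulo \<open>m\<close> correspond to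
  independent solutions modulo the new prime \<open>p\<close>, of which there are at least
  \<open>p - 2\<close>.\<close>

lemma card_minus_one_reps_mult_coprime:
  assumes p: "prime (p::int)" "odd p" and m: "m > 0" "\<not> p dvd m"
  shows "(nat p - 2) * card (minus_one_reps m) \<le> card (minus_one_reps (m * p))"
proof (rule card_minus_one_reps_lift)
  have p1: "p > 1" using p(1) by (simp add: prime_gt_1_int)
  then show "0 < p" by simp
  show "0 < m" by fact
  have cop: "coprime m p" using m(2) p(1) by (metis coprime_commute prime_imp_coprime)
  obtain y where "[m * y = 1] (mod p)" using cong_solve_coprime_int[OF cop] by blast
  then obtain q where q: "m * y - 1 = p * q" by (auto simp: cong_iff_dvd_diff)
  fix a b assume ab: "(a, b) \<in> minus_one_reps m"
  let ?T = "{(\<alpha>, \<beta>). (\<alpha>, \<beta>) \<in> {0..<p} \<times> {0..<p} \<and> m * p dvd (a + m * \<alpha>)\<^sup>2 + (b + m * \<beta>)\<^sup>2 + 1}"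
  have fT: "finite ?T" by (rule finite_subset[of _ "{0..<p} \<times> {0..<p}"]) auto
  have dm: "m dvd (a + m * \<alpha>)\<^sup>2 + (b + m * \<beta>)\<^sup>2 + 1" for \<alpha> \<beta>
  proof -
    have "(a + m * \<alpha>)\<^sup>2 + (b + m * \<beta>)\<^sup>2 + 1 = (a\<^sup>2 + b\<^sup>2 + 1) + m * (\<alpha> * (2 * a + m * \<alpha>) + \<beta> * (2 * b + m * \<beta>))"
      by (simp add: power2_eq_square algebra_simps)
    moreover have "m dvd a\<^sup>2 + b\<^sup>2 + 1" using ab by (simp add: minus_one_reps_def)
    ultimately show ?thesis by (simp only:) (intro dvd_add[OF _ dvd_triv_left])
  qed
  define h where "h = (\<lambda>a c. ((c - a) * y) mod p)"
  have h: "p dvd a + m * h a c - c" "h a c \<in> {0..<p}" for a c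
  proof -
    have "p dvd h a c - (c - a) * y" unfolding h_def by (simp flip: mod_eq_dvd_iff)
    then obtain r where r: "h a c = (c - a) * y + p * r" by (metis dvd_def add.commute diff_add_cancel)
    have "a + m * h a c - c = (c - a) * (m * y - 1) + p * (m * r)" unfolding r by (simp add: algebra_simps)
    also have "\<dots> = p * ((c - a) * q + m * r)" unfolding q by (simp add: algebra_simps)
    finally show "p dvd a + m * h a c - c" by simp
    show "h a c \<in> {0..<p}" using p1 by (simp add: h_def)
  qed
  have "card (minus_one_reps p) \<le> card ?T"
  proof (rule card_inj_on_le[OF _ _ fT])
    show "inj_on (\<lambda>(c, d). (h a c, h b d)) (minus_one_reps p)"
    proof (rule inj_onI, clarsimp simp: minus_one_reps_def)
      have key: "c = c'" if "h a c = h a c'" "0 \<le> c" "c < p" "0 \<le> c'" "c' < p" for a c c'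
      proof -
        have "p dvd (a + m * h a c - c) - (a + m * h a c' - c')" by (intro dvd_diff h)
        then have "c' mod p = c mod p" using that(1) by (simp add: mod_eq_dvd_iff)
        then show ?thesis using that(2-5) by simp
      qed
      fix c d c' d' assume "0 \<le> c" "c < p" "0 \<le> c'" "c' < p" "0 \<le> d" "d < p" "0 \<le> d'" "d' < p"
        "h a c = h a c'" "h b d = h b d'"
      then show "c = c' \<and> d = d'" using key by blast
    qed
    show "(\<lambda>(c, d). (h a c, h b d)) ` minus_one_reps p \<subseteq> ?T"
    proof (clarsimp simp: minus_one_reps_def, intro conjI)
      fix c d assume cd: "p dvd c\<^sup>2 + d\<^sup>2 + 1"
      show "0 \<le> h a c" "h a c < p" "0 \<le> h b d" "h b d < p" using h(2)[of a c] h(2)[of b d] by auto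
      obtain r s where r: "a + m * h a c = c + p * r" and s: "b + m * h b d = d + p * s"
        using h(1)[of a c] h(1)[of b d] by (metis dvd_def add.commute diff_add_cancel)
      have "(a + m * h a c)\<^sup>2 + (b + m * h b d)\<^sup>2 + 1 = (c\<^sup>2 + d\<^sup>2 + 1) + p * (r * (2 * c + p * r) + s * (2 * d + p * s))"
        unfolding r s by (simp add: power2_eq_square algebra_simps)
      then have "p dvd (a + m * h a c)\<^sup>2 + (b + m * h b d)\<^sup>2 + 1"
        by (simp only:) (intro dvd_add[OF cd dvd_triv_left])
      then show "m * p dvd (a + m * h a c)\<^sup>2 + (b + m * h b d)\<^sup>2 + 1" 
        using dm cop by (intro divides_mult) auto
    qed
  qed
  then show "nat p - 2 \<le> card ?T" using card_minus_one_reps_prime[OF p] by linarith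
qed

text \<open>One prime is split off at a time: a repeated prime contributes at least the factor
  \<open>p\<close>, a new one at least \<open>p - 2\<close>.\<close>

lemma card_minus_one_reps_ge_prod:
  assumes "k > 0" "odd k" "\<not> 3 dvd k"
  shows "real_of_int k * (\<Prod>p\<in>prime_factors k. 1 - 2 / real_of_int p) \<le> real (card (minus_one_reps k))"
  using assms
proof (induction "nat k" arbitrary: k rule: less_induct)
  case less
  show ?case
  proof (cases "k = 1")
    case True
    have "minus_one_reps 1 = {(0, 0)}" by (auto simp: minus_one_reps_def)
    then show ?thesis using True by simp
  next
    case False
    then obtain p where p: "prime p" "p dvd k" using less.prems prime_divisor_exists[of k] by auto
    then obtain m where km: "k = m * p" by (metis dvd_def mult.commute)
    have p1: "p > 1" using p(1) by (simp add: prime_gt_1_int)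
    have m0: "m > 0" using less.prems(1) p1 km by (simp add: zero_less_mult_iff)
    have lt: "nat m < nat k" using km m0 p1 by simp
    have odd: "odd p" "odd m" "\<not> 3 dvd m" using less.prems km by auto
    have IH: "real_of_int m * (\<Prod>p\<in>prime_factors m. 1 - 2 / real_of_int p) \<le> real (card (minus_one_reps m))"
      by (rule less.hyps[OF lt m0 odd(2,3)])
    have pf: "prime_factors k = insert p (prime_factors m)"
      using p(1) m0 km by (simp add: prime_factors_product) (metis prime_prime_factors prime_factors_product insert_is_Un sup_commute)
    show ?thesis
    proof (cases "p dvd m")
      case True
      then have "p \<in> prime_factors m" using p(1) m0 by (simp add: prime_factors_dvd)
      then have "prime_factors k = prime_factors m" using pf by auto
      then have "real_of_int k * (\<Prod>p\<in>prime_factors k. 1 - 2 / real_of_int p)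
        = real_of_int p * (real_of_int m * (\<Prod>p\<in>prime_factors m. 1 - 2 / real_of_int p))"
        using km by simp
      also have "\<dots> \<le> real_of_int p * real (card (minus_one_reps m))"
        using IH p1 by (intro mult_left_mono) auto
      also have "\<dots> = real (nat p * card (minus_one_reps m))" using p1 by simp
      also have "\<dots> \<le> real (card (minus_one_reps k))"
        unfolding km using card_minus_one_reps_mult_dvd[OF p(1) odd(1) m0 True] by (simp only: of_nat_le_iff)
      finally show ?thesis .
    next
      case False
      then have "p \<notin> prime_factors m" by auto
      then have "real_of_int k * (\<Prod>p\<in>prime_factors k. 1 - 2 / real_of_int p)
        = (real_of_int p - 2) * (real_of_int m * (\<Prod>p\<in>prime_factors m. 1 - 2 / real_of_int p))"
        using km pf p1 by (simp add: field_simps)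
      also have "\<dots> \<le> (real_of_int p - 2) * real (card (minus_one_reps m))"
        using IH p1 by (intro mult_left_mono) auto
      also have "\<dots> = real ((nat p - 2) * card (minus_one_reps m))" using p1 by (simp add: of_nat_diff)
      also have "\<dots> \<le> real (card (minus_one_reps k))"
        unfolding km using card_minus_one_reps_mult_coprime[OF p(1) odd(1) m0 False] by (simp only: of_nat_le_iff)
      finally show ?thesis .
    qed
  qed
qed

text \<open>The element with \<open>j\<close> smaller ones in the set is at least
  \<open>2 * j + 5\<close>, so the product dominates the telescoping product of
  \<open>(2 * j + 3) / (2 * j + 5)\<close>.\<close>

lemma prod_one_minus_two_div_ge:
  fixes P :: "int set"
  assumes "finite P" "\<And>p. p \<in> P \<Longrightarrow> odd p \<and> p \<ge> 5"
  shows "3 / (2 * real (card P) + 3) \<le> (\<Prod>p\<in>P. 1 - 2 / real_of_int p)"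
  using assms
proof (induction P rule: finite_linorder_max_induct)
  case (insert b A)
  have "A \<subseteq> (\<lambda>j. 2 * int j + 5) ` {..<nat ((b - 5) div 2)}"
  proof
    fix a assume a: "a \<in> A"
    then have "odd a" "a \<ge> 5" "a < b" "odd b" using insert by auto
    then have "a = 2 * int (nat ((a - 5) div 2)) + 5" "nat ((a - 5) div 2) < nat ((b - 5) div 2)"
      by (auto elim!: oddE)
    then show "a \<in> (\<lambda>j. 2 * int j + 5) ` {..<nat ((b - 5) div 2)}" by blast
  qed
  then have "card A \<le> card ((\<lambda>j. 2 * int j + 5) ` {..<nat ((b - 5) div 2)})" by (intro card_mono) auto
  also have "\<dots> \<le> nat ((b - 5) div 2)" using card_image_le[of "{..<nat ((b - 5) div 2)}"] by simp
  finally have "2 * int (card A) + 5 \<le> b" using insert.prems[of b] by auto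
  then have b: "2 * real (card A) + 5 \<le> real_of_int b" by linarith
  have "b \<notin> A" using insert by auto
  have "3 / (2 * real (card (insert b A)) + 3) = (2 * real (card A) + 3) / (2 * real (card A) + 5) * (3 / (2 * real (card A) + 3))"
  proof -
    have "card (insert b A) = card A + 1" using \<open>b \<notin> A\<close> insert.hyps(1) by simp
    moreover have "3 / (2 * (x + 1) + 3) = (2 * x + 3) / (2 * x + 5) * (3 / (2 * x + 3))" if "x \<ge> 0" for x :: real
      using that by (simp add: divide_simps) (simp add: algebra_simps)
    ultimately show ?thesis by (simp only: of_nat_add of_nat_1 of_nat_0_le_iff)
  qed
  also have "\<dots> \<le> (1 - 2 / real_of_int b) * (\<Prod>p\<in>A. 1 - 2 / real_of_int p)"
  proof (rule mult_mono)
    have "(2 * real (card A) + 3) / (2 * real (card A) + 5) = 1 - 2 / (2 * real (card A) + 5)"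
      by (simp add: field_simps)
    also have "\<dots> \<le> 1 - 2 / real_of_int b" using b by (intro diff_left_mono divide_left_mono) auto
    finally show "(2 * real (card A) + 3) / (2 * real (card A) + 5) \<le> 1 - 2 / real_of_int b" .
    show "0 \<le> 1 - 2 / real_of_int b" using b by (simp add: field_simps)
  qed (use insert in auto)
  finally show ?case using \<open>b \<notin> A\<close> insert.hyps(1) by simp
qed simp

lemma two_power_card_prime_factors_le:
  assumes "(k::int) > 0"
  shows "2 ^ card (prime_factors k) \<le> k"
proof -
  have "(2::int) ^ card (prime_factors k) = (\<Prod>p\<in>prime_factors k. 2)" by simp
  also have "\<dots> \<le> (\<Prod>p\<in>prime_factors k. p ^ multiplicity p k)"
  proof (rule prod_mono, safe)
    fix p assume p: "p \<in> prime_factors k"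
    then have "2 \<le> p" by (intro prime_ge_2_int) auto
    moreover have "multiplicity p k \<noteq> 0" using p by (simp add: prime_factors_multiplicity)
    ultimately show "2 \<le> p ^ multiplicity p k"
      using self_le_power[of p "multiplicity p k"] by linarith
  qed simp
  also have "\<dots> = k" using assms by (simp add: prod_prime_factors)
  finally show ?thesis .
qed

lemma card_four_square_reps_ge:
  assumes k: "k > 0" "odd k" "\<not> 3 dvd k"
  shows "real_of_int k powr (15/16) / 22 \<le> real (card (four_square_reps k))"
proof -
  define \<omega> where "\<omega> = card (prime_factors k)"
  \<comment> \<open>The inequality \<open>ln L \<le> L - 1\<close> turns the logarithmic bound on
    the number of prime factors into a bound linear in \<open>L\<close>; this is where the power
    \<open>1/16\<close> is lost.\<close>
  define L where "L = real_of_int k powr (1/16)"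
  have k1: "real_of_int k \<ge> 1" using k(1) by simp
  then have L1: "L \<ge> 1" by (simp add: L_def ge_one_powr_ge_zero)
  have "(2::real) ^ \<omega> = real_of_int (2 ^ \<omega>)" by simp
  also have "\<dots> \<le> real_of_int k"
    unfolding \<omega>_def using two_power_card_prime_factors_le[OF k(1)] by (simp only: of_int_le_iff)
  finally have "ln ((2::real) ^ \<omega>) \<le> ln (real_of_int k)" using k1 by (subst ln_le_cancel_iff) auto
  then have "real \<omega> * ln 2 \<le> ln (real_of_int k)" by (simp add: ln_realpow)
  also have "\<dots> = 16 * ln L" using k1 by (simp add: L_def ln_powr)
  also have "\<dots> \<le> 16 * (L - 1)" using ln_le_minus_one[of L] L1 by simp
  finally have 1: "real \<omega> * ln 2 \<le> 16 * (L - 1)" .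
  have "exp (1/2 :: real) ^ 2 \<le> 2 ^ 2"
    using exp_le by (simp flip: exp_of_nat_mult)
  then have "exp (1/2 :: real) \<le> 2" by (rule power2_le_imp_le) simp
  then have "1/2 \<le> ln (2::real)" by (subst ln_ge_iff) auto
  then have "real \<omega> * (1/2) \<le> real \<omega> * ln 2" by (intro mult_left_mono) auto
  also note 1
  finally have w: "2 * real \<omega> + 3 \<le> 64 * L" by simp
  have "real_of_int k powr (15/16) * L = real_of_int k powr (15/16 + 1/16)" unfolding L_def by (rule powr_add[symmetric])
  then have "real_of_int k powr (15/16) * L = real_of_int k" using k1 by simp
  then have "real_of_int k powr (15/16) / 22 = real_of_int k * (1 / (22 * L))" using L1 by (simp add: field_simps)
  \<comment> \<open>From \<open>2 * \<omega> + 3 \<le> 64 * L\<close> and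
    \<open>64 / 3 \<le> 22\<close>.\<close>
  also have "\<dots> \<le> real_of_int k * (3 / (2 * real \<omega> + 3))"
    using w L1 k1 by (intro mult_left_mono) (auto simp: field_simps)
  also have "\<dots> \<le> real_of_int k * (\<Prod>p\<in>prime_factors k. 1 - 2 / real_of_int p)"
  proof (intro mult_left_mono)
    show "3 / (2 * real \<omega> + 3) \<le> (\<Prod>p\<in>prime_factors k. 1 - 2 / real_of_int p)"
      unfolding \<omega>_def
    proof (rule prod_one_minus_two_div_ge)
      fix p assume p: "p \<in> prime_factors k"
      then have "p dvd k" "prime p" by auto
      then have "odd p" "p \<noteq> 3" "p \<ge> 2" using k by (auto dest: dvd_trans intro: prime_ge_2_int)
      then show "odd p \<and> p \<ge> 5" by (auto elim!: oddE)
    qed simp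
  qed (use k1 in simp)
  also have "\<dots> \<le> real (card (minus_one_reps k))" by (rule card_minus_one_reps_ge_prod[OF k])
  also have "\<dots> \<le> real (card (four_square_reps k))"
    using card_minus_one_reps_le[OF k] by simp
  finally show ?thesis .
qed

section \<open>Sums of at least five squares\<close>

text \<open>Lists make the dimension a natural number on which induction is possible, unlike the
  index type of a vector.\<close>

definition square_sum_lists :: "nat \<Rightarrow> int \<Rightarrow> int list set" where
  "square_sum_lists d n = {xs. length xs = d \<and> (\<Sum>x\<leftarrow>xs. x\<^sup>2) = n}"

lemma square_le_sum_list:
  fixes xs :: "int list"
  shows "x \<in> set xs \<Longrightarrow> x\<^sup>2 \<le> (\<Sum>x\<leftarrow>xs. x\<^sup>2)"
proof (induction xs)
  case (Cons a xs)
  have "0 \<le> (\<Sum>x\<leftarrow>xs. x\<^sup>2)" by (rule sum_list_nonneg) auto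
  then show ?case using Cons by (auto intro: order_trans)
qed simp

lemma finite_square_sum_lists: "finite (square_sum_lists d n)"
proof (rule finite_subset)
  show "square_sum_lists d n \<subseteq> {xs. set xs \<subseteq> {-n..n} \<and> length xs = d}"
  proof (clarsimp simp: square_sum_lists_def)
    fix xs :: "int list" and x assume "x \<in> set xs"
    from abs_le_of_square_le[OF square_le_sum_list[OF this]]
    show "- (\<Sum>x\<leftarrow>xs. x\<^sup>2) \<le> x \<and> x \<le> (\<Sum>x\<leftarrow>xs. x\<^sup>2)" by linarith
  qed
  show "finite {xs. set xs \<subseteq> {-n..n} \<and> length xs = d}" by (rule finite_lists_length_eq) simp
qed

lemma card_square_sum_lists_Suc_ge:
  assumes "finite S"
  shows "(\<Sum>m\<in>S. card (square_sum_lists d (n - m\<^sup>2))) \<le> card (square_sum_lists (Suc d) n)"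
proof -
  have "(\<Sum>m\<in>S. card (square_sum_lists d (n - m\<^sup>2))) = card (SIGMA m:S. square_sum_lists d (n - m\<^sup>2))"
    using assms finite_square_sum_lists by (subst card_SigmaI) auto
  also have "\<dots> \<le> card (square_sum_lists (Suc d) n)"
    by (rule card_inj_on_le[OF _ _ finite_square_sum_lists, of "\<lambda>(m, xs). m # xs"])
      (auto simp: inj_on_def square_sum_lists_def)
  finally show ?thesis .
qed

lemma card_four_square_reps_le: "card (four_square_reps k) \<le> card (square_sum_lists 4 k)"
  by (rule card_inj_on_le[OF _ _ finite_square_sum_lists, of "\<lambda>(x, y, z, w). [x, y, z, w]"])
    (auto simp: inj_on_def four_square_reps_def square_sum_lists_def)

text \<open>Only the class of \<open>r\<close> modulo 6 matters: its parity must differ from that of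
  \<open>n\<close>, and its square must differ from \<open>n\<close> modulo 3, which always leaves a
  choice.\<close>

lemma exists_coprime_6_shift:
  fixes n :: int
  shows "\<exists>r\<in>{0..5}. \<forall>j. odd (n - (r + 6 * j)\<^sup>2) \<and> \<not> 3 dvd n - (r + 6 * j)\<^sup>2"
proof -
  have *: ?thesis if r: "r \<in> {0..5}" "odd (n - r\<^sup>2)" "\<not> 3 dvd n - r\<^sup>2" for r
  proof (intro bexI[of _ r] allI conjI)
    fix j
    have eq: "n - (r + 6 * j)\<^sup>2 = (n - r\<^sup>2) - 6 * (2 * r * j + 6 * j * j)"
      by (simp add: power2_eq_square algebra_simps)
    show "odd (n - (r + 6 * j)\<^sup>2)" using r(2) unfolding eq by presburger
    show "\<not> 3 dvd n - (r + 6 * j)\<^sup>2" using r(3) unfolding eq by presburger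
  qed (use r in auto)
  have "0 \<le> n mod 6" "n mod 6 < 6" by simp_all
  then consider "n mod 6 = 0" | "n mod 6 = 1" | "n mod 6 = 2" | "n mod 6 = 3" | "n mod 6 = 4" | "n mod 6 = 5"
    by linarith
  then show ?thesis
  proof cases
    case 1 then show ?thesis by (intro *[of 1]; simp; presburger)
  next
    case 2 then show ?thesis by (intro *[of 0]; simp; presburger)
  next
    case 3 then show ?thesis by (intro *[of 3]; simp; presburger)
  next
    case 4 then show ?thesis by (intro *[of 2]; simp; presburger)
  next
    case 5 then show ?thesis by (intro *[of 3]; simp; presburger)
  next
    case 6 then show ?thesis by (intro *[of 0]; simp; presburger)
  qed
qed

lemma square_le_half:
  fixes m n :: int
  assumes "0 \<le> m" "real_of_int m \<le> sqrt (real_of_int n / 2)" "n \<ge> 0"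
  shows "real_of_int n / 2 \<le> real_of_int (n - m\<^sup>2)"
proof -
  have "(real_of_int m)\<^sup>2 \<le> (sqrt (real_of_int n / 2))\<^sup>2" using assms by (intro power_mono) auto
  then show ?thesis using assms(3) by simp
qed

text \<open>Letting the first coordinate run through one class modulo 6 up to
  \<open>sqrt (n / 2)\<close> leaves a number prime to 6 and at least \<open>n / 2\<close> for the
  other four. The exponent \<open>23/16\<close> is \<open>1/2 + 15/16\<close>, and
  \<open>264\<close> is \<open>12 * 22\<close>.\<close>

lemma card_square_sum_lists_5_ge:
  assumes "n \<ge> 200"
  shows "(real_of_int n / 2) powr (23/16) / 264 \<le> real (card (square_sum_lists 5 n))"
proof -
  define x where "x = sqrt (real_of_int n / 2)"
  have "sqrt (10\<^sup>2) \<le> x" unfolding x_def using assms by (intro real_sqrt_le_mono) auto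
  then have x: "x \<ge> 10" by simp
  obtain r where r: "r \<in> {0..5}" "\<And>j. odd (n - (r + 6 * j)\<^sup>2)" "\<And>j. \<not> 3 dvd n - (r + 6 * j)\<^sup>2"
    using exists_coprime_6_shift by blast
  define J where "J = \<lfloor>(x - 5) / 6\<rfloor>"
  have J: "J \<ge> 0" "real_of_int J \<le> (x - 5) / 6" "(x - 5) / 6 < real_of_int J + 1"
    using x of_int_floor_le[of "(x - 5) / 6"] floor_correct[of "(x - 5) / 6"] unfolding J_def by auto
  define S where "S = (\<lambda>j. r + 6 * j) ` {0..J}"
  have fS: "finite S" by (simp add: S_def)
  have "card S = nat (J + 1)" unfolding S_def by (subst card_image) (auto simp: inj_on_def)
  \<comment> \<open>\<open>J + 1\<close> exceeds \<open>(x - 5) / 6\<close>, which is at least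
    \<open>x / 12\<close> exactly when \<open>x \<ge> 10\<close>; hence the threshold 200 for
    \<open>n\<close>.\<close>
  then have cS: "x / 12 \<le> real (card S)" using J x by simp
  have each: "(real_of_int n / 2) powr (15/16) / 22 \<le> real (card (square_sum_lists 4 (n - m\<^sup>2)))" if mS: "m \<in> S" for m
  proof -
    obtain j where j: "m = r + 6 * j" "0 \<le> j" "j \<le> J" using mS by (auto simp: S_def)
    have "real_of_int m \<le> x" using j r(1) J(2) by auto
    then have ge: "real_of_int n / 2 \<le> real_of_int (n - m\<^sup>2)"
      using j r(1) assms by (intro square_le_half) (auto simp: x_def)
    then have pos: "n - m\<^sup>2 > 0" using assms by linarith
    have "(real_of_int n / 2) powr (15/16) / 22 \<le> real_of_int (n - m\<^sup>2) powr (15/16) / 22"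
      using ge assms by (intro divide_right_mono powr_mono2) auto
    also have "\<dots> \<le> real (card (four_square_reps (n - m\<^sup>2)))"
      using r(2)[of j] r(3)[of j] j(1) pos by (intro card_four_square_reps_ge) auto
    also have "\<dots> \<le> real (card (square_sum_lists 4 (n - m\<^sup>2)))"
      using card_four_square_reps_le by simp
    finally show ?thesis .
  qed
  have "(real_of_int n / 2) powr (23/16) = (real_of_int n / 2) powr (1/2) * (real_of_int n / 2) powr (15/16)"
    by (simp flip: powr_add)
  also have "(real_of_int n / 2) powr (1/2) = x" using assms by (simp add: x_def powr_half_sqrt)
  finally have "(real_of_int n / 2) powr (23/16) / 264 = (x / 12) * ((real_of_int n / 2) powr (15/16) / 22)"
    by simp
  also have "\<dots> \<le> real (card S) * ((real_of_int n / 2) powr (15/16) / 22)"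
    using cS by (intro mult_right_mono) auto
  also have "\<dots> = (\<Sum>m\<in>S. (real_of_int n / 2) powr (15/16) / 22)" by simp
  also have "\<dots> \<le> (\<Sum>m\<in>S. real (card (square_sum_lists 4 (n - m\<^sup>2))))"
    using each by (intro sum_mono) auto
  also have "\<dots> \<le> real (card (square_sum_lists (Suc 4) n))"
    using card_square_sum_lists_Suc_ge[OF fS, of 4 n] by (metis of_nat_le_iff of_nat_sum)
  finally show ?thesis by simp
qed

text \<open>Each further coordinate has about \<open>sqrt (n / 2)\<close> values that leave at least
  \<open>n / 2\<close> for the rest, which raises the exponent by \<open>1/2\<close>.\<close>

lemma card_square_sum_lists_ge:
  assumes "d \<ge> 5"
  shows "\<exists>c>0. \<exists>n0. \<forall>n\<ge>n0. c * real_of_int n powr (real d / 2 - 17/16) \<le> real (card (square_sum_lists d n))"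
  using assms
proof (induction d rule: dec_induct)
  case base
  have "(1/2) powr (23/16) / 264 * real_of_int n powr (real 5 / 2 - 17/16) \<le> real (card (square_sum_lists 5 n))"
    if "n \<ge> 200" for n
    using card_square_sum_lists_5_ge[OF that] that powr_mult[of "1/2" "real_of_int n" "23/16"] by simp
  then show ?case by (intro exI[of _ "(1/2) powr (23/16) / 264"] conjI exI[of _ 200]) auto
next
  case (step d)
  define e where "e = real d / 2 - 17/16"
  have e0: "e \<ge> 0" using step by (simp add: e_def)
  obtain c n0 where c: "c > 0" and IH: "\<And>n. n \<ge> n0 \<Longrightarrow> c * real_of_int n powr e \<le> real (card (square_sum_lists d n))"
    using step unfolding e_def by blast
  have "c * (1/2) powr (e + 1/2) * real_of_int n powr (real (Suc d) / 2 - 17/16) \<le> real (card (square_sum_lists (Suc d) n))"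
    if n: "n \<ge> max 1 (2 * n0)" for n
  proof -
    define x where "x = sqrt (real_of_int n / 2)"
    have x: "x \<ge> 0" using n by (simp add: x_def)
    define S where "S = {0..\<lfloor>x\<rfloor>}"
    have cS: "x \<le> real (card S)" using x unfolding S_def by simp
    have each: "c * (real_of_int n / 2) powr e \<le> real (card (square_sum_lists d (n - m\<^sup>2)))" if mS: "m \<in> S" for m
    proof -
      have "0 \<le> m" "real_of_int m \<le> x" using mS by (auto simp: S_def le_floor_iff)
      then have ge: "real_of_int n / 2 \<le> real_of_int (n - m\<^sup>2)"
        using n by (intro square_le_half) (auto simp: x_def)
      then have "n - m\<^sup>2 \<ge> n0" using n by linarith
      have "c * (real_of_int n / 2) powr e \<le> c * real_of_int (n - m\<^sup>2) powr e"
        using ge n c e0 by (intro mult_left_mono powr_mono2) auto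
      also have "\<dots> \<le> real (card (square_sum_lists d (n - m\<^sup>2)))" by (rule IH) fact
      finally show ?thesis .
    qed
    have "(1/2) powr (e + 1/2) * real_of_int n powr (e + 1/2) = (real_of_int n / 2) powr (e + 1/2)"
      using n by (subst powr_mult[symmetric]) auto
    also have "\<dots> = (real_of_int n / 2) powr (1/2) * (real_of_int n / 2) powr e"
      by (simp add: add.commute flip: powr_add)
    also have "(real_of_int n / 2) powr (1/2) = x" using n by (simp add: x_def powr_half_sqrt)
    finally have "c * (1/2) powr (e + 1/2) * real_of_int n powr (e + 1/2) = x * (c * (real_of_int n / 2) powr e)"
      by simp
    also have "\<dots> \<le> real (card S) * (c * (real_of_int n / 2) powr e)"
      using cS c by (intro mult_right_mono) auto
    also have "\<dots> = (\<Sum>m\<in>S. c * (real_of_int n / 2) powr e)" by simp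
    also have "\<dots> \<le> (\<Sum>m\<in>S. real (card (square_sum_lists d (n - m\<^sup>2))))"
      using each by (intro sum_mono) auto
    also have "\<dots> \<le> real (card (square_sum_lists (Suc d) n))"
      using card_square_sum_lists_Suc_ge[of S d n] by (metis S_def finite_atLeastAtMost_int of_nat_le_iff of_nat_sum)
    finally show ?thesis by (simp add: e_def add_divide_distrib algebra_simps)
  qed
  then show ?case using c
    by (intro exI[of _ "c * (1/2) powr (e + 1/2)"] conjI exI[of _ "max 1 (2 * n0)"]) auto
qed

section \<open>Lattice points on circles and additive quadruples\<close>

text \<open>For a triangle inscribed in the circle, the product of the sides is
  \<open>4 * \<rho>\<close> times the area. Squared, with Heron's formula for 16 times the squared
  area in terms of the squared sides, this is the identity. The area enters as the modulus of
  \<open>cnj u * v - u * cnj v\<close>, which is 4 times it.\<close>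

lemma heron_on_circle:
  fixes z1 z2 z3 :: complex
  assumes "cmod z1 = \<rho>" "cmod z2 = \<rho>" "cmod z3 = \<rho>"
  defines "A \<equiv> (cmod (z1 - z2))\<^sup>2" and "B \<equiv> (cmod (z2 - z3))\<^sup>2" and "C \<equiv> (cmod (z3 - z1))\<^sup>2"
  shows "A * B * C = \<rho>\<^sup>2 * (4 * A * C - (A + C - B)\<^sup>2)"
proof (cases "\<rho> = 0")
  case True
  then show ?thesis using assms(1-3) by (simp add: A_def)
next
  case False
  define u v where "u = z2 - z1" and "v = z3 - z1"
  define r where "r = complex_of_real (\<rho>\<^sup>2)"
  have n: "z1 * cnj z1 = r" "z2 * cnj z2 = r" "z3 * cnj z3 = r"
    using assms(1-3) by (simp_all add: r_def complex_norm_square[symmetric])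
  have "(cnj u * v - u * cnj v) * (z1 * z2 * z3)
     = ((z2 * cnj z2) * z1 - (z1 * cnj z1) * z2) * z3 * (z3 - z1) - ((z3 * cnj z3) * z1 - (z1 * cnj z1) * z3) * z2 * (z2 - z1)"
    by (simp add: u_def v_def algebra_simps)
  also have "\<dots> = r * ((z1 - z2) * (z2 - z3) * (z1 - z3))"
    unfolding n by (simp add: algebra_simps)
  finally have "cmod (cnj u * v - u * cnj v) * (\<rho> * \<rho> * \<rho>) = \<rho>\<^sup>2 * (cmod (z1 - z2) * cmod (z2 - z3) * cmod (z3 - z1))"
    using assms(1-3) by (metis (no_types, lifting) norm_mult norm_minus_commute norm_of_real r_def abs_of_nonneg zero_le_power2)
  then have "cmod (cnj u * v - u * cnj v) * \<rho> = cmod (z1 - z2) * cmod (z2 - z3) * cmod (z3 - z1)"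
    using False by (simp add: power2_eq_square)
  then have "A * B * C = \<rho>\<^sup>2 * (cmod (cnj u * v - u * cnj v))\<^sup>2"
    unfolding A_def B_def C_def by (simp flip: power_mult_distrib add: mult.commute)
  also have "(cmod (cnj u * v - u * cnj v))\<^sup>2 = 4 * (cmod u)\<^sup>2 * (cmod v)\<^sup>2 - ((cmod u)\<^sup>2 + (cmod v)\<^sup>2 - (cmod (u - v))\<^sup>2)\<^sup>2"
    by (simp add: cmod_power2) (simp add: power2_eq_square algebra_simps)
  also have "u - v = z2 - z3" by (simp add: u_def v_def)
  also have "cmod u = cmod (z1 - z2)" by (simp add: u_def norm_minus_commute)
  also have "cmod v = cmod (z3 - z1)" by (simp add: v_def)
  finally show ?thesis by (simp add: A_def B_def C_def)
qed

lemma norm_cis_diff_le: "cmod (cis a - cis b) \<le> \<bar>a - b\<bar>"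
proof -
  have "(cmod (cis a - cis b))\<^sup>2 = 2 - 2 * cos (a - b)"
    by (simp add: cmod_power2 cos_diff power2_diff algebra_simps)
  also have "\<dots> = (2 * sin ((a - b) / 2))\<^sup>2"
  proof -
    have "cos (a - b) = 1 - 2 * (sin ((a - b) / 2))\<^sup>2"
      using cos_double_sin[of "(a - b) / 2"] by (simp only: mult_2 field_sum_of_halves)
    then show ?thesis by (simp add: power_mult_distrib)
  qed
  also have "\<dots> \<le> \<bar>a - b\<bar>\<^sup>2"
  proof -
    have "\<bar>2 * sin ((a - b) / 2)\<bar> \<le> \<bar>a - b\<bar>"
      using abs_sin_x_le_abs_x[of "(a - b) / 2"] by simp
    then show ?thesis by (simp add: abs_le_square_iff)
  qed
  finally show ?thesis by (rule power2_le_imp_le) simp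
qed

text \<open>
  For three points on a circle of radius \<open>\<rho>\<close> with integral squared distances, Heron's formula makes the product of the
  distances at least \<open>\<rho>\<close>. So a sector of diameter less than \<open>\<rho> powr (1/3)\<close> contains at most two of the points.
\<close>

lemma card_circle_integral_distances:
  fixes Z :: "complex set"
  assumes fin: "finite Z" and \<rho>: "\<And>z. z \<in> Z \<Longrightarrow> cmod z = \<rho>"
    and int: "\<And>z w. z \<in> Z \<Longrightarrow> w \<in> Z \<Longrightarrow> (cmod (z - w))\<^sup>2 \<in> \<int>"
  shows "real (card Z) \<le> 18 * (\<rho>\<^sup>2 + 1) powr (1/3)"
proof (cases "\<rho> > 0")
  case False
  then have "Z \<subseteq> {0}" using \<rho> by (metis insertI1 norm_le_zero_iff not_less subsetI)
  then have "card Z \<le> card {0::complex}" by (intro card_mono) auto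
  then have "real (card Z) \<le> 1" by simp
  also have "1 \<le> (\<rho>\<^sup>2 + 1) powr (1/3)" by (rule ge_one_powr_ge_zero) auto
  finally show ?thesis by simp
next
  case True
  \<comment> \<open>The number of sectors. Since \<open>2 * pi < 7\<close>, an arc of angle
    \<open>2 * pi / G\<close> is shorter than \<open>\<rho> powr (1/3)\<close>.\<close>
  define G where "G = \<lceil>7 * \<rho> powr (2/3)\<rceil>"
  have G: "7 * \<rho> powr (2/3) \<le> real_of_int G" "real_of_int G < 7 * \<rho> powr (2/3) + 1"
    unfolding G_def by linarith+
  have rp: "\<rho> powr (2/3) > 0" using True by simp
  then have G0: "G > 0" using G(1) by linarith
  define k where "k = (\<lambda>z. \<lfloor>(Arg z + pi) / (2 * pi) * real_of_int G\<rfloor>)"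
  \<comment> \<open>The last index \<open>G\<close> does occur, namely for
    \<open>Arg z = pi\<close>; so there are \<open>G + 1\<close> classes.\<close>
  have k_range: "k z \<in> {0..G}" for z
  proof -
    have *: "0 \<le> (Arg z + pi) / (2 * pi)" "(Arg z + pi) / (2 * pi) \<le> 1"
      using mpi_less_Arg[of z] Arg_le_pi[of z] by (auto simp: field_simps)
    have "0 \<le> (Arg z + pi) / (2 * pi) * real_of_int G" using * G0 by (intro mult_nonneg_nonneg) auto
    moreover have "(Arg z + pi) / (2 * pi) * real_of_int G \<le> 1 * real_of_int G"
      using * G0 by (intro mult_right_mono) auto
    ultimately show ?thesis by (simp add: k_def floor_le_iff)
  qed
  have close: "cmod (z - w) < \<rho> powr (1/3)" if "z \<in> Z" "w \<in> Z" "k z = k w" for z w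
  proof -
    have "\<bar>(Arg z + pi) / (2 * pi) * real_of_int G - (Arg w + pi) / (2 * pi) * real_of_int G\<bar> < 1"
      using that(3) unfolding k_def by linarith
    also have "(Arg z + pi) / (2 * pi) * real_of_int G - (Arg w + pi) / (2 * pi) * real_of_int G = (Arg z - Arg w) * (real_of_int G / (2 * pi))"
      by (simp add: field_simps)
    finally have "\<bar>Arg z - Arg w\<bar> * (real_of_int G / (2 * pi)) < 1" using G0 by (simp add: abs_mult)
    then have arg: "\<bar>Arg z - Arg w\<bar> < 2 * pi / real_of_int G" using G0 by (simp add: field_simps)
    have "z = \<rho> * cis (Arg z)" "w = \<rho> * cis (Arg w)"
      using \<rho>[OF that(1)] \<rho>[OF that(2)] rcis_cmod_Arg[of z] rcis_cmod_Arg[of w] by (simp_all add: rcis_def)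
    then have "z - w = \<rho> * (cis (Arg z) - cis (Arg w))" by (simp add: right_diff_distrib)
    then have "cmod (z - w) = \<rho> * cmod (cis (Arg z) - cis (Arg w))" using True by (simp add: norm_mult)
    also have "\<dots> \<le> \<rho> * \<bar>Arg z - Arg w\<bar>" using True norm_cis_diff_le by (intro mult_left_mono) auto
    also have "\<dots> < \<rho> * (2 * pi / real_of_int G)" using True arg by (intro mult_strict_left_mono) auto
    also have "\<dots> \<le> \<rho> * (2 * pi / (7 * \<rho> powr (2/3)))"
      using True G rp G0 by (intro mult_left_mono divide_left_mono mult_pos_pos) auto
    also have "\<dots> = (2 * pi / 7) * \<rho> powr (1/3)"
    proof -
      have "\<rho> powr (1/3) * \<rho> powr (2/3) = \<rho>" using True by (simp flip: powr_add)
      then show ?thesis using rp by (simp add: field_simps)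
    qed
    also have "\<dots> \<le> 1 * \<rho> powr (1/3)" using pi_less_4 pi_approx by (intro mult_right_mono) auto
    finally show ?thesis by simp
  qed
  have "card {z \<in> Z. k z = j} \<le> 2" for j
  proof (rule ccontr)
    assume "\<not> card {z \<in> Z. k z = j} \<le> 2"
    then have "3 \<le> card {z \<in> Z. k z = j}" by simp
    then obtain T where "T \<subseteq> {z \<in> Z. k z = j}" "card T = 3" by (metis obtain_subset_with_card_n)
    then obtain z1 z2 z3 where z: "z1 \<in> Z" "z2 \<in> Z" "z3 \<in> Z" "k z1 = j" "k z2 = j" "k z3 = j"
      and ne: "z1 \<noteq> z2" "z2 \<noteq> z3" "z1 \<noteq> z3" by (auto simp: card_3_iff)
    define A B C where "A = (cmod (z1 - z2))\<^sup>2" and "B = (cmod (z2 - z3))\<^sup>2" and "C = (cmod (z3 - z1))\<^sup>2"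
    have eq: "A * B * C = \<rho>\<^sup>2 * (4 * A * C - (A + C - B)\<^sup>2)"
      unfolding A_def B_def C_def by (rule heron_on_circle) (use z \<rho> in auto)
    have pos: "A > 0" "B > 0" "C > 0" using ne by (auto simp: A_def B_def C_def)
    have ints: "A \<in> \<int>" "B \<in> \<int>" "C \<in> \<int>" using z int by (auto simp: A_def B_def C_def)
    then have "4 * A * C - (A + C - B)\<^sup>2 \<in> \<int>" by auto
    moreover have "0 < \<rho>\<^sup>2 * (4 * A * C - (A + C - B)\<^sup>2)" using eq pos by (metis mult_pos_pos)
    then have "0 < 4 * A * C - (A + C - B)\<^sup>2" using True by (simp add: zero_less_mult_iff)
    ultimately have "1 \<le> 4 * A * C - (A + C - B)\<^sup>2" by (auto elim!: Ints_cases)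
    then have "\<rho>\<^sup>2 * 1 \<le> A * B * C" unfolding eq by (intro mult_left_mono) auto
    moreover have lt: "X < (\<rho> powr (1/3))\<^sup>2" if "X = (cmod (z - w))\<^sup>2" "z \<in> Z" "w \<in> Z" "k z = k w" for X z w
      unfolding that(1) using close[OF that(2-4)] by (intro power_strict_mono) auto
    have "A < (\<rho> powr (1/3))\<^sup>2" "B < (\<rho> powr (1/3))\<^sup>2" "C < (\<rho> powr (1/3))\<^sup>2"
      by (rule lt[OF A_def] lt[OF B_def] lt[OF C_def]; use z in simp)+
    then have "A * B * C < (\<rho> powr (1/3))\<^sup>2 * (\<rho> powr (1/3))\<^sup>2 * (\<rho> powr (1/3))\<^sup>2"
      using pos by (intro mult_strict_mono) auto
    also have "\<dots> = (\<rho> powr (1/3) * \<rho> powr (1/3) * \<rho> powr (1/3))\<^sup>2" by (simp add: power2_eq_square)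
    also have "\<rho> powr (1/3) * \<rho> powr (1/3) * \<rho> powr (1/3) = \<rho>" using True by (simp flip: powr_add)
    ultimately show False by simp
  qed
  then have "card (\<Union>j\<in>{0..G}. {z \<in> Z. k z = j}) \<le> (\<Sum>j\<in>{0..G}. 2)"
    by (intro order_trans[OF card_UN_le] sum_mono) auto
  moreover have "(\<Union>j\<in>{0..G}. {z \<in> Z. k z = j}) = Z" using k_range by auto
  ultimately have "card Z \<le> 2 * nat (G + 1)" by simp
  then have "real (card Z) \<le> real (2 * nat (G + 1))" by (simp only: of_nat_le_iff)
  also have "\<dots> = 2 * (real_of_int G + 1)" using G0 by simp
  also have "\<dots> \<le> 14 * \<rho> powr (2/3) + 4" using G(2) by simp
  also have "\<rho> powr (2/3) = (\<rho>\<^sup>2) powr (1/3)" using True by (simp add: powr_powr flip: powr_numeral)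
  also have "14 * (\<rho>\<^sup>2) powr (1/3) + 4 \<le> 14 * (\<rho>\<^sup>2 + 1) powr (1/3) + 4 * (\<rho>\<^sup>2 + 1) powr (1/3)"
  proof -
    have "(\<rho>\<^sup>2) powr (1/3) \<le> (\<rho>\<^sup>2 + 1) powr (1/3)" by (intro powr_mono2) auto
    moreover have "1 \<le> (\<rho>\<^sup>2 + 1) powr (1/3)" by (rule ge_one_powr_ge_zero) auto
    ultimately show ?thesis by simp
  qed
  finally show ?thesis by simp
qed

section \<open>Hyperplane sections of the sphere of frequencies\<close>

definition supported_box :: "'n set \<Rightarrow> real \<Rightarrow> (real ^ 'n::finite) set" where
  "supported_box I r = {l. (\<forall>i. l $ i \<in> \<int>) \<and> (\<forall>i\<in>I. \<bar>l $ i\<bar> \<le> r) \<and> (\<forall>i. i \<notin> I \<longrightarrow> l $ i = 0)}"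

lemma supported_box_card:
  fixes I :: "'n::finite set"
  assumes "r \<ge> 0"
  shows "finite (supported_box I r)" "real (card (supported_box I r)) \<le> (2 * r + 1) ^ card I"
proof -
  define g :: "real ^ 'n \<Rightarrow> 'n \<Rightarrow> int" where "g = (\<lambda>l. restrict (\<lambda>i. \<lfloor>l $ i\<rfloor>) I)"
  have inj: "inj_on g (supported_box I r)"
  proof (rule inj_onI)
    fix l m assume l: "l \<in> supported_box I r" and m: "m \<in> supported_box I r" and eq: "g l = g m"
    show "l = m"
    proof (rule vec_eq_iff[THEN iffD2], rule allI)
      fix i
      show "l $ i = m $ i"
      proof (cases "i \<in> I")
        case True
        then have "\<lfloor>l $ i\<rfloor> = \<lfloor>m $ i\<rfloor>" using fun_cong[OF eq, of i] by (simp add: g_def)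
        moreover have "l $ i \<in> \<int>" "m $ i \<in> \<int>" using l m by (auto simp: supported_box_def)
        ultimately show ?thesis by (metis of_int_floor)
      qed (use l m in \<open>auto simp: supported_box_def\<close>)
    qed
  qed
  have sub: "g ` supported_box I r \<subseteq> (\<Pi>\<^sub>E i\<in>I. {-\<lfloor>r\<rfloor>..\<lfloor>r\<rfloor>})"
  proof (rule image_subsetI, rule PiE_I)
    fix l i assume l: "l \<in> supported_box I r" and i: "i \<in> I"
    have "l $ i \<in> \<int>" using l by (simp add: supported_box_def)
    then obtain q where q: "l $ i = of_int q" by (rule Ints_cases)
    have "\<bar>of_int q\<bar> \<le> r" using l i q by (metis (mono_tags, lifting) mem_Collect_eq supported_box_def)
    then have "q \<le> \<lfloor>r\<rfloor>" "- q \<le> \<lfloor>r\<rfloor>" by (auto simp: le_floor_iff)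
    then show "g l i \<in> {-\<lfloor>r\<rfloor>..\<lfloor>r\<rfloor>}" using i q by (simp add: g_def)
  qed (simp add: g_def)
  have finP: "finite (\<Pi>\<^sub>E i\<in>I. {-\<lfloor>r\<rfloor>..\<lfloor>r\<rfloor>})" by (intro finite_PiE) auto
  show "finite (supported_box I r)" using inj sub finP by (metis finite_imageD finite_subset)
  have "real (card (supported_box I r)) \<le> real (card (\<Pi>\<^sub>E i\<in>I. {-\<lfloor>r\<rfloor>..\<lfloor>r\<rfloor>}))"
    using card_inj_on_le[OF inj sub finP] by simp
  also have "\<dots> = real (nat (2 * \<lfloor>r\<rfloor> + 1)) ^ card I" by (simp add: card_PiE)
  also have "\<dots> \<le> (2 * r + 1) ^ card I"
    using assms by (intro power_mono) linarith+
  finally show "real (card (supported_box I r)) \<le> (2 * r + 1) ^ card I" .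
qed

lemma abs_component_le:
  assumes "l \<in> frequencies E"
  shows "\<bar>l $ i\<bar> \<le> sqrt (real E)"
proof -
  have "norm l = sqrt (real E)" using assms by (auto simp: frequencies_def intro: real_sqrt_unique[symmetric])
  then show ?thesis using component_le_norm_cart[of l i] by simp
qed

lemma finite_frequencies: "finite (frequencies E :: (real ^ 'n::finite) set)"
proof (rule finite_subset)
  show "(frequencies E :: (real ^ 'n) set) \<subseteq> supported_box UNIV (sqrt (real E))"
    using abs_component_le by (fastforce simp: supported_box_def frequencies_def)
qed (simp add: supported_box_card)

lemma card_square_sum_lists_le_freq_count:
  "card (square_sum_lists CARD('n) (int E)) \<le> freq_count TYPE('n::finite) E"
proof -
  obtain g :: "'n \<Rightarrow> nat" where g: "bij_betw g UNIV {0..<CARD('n)}"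
    using ex_bij_betw_finite_nat[of "UNIV :: 'n set"] by auto
  define F :: "int list \<Rightarrow> real ^ 'n" where "F = (\<lambda>xs. \<chi> i. real_of_int (xs ! g i))"
  have "inj_on F (square_sum_lists CARD('n) (int E))"
  proof (rule inj_onI)
    fix xs ys assume l: "xs \<in> square_sum_lists CARD('n) (int E)" "ys \<in> square_sum_lists CARD('n) (int E)"
      and eq: "F xs = F ys"
    show "xs = ys"
    proof (rule nth_equalityI)
      show "length xs = length ys" using l by (simp add: square_sum_lists_def)
      fix j assume "j < length xs"
      then have "j \<in> {0..<CARD('n)}" using l by (simp add: square_sum_lists_def)
      then obtain i where "j = g i" using g by (metis bij_betw_imp_surj_on imageE)
      moreover have "F xs $ i = F ys $ i" using eq by simp
      ultimately show "xs ! j = ys ! j" by (simp add: F_def)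
    qed
  qed
  moreover have "F ` square_sum_lists CARD('n) (int E) \<subseteq> frequencies E"
  proof (rule image_subsetI)
    fix xs assume xs: "xs \<in> square_sum_lists CARD('n) (int E)"
    have "(norm (F xs))\<^sup>2 = (\<Sum>i\<in>UNIV. (real_of_int (xs ! g i))\<^sup>2)"
      by (simp add: norm_vec_def L2_set_def F_def sum_nonneg)
    also have "\<dots> = (\<Sum>j\<in>{0..<CARD('n)}. (real_of_int (xs ! j))\<^sup>2)"
      using sum.reindex_bij_betw[OF g, of "\<lambda>j. (real_of_int (xs ! j))\<^sup>2"] by simp
    also have "\<dots> = real_of_int (\<Sum>x\<leftarrow>xs. x\<^sup>2)"
      using xs by (simp add: sum_list_sum_nth square_sum_lists_def)
    also have "\<dots> = real E" using xs by (simp add: square_sum_lists_def)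
    finally show "F xs \<in> frequencies E" by (simp add: frequencies_def F_def)
  qed
  ultimately show ?thesis unfolding freq_count_def using finite_frequencies by (metis card_inj_on_le)
qed

text \<open>The two components are coordinates in the orthonormal basis
  \<open>(-\<beta>, \<alpha>, 0) / a\<close>, \<open>(-\<alpha> * \<gamma>, -\<beta> * \<gamma>,
  a\<^sup>2) / (a * b)\<close> of the plane orthogonal to
  \<open>(\<alpha>, \<beta>, \<gamma>)\<close>. The identity is Pythagoras: the component along the
  normal is subtracted.\<close>

lemma plane_coordinates_norm:
  fixes \<alpha> \<beta> \<gamma> a b x y z :: real
  assumes "a\<^sup>2 = \<alpha>\<^sup>2 + \<beta>\<^sup>2" "b\<^sup>2 = a\<^sup>2 + \<gamma>\<^sup>2" "a \<noteq> 0" "b \<noteq> 0"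
  shows "(cmod (Complex ((\<alpha> * y - \<beta> * x) / a) ((a\<^sup>2 * z - \<gamma> * (\<alpha> * x + \<beta> * y)) / (a * b))))\<^sup>2
    = x\<^sup>2 + y\<^sup>2 + z\<^sup>2 - (\<alpha> * x + \<beta> * y + \<gamma> * z)\<^sup>2 / b\<^sup>2"
proof -
  have *: "b\<^sup>2 * (\<alpha> * y - \<beta> * x)\<^sup>2 + (a\<^sup>2 * z - \<gamma> * (\<alpha> * x + \<beta> * y))\<^sup>2
     = a\<^sup>2 * (b\<^sup>2 * (x\<^sup>2 + y\<^sup>2 + z\<^sup>2) - (\<alpha> * x + \<beta> * y + \<gamma> * z)\<^sup>2)"
    unfolding assms(2) assms(1) by (simp add: power2_eq_square algebra_simps)
  have "(cmod (Complex ((\<alpha> * y - \<beta> * x) / a) ((a\<^sup>2 * z - \<gamma> * (\<alpha> * x + \<beta> * y)) / (a * b))))\<^sup>2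
    = (b\<^sup>2 * (\<alpha> * y - \<beta> * x)\<^sup>2 + (a\<^sup>2 * z - \<gamma> * (\<alpha> * x + \<beta> * y))\<^sup>2) / (a\<^sup>2 * b\<^sup>2)"
    using assms(3,4) by (simp add: cmod_power2 power_divide power_mult_distrib add_divide_distrib)
  also have "\<dots> = (b\<^sup>2 * (x\<^sup>2 + y\<^sup>2 + z\<^sup>2) - (\<alpha> * x + \<beta> * y + \<gamma> * z)\<^sup>2) / b\<^sup>2"
    unfolding * using assms(3) by simp
  also have "\<dots> = x\<^sup>2 + y\<^sup>2 + z\<^sup>2 - (\<alpha> * x + \<beta> * y + \<gamma> * z)\<^sup>2 / b\<^sup>2"
    using assms(4) by (simp add: diff_divide_distrib)
  finally show ?thesis .
qed

text \<open>Fixing all but three coordinates leaves integer points on a sphere in three dimensions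
  cut by a plane, that is on a circle of squared radius at most \<open>E\<close>. The power counts
  the choices of the fixed coordinates, the cube root bounds each circle.\<close>

lemma card_section_le:
  fixes v :: "real ^ 'n::finite"
  assumes "v \<noteq> 0" "CARD('n) \<ge> 3"
  shows "real (card {l \<in> frequencies E. l \<bullet> v = h})
    \<le> (2 * sqrt (real E) + 1) ^ (CARD('n) - 3) * (18 * (real E + 1) powr (1/3))"
proof -
  \<comment> \<open>A coordinate with \<open>v $ i \<noteq> 0\<close> is kept among the three free
    ones, so that the hyperplane still cuts out a genuine plane there.\<close>
  obtain i where i: "v $ i \<noteq> 0" using assms(1) by (auto simp: vec_eq_iff)
  have "card (UNIV - {i}) \<ge> 2" using assms(2) by (simp add: card_Diff_singleton)
  then obtain T where "T \<subseteq> UNIV - {i}" "card T = 2" by (metis obtain_subset_with_card_n)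
  then obtain j k where jk: "j \<noteq> i" "k \<noteq> i" "j \<noteq> k" by (auto simp: card_2_iff)
  define A where "A = {l \<in> frequencies E. l \<bullet> v = h}"
  have finA: "finite A" unfolding A_def by (rule finite_subset[OF _ finite_frequencies[of E]]) auto
  define rest :: "real ^ 'n \<Rightarrow> real ^ 'n" where "rest = (\<lambda>l. \<chi> m. if m \<in> {i, j, k} then 0 else l $ m)"
  have split: "l \<bullet> w = l $ i * w $ i + l $ j * w $ j + l $ k * w $ k + rest l \<bullet> w" for l w
  proof -
    have "l \<bullet> w = (l - rest l) \<bullet> w + rest l \<bullet> w" by (simp add: inner_diff_left)
    also have "(l - rest l) \<bullet> w = (\<Sum>m\<in>UNIV. if m \<in> {i, j, k} then l $ m * w $ m else 0)"
      unfolding inner_vec_def by (intro sum.cong) (auto simp: rest_def)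
    also have "\<dots> = (\<Sum>m\<in>{i, j, k}. l $ m * w $ m)"
      using sum.inter_restrict[of UNIV "\<lambda>m. l $ m * w $ m" "{i, j, k}"] by simp
    also have "\<dots> = l $ i * w $ i + l $ j * w $ j + l $ k * w $ k" using jk by auto
    finally show ?thesis .
  qed
  define \<alpha> \<beta> \<gamma> where "\<alpha> = v $ i" and "\<beta> = v $ j" and "\<gamma> = v $ k"
  define a b where "a = sqrt (\<alpha>\<^sup>2 + \<beta>\<^sup>2)" and "b = sqrt (\<alpha>\<^sup>2 + \<beta>\<^sup>2 + \<gamma>\<^sup>2)"
  have "\<alpha>\<^sup>2 > 0" using i by (simp add: \<alpha>_def)
  then have pos: "\<alpha>\<^sup>2 + \<beta>\<^sup>2 > 0" "\<alpha>\<^sup>2 + \<beta>\<^sup>2 + \<gamma>\<^sup>2 > 0"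
    by (simp_all add: add_pos_nonneg)
  then have ab: "a\<^sup>2 = \<alpha>\<^sup>2 + \<beta>\<^sup>2" "b\<^sup>2 = a\<^sup>2 + \<gamma>\<^sup>2" "a \<noteq> 0" "b \<noteq> 0" by (auto simp: a_def b_def)
  define \<phi> where "\<phi> = (\<lambda>l :: real ^ 'n. Complex ((\<alpha> * l $ j - \<beta> * l $ i) / a)
      ((a\<^sup>2 * l $ k - \<gamma> * (\<alpha> * l $ i + \<beta> * l $ j)) / (a * b)))"
  define sq where "sq = (\<lambda>l :: real ^ 'n. (l $ i)\<^sup>2 + (l $ j)\<^sup>2 + (l $ k)\<^sup>2)"
  define s where "s = (\<lambda>l :: real ^ 'n. \<alpha> * l $ i + \<beta> * l $ j + \<gamma> * l $ k)"
  have norm_\<phi>: "(cmod (\<phi> l))\<^sup>2 = sq l - (s l)\<^sup>2 / b\<^sup>2" for l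
    unfolding \<phi>_def sq_def s_def by (rule plane_coordinates_norm[OF ab])
  have \<phi>_diff: "\<phi> l - \<phi> m = \<phi> (l - m)" for l m
    using ab(3,4) by (simp add: \<phi>_def complex_eq_iff diff_divide_distrib[symmetric] algebra_simps)
  have s_eq: "s l = h - y \<bullet> v" and sq_eq: "sq l = real E - y \<bullet> y" if "l \<in> A" "rest l = y" for l y
  proof -
    have "l \<bullet> v = h" "l \<bullet> l = real E"
      using that by (auto simp: A_def frequencies_def power2_norm_eq_inner)
    moreover have "rest l \<bullet> l = rest l \<bullet> rest l"
      using split[of l "rest l"] by (simp add: rest_def inner_commute)
    ultimately show "s l = h - y \<bullet> v" "sq l = real E - y \<bullet> y"
      using split[of l v] split[of l l] that(2)
      by (simp_all add: s_def sq_def \<alpha>_def \<beta>_def \<gamma>_def power2_eq_square algebra_simps)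
  qed
  have fibre: "real (card {l \<in> A. rest l = y}) \<le> 18 * (real E + 1) powr (1/3)" for y
  proof (cases "{l \<in> A. rest l = y} = {}")
    case True
    then show ?thesis by (simp only: card.empty) simp
  next
    case False
    then obtain l0 where l0: "l0 \<in> A" "rest l0 = y" by auto
    let ?F = "{l \<in> A. rest l = y}"
    \<comment> \<open>Within a fibre the component along the normal is constant, so
      \<open>\<phi>\<close> preserves distances. The coordinates of \<open>\<phi>\<close> may be
      irrational, but squared distances are those of integer points, hence integers.\<close>
    have dist: "(cmod (\<phi> l - \<phi> m))\<^sup>2 = sq (l - m)" if "l \<in> ?F" "m \<in> ?F" for l m
    proof -
      have "s (l - m) = s l - s m" by (simp add: s_def algebra_simps)
      also have "\<dots> = 0" using that s_eq by simp
      finally show ?thesis unfolding \<phi>_diff norm_\<phi> by simp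
    qed
    have inj: "inj_on \<phi> ?F"
    proof (rule inj_onI)
      fix l m assume l: "l \<in> ?F" and m: "m \<in> ?F" and eq: "\<phi> l = \<phi> m"
      then have "sq (l - m) = 0" using dist[OF l m] by simp
      then have "l $ i = m $ i" "l $ j = m $ j" "l $ k = m $ k"
        by (simp_all add: sq_def add_nonneg_eq_0_iff)
      moreover have "l $ q = m $ q" if "q \<notin> {i, j, k}" for q
      proof -
        have "rest l $ q = rest m $ q" using l m by simp
        then show ?thesis using that by (simp add: rest_def)
      qed
      ultimately have "l $ q = m $ q" for q by (cases "q \<in> {i, j, k}") auto
      then show "l = m" by (simp add: vec_eq_iff)
    qed
    have "real (card ?F) = real (card (\<phi> ` ?F))" using inj by (simp add: card_image)
    also have "\<dots> \<le> 18 * ((cmod (\<phi> l0))\<^sup>2 + 1) powr (1/3)"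
    proof (rule card_circle_integral_distances)
      show "finite (\<phi> ` ?F)" using finA by simp
      fix z assume "z \<in> \<phi> ` ?F"
      then obtain l where l: "z = \<phi> l" "l \<in> A" "rest l = y" by auto
      have "(cmod z)\<^sup>2 = (cmod (\<phi> l0))\<^sup>2"
        using l l0 by (simp add: norm_\<phi> s_eq sq_eq)
      then show "cmod z = cmod (\<phi> l0)" by (simp add: power2_eq_iff_nonneg)
    next
      fix z w assume "z \<in> \<phi> ` ?F" "w \<in> \<phi> ` ?F"
      then obtain l m where lm: "l \<in> ?F" "m \<in> ?F" "z = \<phi> l" "w = \<phi> m" by auto
      have "l $ q \<in> \<int>" "m $ q \<in> \<int>" for q using lm by (auto simp: A_def frequencies_def)
      then show "(cmod (z - w))\<^sup>2 \<in> \<int>" unfolding lm dist[OF lm(1,2)] sq_def by auto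
    qed
    also have "\<dots> \<le> 18 * (real E + 1) powr (1/3)"
    proof -
      have "(cmod (\<phi> l0))\<^sup>2 \<le> real E"
      proof -
        have "(cmod (\<phi> l0))\<^sup>2 \<le> sq l0" unfolding norm_\<phi> by simp
        also have "\<dots> \<le> real E" using sq_eq[OF l0] by simp
        finally show ?thesis .
      qed
      then show ?thesis by (intro mult_left_mono powr_mono2) auto
    qed
    finally show ?thesis .
  qed
  have "rest ` A \<subseteq> supported_box (UNIV - {i, j, k}) (sqrt (real E))"
  proof (rule image_subsetI)
    fix l assume "l \<in> A"
    then have l: "l \<in> frequencies E" by (simp add: A_def)
    then show "rest l \<in> supported_box (UNIV - {i, j, k}) (sqrt (real E))"
      using abs_component_le[OF l] by (simp add: supported_box_def rest_def frequencies_def)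
  qed
  then have "card (rest ` A) \<le> card (supported_box (UNIV - {i, j, k}) (sqrt (real E)))"
    by (intro card_mono supported_box_card) auto
  also have "real \<dots> \<le> (2 * sqrt (real E) + 1) ^ card (UNIV - {i, j, k})"
    by (rule supported_box_card) simp
  also have "card (UNIV - {i, j, k}) = CARD('n) - 3" using jk by (simp add: card_Diff_subset)
  finally have img: "real (card (rest ` A)) \<le> (2 * sqrt (real E) + 1) ^ (CARD('n) - 3)" by simp
  have "real (card A) = (\<Sum>y\<in>rest ` A. real (card {l \<in> A. rest l = y}))"
    using sum.image_gen[OF finA, of "\<lambda>_. 1 :: real" rest] by simp
  also have "\<dots> \<le> (\<Sum>y\<in>rest ` A. 18 * (real E + 1) powr (1/3))" by (intro sum_mono fibre)
  also have "\<dots> = real (card (rest ` A)) * (18 * (real E + 1) powr (1/3))" by simp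
  also have "\<dots> \<le> (2 * sqrt (real E) + 1) ^ (CARD('n) - 3) * (18 * (real E + 1) powr (1/3))"
    using img by (intro mult_right_mono) auto
  finally show ?thesis by (simp add: A_def)
qed

text \<open>In the plane \<open>l\<close> is determined by its inner product with \<open>v\<close>
  and by the determinant \<open>t l\<close>. By Lagrange's identity the square of that determinant
  is the constant \<open>E * D - h\<^sup>2\<close>, which leaves two values.\<close>

lemma card_two_circles_le_2:
  fixes v :: "real ^ 'n::finite"
  assumes "v \<noteq> 0" "CARD('n) = 2" "finite A" "\<And>l. l \<in> A \<Longrightarrow> l \<bullet> l = E \<and> l \<bullet> v = h"
  shows "card A \<le> 2"
proof -
  obtain i j :: 'n where ij: "UNIV = {i, j}" "i \<noteq> j" using assms(2) by (auto simp: card_2_iff)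
  have inner: "x \<bullet> y = x $ i * y $ i + x $ j * y $ j" for x y :: "real ^ 'n"
    unfolding inner_vec_def ij(1) using ij(2) by simp
  define D where "D = v \<bullet> v"
  have D: "D > 0" using assms(1) by (simp add: D_def)
  define t where "t = (\<lambda>l :: real ^ 'n. l $ i * v $ j - l $ j * v $ i)"
  have t2: "(t l)\<^sup>2 = E * D - h\<^sup>2" if "l \<in> A" for l
  proof -
    have "(t l)\<^sup>2 = (l \<bullet> l) * (v \<bullet> v) - (l \<bullet> v)\<^sup>2"
      by (simp add: t_def inner power2_eq_square algebra_simps)
    then show ?thesis using assms(4)[OF that] by (simp add: D_def)
  qed
  have inj: "inj_on t A"
  proof (rule inj_onI)
    fix l m assume lm: "l \<in> A" "m \<in> A" "t l = t m"
    have "D * (x $ i) = (x \<bullet> v) * v $ i + t x * v $ j" "D * (x $ j) = (x \<bullet> v) * v $ j - t x * v $ i" for x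
      by (simp_all add: D_def t_def inner algebra_simps)
    then have "D * (l $ i) = D * (m $ i)" "D * (l $ j) = D * (m $ j)"
      using lm(3) assms(4)[OF lm(1)] assms(4)[OF lm(2)] by simp_all
    then have "l $ i = m $ i" "l $ j = m $ j" using D by auto
    then have "\<forall>q\<in>{i, j}. l $ q = m $ q" by auto
    then show "l = m" using ij(1) by (metis UNIV_I vec_eq_iff)
  qed
  have "t ` A \<subseteq> {sqrt (E * D - h\<^sup>2), - sqrt (E * D - h\<^sup>2)}"
  proof
    fix y assume "y \<in> t ` A"
    then have "y\<^sup>2 = E * D - h\<^sup>2" using t2 by auto
    then have "\<bar>y\<bar> = sqrt (E * D - h\<^sup>2)" by (metis real_sqrt_abs)
    then show "y \<in> {sqrt (E * D - h\<^sup>2), - sqrt (E * D - h\<^sup>2)}" by auto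
  qed
  then have "card (t ` A) \<le> card {sqrt (E * D - h\<^sup>2), - sqrt (E * D - h\<^sup>2)}" by (intro card_mono) auto
  also have "\<dots> \<le> 2" by (simp add: card_insert_if)
  finally show ?thesis using inj by (simp add: card_image)
qed

section \<open>Counting zero-sum quadruples of frequencies\<close>

definition zero_sum_quadruples :: "'a::ab_group_add set \<Rightarrow> ('a \<times> 'a \<times> 'a \<times> 'a) set" where
  "zero_sum_quadruples S = {(a, b, c, d). a \<in> S \<and> b \<in> S \<and> c \<in> S \<and> d \<in> S \<and> a + b + c + d = 0}"

text \<open>Summing over the pair \<open>(a, b)\<close>: a pair with sum zero leaves at most
  \<open>card S\<close> choices for \<open>c\<close>, and there are at most \<open>card S\<close>
  such pairs; every other pair leaves at most \<open>B\<close> choices.\<close>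

lemma card_zero_sum_quadruples_le:
  fixes S :: "'a::ab_group_add set"
  assumes fin: "finite S" and B: "\<And>v. v \<noteq> 0 \<Longrightarrow> card {c \<in> S. v - c \<in> S} \<le> B"
  shows "card (zero_sum_quadruples S) \<le> (card S)\<^sup>2 * (1 + B)"
proof -
  define r where "r = (\<lambda>(a, b). {c \<in> S. - (a + b) - c \<in> S})"
  define P where "P = {(a, b). a \<in> S \<and> b \<in> S \<and> b = - a}"
  have finr: "finite (r s)" for s using fin by (simp add: r_def split_beta)
  have finP: "finite P" by (rule finite_subset[of _ "S \<times> S"]) (use fin in \<open>auto simp: P_def\<close>)
  have "card (zero_sum_quadruples S) \<le> card (Sigma (S \<times> S) r)"
  proof (rule card_inj_on_le)
    show "inj_on (\<lambda>(a, b, c, d). ((a, b), c)) (zero_sum_quadruples S)"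
      by (auto simp: inj_on_def zero_sum_quadruples_def) (metis add_left_imp_eq)
    show "(\<lambda>(a, b, c, d). ((a, b), c)) ` zero_sum_quadruples S \<subseteq> Sigma (S \<times> S) r"
    proof (clarsimp simp: zero_sum_quadruples_def r_def)
      fix a b c d assume "d \<in> S" "a + b + c + d = 0"
      then have "d = - (a + b) - c" by (simp add: algebra_simps eq_neg_iff_add_eq_0)
      then show "- a - b - c \<in> S" using \<open>d \<in> S\<close> by simp
    qed
    show "finite (Sigma (S \<times> S) r)" using fin finr by auto
  qed
  also have "\<dots> = (\<Sum>s\<in>S \<times> S. card (r s))" using fin finr by (subst card_SigmaI) auto
  also have "\<dots> \<le> (\<Sum>s\<in>S \<times> S. (if s \<in> P then card S else 0) + B)"
  proof (rule sum_mono)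
    fix s assume s: "s \<in> S \<times> S"
    obtain a b where ab: "s = (a, b)" by (cases s)
    show "card (r s) \<le> (if s \<in> P then card S else 0) + B"
    proof (cases "a + b = 0")
      case True
      then have "s \<in> P" using s by (simp add: P_def ab eq_neg_iff_add_eq_0 add.commute)
      moreover have "card (r s) \<le> card S" by (rule card_mono[OF fin]) (auto simp: r_def ab)
      ultimately show ?thesis by simp
    next
      case False
      then have "card (r s) \<le> B" using B[of "- (a + b)"] by (simp add: r_def ab neg_equal_0_iff_equal del: minus_add_distrib)
      then show ?thesis by simp
    qed
  qed
  also have "\<dots> = (\<Sum>s\<in>S \<times> S. if s \<in> P then card S else 0) + card S * card S * B"
    using fin by (simp add: sum.distrib card_cartesian_product)
  also have "(\<Sum>s\<in>S \<times> S. if s \<in> P then card S else 0) = card P * card S"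
  proof -
    have "P \<subseteq> S \<times> S" by (auto simp: P_def)
    then have "S \<times> S \<inter> P = P" by auto
    then show ?thesis using fin sum.inter_restrict[of "S \<times> S" "\<lambda>_. card S" P] by simp
  qed
  also have "card P \<le> card S"
    by (rule card_inj_on_le[OF _ _ fin, of fst]) (auto simp: inj_on_def P_def)
  then have "card P * card S + card S * card S * B \<le> card S * card S + card S * card S * B" by simp
  finally show ?thesis by (simp add: power2_eq_square algebra_simps)
qed

text \<open>Two points of equal norm with sum \<open>v\<close> lie on the bisecting hyperplane of
  \<open>0\<close> and \<open>v\<close>. This turns the counting of quadruples into the counting of
  points on sections.\<close>

lemma frequencies_sum_inner:
  assumes "c \<in> frequencies E" "v - c \<in> frequencies E"
  shows "c \<bullet> v = (v \<bullet> v) / 2"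
proof -
  have "c \<bullet> c = real E" "(v - c) \<bullet> (v - c) = real E"
    using assms by (auto simp: frequencies_def power2_norm_eq_inner)
  then show ?thesis by (simp add: inner_diff inner_commute)
qed

lemma freq_count_ge:
  assumes "CARD('n::finite) \<ge> 5"
  shows "\<exists>c>0. \<exists>n0. \<forall>E\<ge>n0. c * real E powr (real CARD('n) / 2 - 17/16) \<le> real (freq_count TYPE('n) E)"
proof -
  obtain c n0 where c: "c > 0"
    and ge: "\<And>n. n \<ge> n0 \<Longrightarrow> c * real_of_int n powr (real CARD('n) / 2 - 17/16) \<le> real (card (square_sum_lists CARD('n) n))"
    using card_square_sum_lists_ge[OF assms] by blast
  have "c * real E powr (real CARD('n) / 2 - 17/16) \<le> real (freq_count TYPE('n) E)" if "E \<ge> nat n0" for E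
  proof -
    have "c * real E powr (real CARD('n) / 2 - 17/16) \<le> real (card (square_sum_lists CARD('n) (int E)))"
      using ge[of "int E"] that by (simp add: nat_le_iff)
    also have "\<dots> \<le> real (freq_count TYPE('n) E)" using card_square_sum_lists_le_freq_count by (simp only: of_nat_le_iff)
    finally show ?thesis .
  qed
  then show ?thesis using c by blast
qed

text \<open>Below any bound there are finitely many eigenvalues, hence a largest count among them,
  which \<open>freq_count\<close> eventually exceeds.\<close>

lemma filterlim_eigenvalue:
  assumes "filterlim (\<lambda>k. freq_count TYPE('n::finite) (E k)) at_top sequentially"
  shows "filterlim E at_top sequentially"
  unfolding filterlim_at_top
proof
  fix Z
  define M where "M = Max (freq_count TYPE('n) ` {..Z})"
  have "eventually (\<lambda>k. M + 1 \<le> freq_count TYPE('n) (E k)) sequentially"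
    using assms by (simp add: filterlim_at_top)
  then show "eventually (\<lambda>k. Z \<le> E k) sequentially"
  proof eventually_elim
    case (elim k)
    show ?case
    proof (rule ccontr)
      assume "\<not> Z \<le> E k"
      then have "freq_count TYPE('n) (E k) \<le> M" unfolding M_def by (intro Max_ge) auto
      then show False using elim by simp
    qed
  qed
qed

theorem zero_sum_quadruples_limit:
  assumes d: "CARD('n::finite) = 2 \<or> CARD('n) \<ge> 5"
    and lim: "filterlim (\<lambda>k. freq_count TYPE('n) (E k)) at_top sequentially"
  shows "(\<lambda>k. real (card (zero_sum_quadruples (frequencies (E k) :: (real ^ 'n) set))) / real (freq_count TYPE('n) (E k)) ^ 3) \<longlonglongrightarrow> 0"
proof -
  define N where "N = (\<lambda>k. real (freq_count TYPE('n) (E k)))"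
  have Ninf: "filterlim N at_top sequentially"
    unfolding N_def using lim filterlim_compose filterlim_real_sequentially by blast
  have Ntend: "(\<lambda>k. C / N k) \<longlonglongrightarrow> 0" for C
    by (rule real_tendsto_divide_at_top[OF tendsto_const Ninf])
  have main: ?thesis
    if B: "\<And>k v. v \<noteq> (0 :: real ^ 'n) \<Longrightarrow> real (card {c \<in> frequencies (E k). v - c \<in> frequencies (E k)}) \<le> B k"
      and B0: "(\<lambda>k. B k / N k) \<longlonglongrightarrow> 0" for B
  proof (rule tendsto_sandwich[where f = "\<lambda>_. 0" and h = "\<lambda>k. (2 + B k) / N k"])
    show "(\<lambda>k. (2 + B k) / N k) \<longlonglongrightarrow> 0"
      using tendsto_add[OF Ntend[of 2] B0] by (simp add: add_divide_distrib)
    show "(\<lambda>k. 0 :: real) \<longlonglongrightarrow> 0" by simp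
    show "eventually (\<lambda>k. real (card (zero_sum_quadruples (frequencies (E k) :: (real ^ 'n) set))) / real (freq_count TYPE('n) (E k)) ^ 3 \<le> (2 + B k) / N k) sequentially"
    proof (intro always_eventually allI)
      fix k
      define b where "b = nat \<lceil>B k\<rceil>"
      \<comment> \<open>Some nonzero vector is used to read off \<open>0 \<le> B k\<close> from the
        hypothesis, so that rounding up costs at most 1.\<close>
      have "axis undefined 1 \<noteq> (0 :: real ^ 'n)" by (simp add: axis_eq_0_iff)
      from B[OF this, of k] have "0 \<le> B k" by (rule order_trans[rotated]) simp
      then have b: "real b \<le> B k + 1" unfolding b_def by linarith
      have "card (zero_sum_quadruples (frequencies (E k) :: (real ^ 'n) set)) \<le> (card (frequencies (E k) :: (real ^ 'n) set))\<^sup>2 * (1 + b)"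
      proof (rule card_zero_sum_quadruples_le[OF finite_frequencies])
        fix v :: "real ^ 'n" assume "v \<noteq> 0"
        from B[OF this, of k] show "card {c \<in> frequencies (E k). v - c \<in> frequencies (E k)} \<le> b"
          unfolding b_def by linarith
      qed
      then have "real (card (zero_sum_quadruples (frequencies (E k) :: (real ^ 'n) set))) \<le> real ((card (frequencies (E k) :: (real ^ 'n) set))\<^sup>2 * (1 + b))"
        by (simp only: of_nat_le_iff)
      then have "real (card (zero_sum_quadruples (frequencies (E k) :: (real ^ 'n) set))) \<le> (N k)\<^sup>2 * (1 + real b)"
        by (simp add: N_def freq_count_def algebra_simps)
      also have "\<dots> \<le> (N k)\<^sup>2 * (2 + B k)" using b by (intro mult_left_mono) auto
      finally have *: "real (card (zero_sum_quadruples (frequencies (E k) :: (real ^ 'n) set))) \<le> (N k)\<^sup>2 * (2 + B k)" .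
      have "N k \<ge> 0" by (simp add: N_def)
      then show "real (card (zero_sum_quadruples (frequencies (E k) :: (real ^ 'n) set))) / real (freq_count TYPE('n) (E k)) ^ 3 \<le> (2 + B k) / N k"
      proof (cases "N k = 0")
        case False
        then have "(N k)\<^sup>2 * (2 + B k) / N k ^ 3 = (2 + B k) / N k"
          by (simp add: power2_eq_square power3_eq_cube)
        moreover have "real (card (zero_sum_quadruples (frequencies (E k) :: (real ^ 'n) set))) / N k ^ 3 \<le> (N k)\<^sup>2 * (2 + B k) / N k ^ 3"
          using \<open>N k \<ge> 0\<close> by (intro divide_right_mono[OF *]) simp
        ultimately show ?thesis by (simp only: N_def)
      qed (simp add: N_def)
    qed
  qed simp
  from d show ?thesis
  proof
    assume d2: "CARD('n) = 2"
    show ?thesis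
    proof (rule main[of "\<lambda>_. 2"])
      fix k and v :: "real ^ 'n" assume "v \<noteq> 0"
      then have "card {c \<in> frequencies (E k). v - c \<in> frequencies (E k)} \<le> 2"
      proof (rule card_two_circles_le_2[OF _ d2])
        show "finite {c \<in> frequencies (E k). v - c \<in> frequencies (E k)}"
          by (rule finite_subset[OF _ finite_frequencies[of "E k"]]) auto
        fix l assume "l \<in> {c \<in> frequencies (E k). v - c \<in> frequencies (E k)}"
        then show "l \<bullet> l = real (E k) \<and> l \<bullet> v = (v \<bullet> v) / 2"
          using frequencies_sum_inner[of l "E k" v] by (auto simp: frequencies_def power2_norm_eq_inner)
      qed
      then show "real (card {c \<in> frequencies (E k). v - c \<in> frequencies (E k)}) \<le> 2" by simp
    qed (rule Ntend)
  next
    assume d5: "CARD('n) \<ge> 5"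
    define D where "D = CARD('n)"
    have Einf: "filterlim (\<lambda>k. real (E k)) at_top sequentially"
      using filterlim_eigenvalue[OF lim] filterlim_compose filterlim_real_sequentially by blast
    obtain c n0 where c: "c > 0"
      and ge: "\<And>m. m \<ge> n0 \<Longrightarrow> c * real m powr (real D / 2 - 17/16) \<le> real (freq_count TYPE('n) m)"
      using freq_count_ge[OF d5] unfolding D_def by blast
    define B where "B = (\<lambda>k. (2 * sqrt (real (E k)) + 1) ^ (D - 3) * (18 * (real (E k) + 1) powr (1/3)))"
    show ?thesis
    proof (rule main[of B])
      fix k and v :: "real ^ 'n" assume v: "v \<noteq> 0"
      have "card {c \<in> frequencies (E k). v - c \<in> frequencies (E k)} \<le> card {l \<in> frequencies (E k). l \<bullet> v = (v \<bullet> v) / 2}"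
        by (intro card_mono finite_subset[OF _ finite_frequencies[of "E k"]]) (auto simp: frequencies_sum_inner)
      also have "real \<dots> \<le> B k" unfolding B_def D_def using d5 v by (intro card_section_le) auto
      finally show "real (card {c \<in> frequencies (E k). v - c \<in> frequencies (E k)}) \<le> B k" by simp
    next
      \<comment> \<open>\<open>36\<close> is \<open>18 * 2\<close>, the 2 covering the replacement
        of \<open>E + 1\<close> by \<open>E\<close>. The exponent \<open>-5/48\<close> below is
        \<open>(D/2 - 7/6) - (D/2 - 17/16)\<close>.\<close>
      define K where "K = 3 ^ (D - 3) * 36 / c"
      show "(\<lambda>k. B k / N k) \<longlonglongrightarrow> 0"
      proof (rule tendsto_sandwich[where f = "\<lambda>_. 0" and h = "\<lambda>k. K * real (E k) powr (- (5/48))"])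
        show "(\<lambda>k. 0 :: real) \<longlonglongrightarrow> 0" by simp
        show "eventually (\<lambda>k. 0 \<le> B k / N k) sequentially" by (simp add: B_def N_def)
        show "(\<lambda>k. K * real (E k) powr (- (5/48))) \<longlonglongrightarrow> 0"
          using tendsto_mult_right_zero[OF tendsto_neg_powr[OF _ Einf, of "- (5/48)"], of K] by simp
        have "eventually (\<lambda>k. real (E k) \<ge> max 1 (real n0)) sequentially"
          using Einf unfolding filterlim_at_top by blast
        then show "eventually (\<lambda>k. B k / N k \<le> K * real (E k) powr (- (5/48))) sequentially"
        proof eventually_elim
          case (elim k)
          define x where "x = real (E k)"
          have x1: "x \<ge> 1" using elim by (simp add: x_def)
          have Nk: "c * x powr (real D / 2 - 17/16) \<le> N k" unfolding N_def x_def using elim by (intro ge) auto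
          have "(2 * sqrt x + 1) ^ (D - 3) \<le> (3 * sqrt x) ^ (D - 3)" using x1 by (intro power_mono) auto
          also have "\<dots> = 3 ^ (D - 3) * x powr ((real D - 3) / 2)"
            using x1 d5 by (simp add: power_mult_distrib powr_half_sqrt[symmetric] powr_realpow[symmetric] powr_powr D_def of_nat_diff)
          finally have 1: "(2 * sqrt x + 1) ^ (D - 3) \<le> 3 ^ (D - 3) * x powr ((real D - 3) / 2)" .
          have "(x + 1) powr (1/3) \<le> (2 * x) powr (1/3)" using x1 by (intro powr_mono2) auto
          also have "\<dots> = 2 powr (1/3) * x powr (1/3)" using x1 by (simp add: powr_mult)
          also have "\<dots> \<le> 2 powr 1 * x powr (1/3)" by (intro mult_right_mono powr_mono) auto
          finally have 2: "(x + 1) powr (1/3) \<le> 2 * x powr (1/3)" by simp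
          have "B k \<le> (3 ^ (D - 3) * x powr ((real D - 3) / 2)) * (18 * (2 * x powr (1/3)))"
            unfolding B_def x_def[symmetric] using 1 2 x1 by (intro mult_mono[OF _ mult_left_mono]) auto
          also have "\<dots> = 3 ^ (D - 3) * 36 * (x powr ((real D - 3) / 2) * x powr (1/3))" by simp
          also have "x powr ((real D - 3) / 2) * x powr (1/3) = x powr (real D / 2 - 7/6)"
            by (simp flip: powr_add add: algebra_simps diff_divide_distrib)
          finally have Bk: "B k \<le> 3 ^ (D - 3) * 36 * x powr (real D / 2 - 7/6)" .
          have "B k / N k \<le> (3 ^ (D - 3) * 36 * x powr (real D / 2 - 7/6)) / (c * x powr (real D / 2 - 17/16))"
            using Bk Nk x1 c by (intro frac_le) (auto simp: B_def)
          also have "\<dots> = K * (x powr (real D / 2 - 7/6) / x powr (real D / 2 - 17/16))" by (simp add: K_def)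
          also have "\<dots> = K * x powr (- (5/48))" by (simp flip: powr_diff)
          finally show ?case by (simp add: x_def)
        qed
      qed
    qed
  qed
qed

section \<open>Moments of the covariance function\<close>

definition unit_cube :: "(real ^ 'n::finite) set" where
  "unit_cube = {x. \<forall>i. 0 \<le> x $ i \<and> x $ i < 1}"

definition torus :: "(real ^ 'n::finite) measure" where
  "torus = restrict_space lborel unit_cube"

lemma Basis_vec_eq: "(Basis :: (real ^ 'n::finite) set) = (\<lambda>i. axis i 1) ` UNIV"
  by (auto simp: Basis_vec_def)

text \<open>Product integrals over \<open>lborel\<close> are indexed by the standard basis; this
  reindexing by coordinates lets Fubini be stated with \<open>x $ i\<close>.\<close>

lemma prod_Basis_vec:
  fixes f :: "'n::finite \<Rightarrow> 'b::comm_monoid_mult"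
  shows "(\<Prod>b\<in>(Basis :: (real ^ 'n) set). f (THE i. b = axis i 1)) = (\<Prod>i\<in>UNIV. f i)"
proof -
  have inj: "inj (\<lambda>i::'n. axis i (1::real))" by (auto simp: inj_on_def axis_eq_axis)
  have "(\<Prod>b\<in>(Basis :: (real ^ 'n) set). f (THE i. b = axis i 1)) = (\<Prod>i\<in>UNIV. f (THE j. axis i (1::real) = axis j 1))"
    unfolding Basis_vec_eq by (subst prod.reindex[OF inj]) simp
  also have "\<dots> = (\<Prod>i\<in>UNIV. f i)" by (simp add: axis_eq_axis)
  finally show ?thesis .
qed

lemma vec_nth_eq_inner_Basis:
  fixes x :: "real ^ 'n::finite"
  assumes "b \<in> Basis"
  shows "x \<bullet> b = x $ (THE i. b = axis i 1)"
  using assms by (auto simp: Basis_vec_eq axis_eq_axis inner_axis)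

lemma nn_integral_prod_vec:
  fixes f :: "'n::finite \<Rightarrow> real \<Rightarrow> ennreal"
  assumes "\<And>i. f i \<in> borel_measurable borel"
  shows "(\<integral>\<^sup>+x. (\<Prod>i\<in>UNIV. f i (x $ i)) \<partial>lborel) = (\<Prod>i\<in>UNIV. \<integral>\<^sup>+t. f i t \<partial>lborel)"
proof -
  let ?i = "\<lambda>b :: real ^ 'n. THE i. b = axis i 1"
  have "(\<integral>\<^sup>+x. (\<Prod>i\<in>UNIV. f i (x $ i)) \<partial>lborel) = (\<integral>\<^sup>+x. (\<Prod>b\<in>(Basis :: (real ^ 'n) set). f (?i b) (x \<bullet> b)) \<partial>lborel)"
    by (intro nn_integral_cong) (simp add: vec_nth_eq_inner_Basis prod_Basis_vec[of "\<lambda>i. f i (_ $ i)", symmetric])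
  also have "\<dots> = (\<Prod>b\<in>(Basis :: (real ^ 'n) set). \<integral>\<^sup>+t. f (?i b) t \<partial>lborel)"
    by (rule nn_integral_lborel_prod) (use assms in auto)
  also have "\<dots> = (\<Prod>i\<in>UNIV. \<integral>\<^sup>+t. f i t \<partial>lborel)" by (rule prod_Basis_vec)
  finally show ?thesis .
qed

lemma integral_prod_vec:
  fixes f :: "'n::finite \<Rightarrow> real \<Rightarrow> complex"
  assumes "\<And>i. integrable lborel (f i)"
  shows "(\<integral>x. (\<Prod>i\<in>UNIV. f i (x $ i)) \<partial>lborel) = (\<Prod>i\<in>UNIV. \<integral>t. f i t \<partial>lborel)"
proof -
  interpret product_sigma_finite "\<lambda>_ :: real ^ 'n. lborel :: real measure" ..
  let ?i = "\<lambda>b :: real ^ 'n. THE i. b = axis i 1"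
  have [measurable]: "f i \<in> borel_measurable borel" for i
    using borel_measurable_integrable[OF assms] by simp
  have "(\<integral>x. (\<Prod>i\<in>UNIV. f i (x $ i)) \<partial>lborel) = (\<integral>x. (\<Prod>b\<in>(Basis :: (real ^ 'n) set). f (?i b) (x \<bullet> b)) \<partial>lborel)"
    by (intro Bochner_Integration.integral_cong) (simp_all add: vec_nth_eq_inner_Basis prod_Basis_vec[of "\<lambda>i. f i (_ $ i)", symmetric])
  also have "\<dots> = (\<integral>x. (\<Prod>b\<in>(Basis :: (real ^ 'n) set). f (?i b) (x b)) \<partial>(\<Pi>\<^sub>M b\<in>Basis. lborel))"
    by (subst lborel_eq, subst integral_distr) (auto intro!: Bochner_Integration.integral_cong prod.cong)
  also have "\<dots> = (\<Prod>b\<in>(Basis :: (real ^ 'n) set). \<integral>t. f (?i b) t \<partial>lborel)"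
    by (rule product_integral_prod) (use assms in auto)
  also have "\<dots> = (\<Prod>i\<in>UNIV. \<integral>t. f i t \<partial>lborel)" by (rule prod_Basis_vec)
  finally show ?thesis .
qed

lemma unit_cube_measurable [measurable]: "unit_cube \<in> sets borel"
  unfolding unit_cube_def by measurable

lemma indicator_unit_cube:
  "indicator unit_cube x = (\<Prod>i\<in>UNIV. indicator {0..<1} (x $ i) :: 'b::{comm_semiring_1})"
proof (cases "x \<in> unit_cube")
  case False
  then obtain i where "x $ i \<notin> {0..<1}" by (auto simp: unit_cube_def)
  then have "(indicator {0..<1} (x $ i) :: 'b) = 0" by (rule indicator_simps(2))
  then have "(\<Prod>i\<in>UNIV. indicator {0..<1} (x $ i) :: 'b) = 0" by (intro prod_zero) auto
  then show ?thesis using False by simp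
qed (auto simp: unit_cube_def)

lemma emeasure_unit_cube: "emeasure lborel (unit_cube :: (real ^ 'n::finite) set) = 1"
proof -
  have "emeasure lborel (unit_cube :: (real ^ 'n) set) = (\<integral>\<^sup>+x. indicator (unit_cube :: (real ^ 'n) set) x \<partial>lborel)" by simp
  also have "\<dots> = (\<integral>\<^sup>+x. (\<Prod>i\<in>UNIV. indicator {0..<1} (x $ i)) \<partial>(lborel :: (real ^ 'n) measure))"
    by (simp only: indicator_unit_cube)
  also have "\<dots> = (\<Prod>i\<in>(UNIV :: 'n set). \<integral>\<^sup>+t. indicator {0..<1::real} t \<partial>lborel)"
    by (rule nn_integral_prod_vec) simp
  also have "\<dots> = 1" by simp
  finally show ?thesis .
qed

lemma prob_space_torus: "prob_space torus"
  by standard (simp add: torus_def emeasure_restrict_space space_restrict_space emeasure_unit_cube)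

interpretation torus: prob_space "torus :: (real ^ 'n::finite) measure" by (rule prob_space_torus)

lemma borel_measurable_torus:
  "f \<in> borel_measurable borel \<Longrightarrow> f \<in> borel_measurable torus"
  unfolding torus_def by (intro measurable_restrict_space1) simp

lemma integral_torus:
  fixes f :: "real ^ 'n::finite \<Rightarrow> 'b::{banach, second_countable_topology}"
  shows "(\<integral>x. f x \<partial>torus) = (\<integral>x. indicator unit_cube x *\<^sub>R f x \<partial>lborel)"
  by (simp add: torus_def integral_restrict_space)

lemma nn_integral_torus:
  "(\<integral>\<^sup>+x. f x \<partial>torus) = (\<integral>\<^sup>+x. f x * indicator unit_cube x \<partial>lborel)"
  by (simp add: torus_def nn_integral_restrict_space)

lemma integral_cis_unit_interval:
  assumes "m \<in> \<int>"
  shows "has_bochner_integral lborel (\<lambda>t. indicator {0..<1} t *\<^sub>R cis (2 * pi * (m * t))) (if m = 0 then 1 else 0)"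
proof -
  \<comment> \<open>The fundamental theorem of calculus works on the closed interval, the torus on
    the half-open one; they differ by a null point.\<close>
  have ae: "AE t in lborel. indicator {0..1} t *\<^sub>R cis (2 * pi * (m * t)) = indicator {0..<1} t *\<^sub>R cis (2 * pi * (m * t))"
    using AE_lborel_singleton[of "1::real"] by eventually_elim (auto split: split_indicator)
  have "has_bochner_integral lborel (\<lambda>t. indicator {0..1} t *\<^sub>R cis (2 * pi * (m * t))) (if m = 0 then 1 else 0)"
  proof (cases "m = 0")
    case True
    have "has_bochner_integral lborel (\<lambda>t. indicator {0..1::real} t *\<^sub>R (1::complex)) (measure lborel {0..1::real} *\<^sub>R 1)"
      by (intro has_bochner_integral_scaleR_left has_bochner_integral_real_indicator) auto
    then show ?thesis using True by simp
  next
    case False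
    define c where "c = 2 * pi * m"
    have c: "c \<noteq> 0" using False by (simp add: c_def)
    have "has_bochner_integral lborel (\<lambda>t. indicator {0..1} t *\<^sub>R cis (c * t)) (cis (c * 1) / (\<i> * c) - cis (c * 0) / (\<i> * c))"
    proof (rule has_bochner_integral_FTC_Icc)
      fix t
      have "((\<lambda>t. c * t) has_derivative (\<lambda>h. c * h)) (at t within {0..1})"
        by (intro derivative_intros)
      from has_derivative_mult_left[OF has_derivative_cis[OF this], of "1 / (\<i> * c)"]
      show "((\<lambda>t. cis (c * t) / (\<i> * c)) has_vector_derivative cis (c * t)) (at t within {0..1})"
        using c by (simp add: has_vector_derivative_def scaleR_conv_of_real field_simps)
    qed (auto intro!: continuous_intros)
    moreover have "cis (c * 1) = 1" using assms cis_multiple_2pi[of m] by (simp add: c_def)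
    ultimately show ?thesis using False by (simp add: c_def mult.assoc)
  qed
  then show ?thesis
    by (subst has_bochner_integral_cong_AE[OF _ _ ae, symmetric])
       (auto intro!: borel_measurable_scaleR borel_measurable_indicator borel_measurable_continuous_onI[of "\<lambda>t. cis (2 * pi * (m * t))"] continuous_intros)
qed

text \<open>The exponential factors over the coordinates; one nonzero integer coordinate already
  makes the product of integrals vanish.\<close>

lemma integral_torus_cis:
  fixes m :: "real ^ 'n::finite"
  assumes "\<And>i. m $ i \<in> \<int>"
  shows "(\<integral>x. cis (2 * pi * (m \<bullet> x)) \<partial>torus) = (if m = 0 then 1 else 0)"
proof -
  define f where "f = (\<lambda>i t. indicator {0..<1} t *\<^sub>R cis (2 * pi * (m $ i * t)))"
  have f: "has_bochner_integral lborel (f i) (if m $ i = 0 then 1 else 0)" for i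
    unfolding f_def by (rule integral_cis_unit_interval[OF assms])
  have "indicator unit_cube x *\<^sub>R cis (2 * pi * (m \<bullet> x)) = (\<Prod>i\<in>UNIV. f i (x $ i))" for x
  proof -
    have "cis (2 * pi * (m \<bullet> x)) = (\<Prod>i\<in>UNIV. cis (2 * pi * (m $ i * x $ i)))"
      by (simp add: cis_conv_exp inner_vec_def sum_distrib_left of_real_sum exp_sum)
    then show ?thesis unfolding f_def indicator_unit_cube
      by (simp add: scaleR_conv_of_real prod.distrib of_real_prod)
  qed
  then have "(\<integral>x. cis (2 * pi * (m \<bullet> x)) \<partial>torus) = (\<integral>x. (\<Prod>i\<in>UNIV. f i (x $ i)) \<partial>lborel)"
    by (simp add: integral_torus)
  also have "\<dots> = (\<Prod>i\<in>UNIV. \<integral>t. f i t \<partial>lborel)"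
    by (rule integral_prod_vec) (use f in \<open>auto intro: integrable.intros\<close>)
  also have "\<dots> = (\<Prod>i\<in>UNIV. if m $ i = 0 then 1 else 0)"
    by (intro prod.cong refl has_bochner_integral_integral_eq f)
  also have "\<dots> = (if m = 0 then 1 else 0)"
  proof (cases "m = 0")
    case False
    then obtain i where "m $ i \<noteq> 0" by (auto simp: vec_eq_iff)
    then have "(\<Prod>i\<in>UNIV. if m $ i = 0 then 1 else 0 :: complex) = 0" by (intro prod_zero bexI[of _ i]) auto
    then show ?thesis using False by simp
  qed simp
  finally show ?thesis .
qed

lemma integral_torus_cis_shift:
  fixes m y :: "real ^ 'n::finite"
  assumes "\<And>i. m $ i \<in> \<int>"
  shows "(\<integral>x. cis (2 * pi * (m \<bullet> (x - y))) \<partial>torus) = (if m = 0 then 1 else 0)"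
proof -
  have "cis (2 * pi * (m \<bullet> (x - y))) = cis (2 * pi * (m \<bullet> x)) * cis (- (2 * pi * (m \<bullet> y)))" for x
    by (simp add: cis_mult inner_diff_right algebra_simps)
  then have "(\<integral>x. cis (2 * pi * (m \<bullet> (x - y))) \<partial>torus) = (\<integral>x. cis (2 * pi * (m \<bullet> x)) \<partial>torus) * cis (- (2 * pi * (m \<bullet> y)))"
    by simp
  then show ?thesis unfolding integral_torus_cis[OF assms] by simp
qed

section \<open>The covariance function and its second and fourth moments\<close>

definition covariance :: "nat \<Rightarrow> real ^ 'n::finite \<Rightarrow> real ^ 'n \<Rightarrow> real" where
  "covariance E x y = (\<Sum>l\<in>frequencies E. cos (2 * pi * (l \<bullet> (x - y)))) / real (freq_count TYPE('n) E)"

lemma borel_measurable_covariance [measurable]: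
  fixes f g :: "'a \<Rightarrow> real ^ 'n::finite"
  assumes [measurable]: "f \<in> borel_measurable M" "g \<in> borel_measurable M"
  shows "(\<lambda>z. covariance E (f z) (g z)) \<in> borel_measurable M"
proof -
  have "(\<lambda>z. l \<bullet> (f z - g z)) \<in> borel_measurable M" for l :: "real ^ 'n" by measurable
  then have "(\<lambda>z. cos (2 * pi * (l \<bullet> (f z - g z)))) \<in> borel_measurable M" for l :: "real ^ 'n"
    by (intro measurable_compose[OF _ borel_measurable_continuous_onI[of cos]] borel_measurable_times borel_measurable_const)
       (auto intro!: continuous_intros)
  then show ?thesis unfolding covariance_def by (intro borel_measurable_divide borel_measurable_sum borel_measurable_const)
qed

lemma uminus_frequencies: "uminus ` frequencies E = frequencies E"
proof -
  have neg: "- l \<in> frequencies E" if "l \<in> frequencies E" for l :: "real ^ 'a"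
    using that by (simp add: frequencies_def)
  then have "l \<in> uminus ` frequencies E" if "l \<in> frequencies E" for l :: "real ^ 'a"
    using that image_eqI[of l uminus "- l" "frequencies E"] by simp
  with neg show ?thesis by blast
qed

text \<open>The sines cancel because the frequencies are symmetric under negation. With
  exponentials, powers of the covariance expand into characters and moments become counts of
  vanishing sums.\<close>

lemma covariance_cis:
  fixes x y :: "real ^ 'n::finite"
  shows "complex_of_real (covariance E x y) =
    (\<Sum>l\<in>frequencies E. cis (2 * pi * (l \<bullet> (x - y)))) / of_nat (freq_count TYPE('n) E)"
proof -
  have "(\<Sum>l\<in>frequencies E. sin (2 * pi * (l \<bullet> (x - y)))) = (\<Sum>l\<in>uminus ` frequencies E. sin (2 * pi * (l \<bullet> (x - y))))"
    by (simp only: uminus_frequencies)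
  also have "\<dots> = - (\<Sum>l\<in>frequencies E. sin (2 * pi * (l \<bullet> (x - y))))"
    by (subst sum.reindex) (auto simp: inj_on_def sum_negf)
  finally have "(\<Sum>l\<in>frequencies E. sin (2 * pi * (l \<bullet> (x - y)))) = 0" by simp
  then have "(\<Sum>l\<in>frequencies E. cis (2 * pi * (l \<bullet> (x - y)))) = of_real (\<Sum>l\<in>frequencies E. cos (2 * pi * (l \<bullet> (x - y))))"
    by (simp add: complex_eq_iff)
  then show ?thesis by (simp add: covariance_def)
qed

lemma frequencies_Ints: "l \<in> frequencies E \<Longrightarrow> l $ i \<in> \<int>"
  by (simp add: frequencies_def)

lemma integrable_torus_cis: "integrable torus (\<lambda>x. cis (2 * pi * (m \<bullet> (x - y))))"
proof (rule torus.integrable_const_bound[of _ 1])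
  show "(\<lambda>x. cis (2 * pi * (m \<bullet> (x - y)))) \<in> borel_measurable torus"
    by (intro borel_measurable_torus borel_measurable_continuous_onI continuous_intros)
qed simp

lemma integral_torus_exponential_sum:
  fixes y :: "real ^ 'n::finite"
  assumes "finite S" "\<And>s i. s \<in> S \<Longrightarrow> g s $ i \<in> \<int>"
  shows "(\<integral>x. (\<Sum>s\<in>S. cis (2 * pi * (g s \<bullet> (x - y)))) \<partial>torus) = of_nat (card {s \<in> S. g s = 0})"
proof -
  have "(\<integral>x. (\<Sum>s\<in>S. cis (2 * pi * (g s \<bullet> (x - y)))) \<partial>torus) = (\<Sum>s\<in>S. \<integral>x. cis (2 * pi * (g s \<bullet> (x - y))) \<partial>torus)"
    by (rule Bochner_Integration.integral_sum) (rule integrable_torus_cis)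
  also have "\<dots> = (\<Sum>s\<in>S. if g s = 0 then 1 else 0)"
    by (intro sum.cong refl integral_torus_cis_shift assms(2))
  also have "\<dots> = of_nat (card {s \<in> S. g s = 0})"
    using assms(1) by (simp flip: sum.inter_filter)
  finally show ?thesis .
qed

lemma exponential_sum_mult:
  "(\<Sum>s\<in>S. cis (2 * pi * (g s \<bullet> z))) * (\<Sum>t\<in>T. cis (2 * pi * (h t \<bullet> z)))
    = (\<Sum>p\<in>S \<times> T. cis (2 * pi * ((g (fst p) + h (snd p)) \<bullet> z)))"
  by (simp add: sum_product sum.cartesian_product cis_mult inner_add_left distrib_left split_beta)

lemma integral_covariance_square:
  fixes y :: "real ^ 'n::finite"
  assumes "freq_count TYPE('n) E > 0"
  shows "(\<integral>x. (covariance E x y)\<^sup>2 \<partial>torus) = 1 / real (freq_count TYPE('n) E)"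
proof -
  define F where "F = (frequencies E :: (real ^ 'n) set)"
  define N where "N = freq_count TYPE('n) E"
  have finF: "finite F" by (simp add: F_def finite_frequencies)
  have "complex_of_real ((covariance E x y)\<^sup>2) = (\<Sum>p\<in>F \<times> F. cis (2 * pi * ((fst p + snd p) \<bullet> (x - y)))) / of_nat N ^ 2" for x
    by (simp add: covariance_cis F_def[symmetric] N_def[symmetric] power_divide)
       (simp add: power2_eq_square exponential_sum_mult)
  then have "complex_of_real (\<integral>x. (covariance E x y)\<^sup>2 \<partial>torus) = (\<integral>x. (\<Sum>p\<in>F \<times> F. cis (2 * pi * ((fst p + snd p) \<bullet> (x - y)))) \<partial>torus) / of_nat N ^ 2"
    by (simp flip: integral_complex_of_real)
  also have "\<dots> = of_nat (card {p \<in> F \<times> F. fst p + snd p = 0}) / of_nat N ^ 2"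
    by (subst integral_torus_exponential_sum) (use finF in \<open>auto simp: F_def frequencies_Ints\<close>)
  also have "{p \<in> F \<times> F. fst p + snd p = 0} = (\<lambda>a. (a, - a)) ` F"
    using uminus_frequencies[of E] by (auto simp: F_def eq_neg_iff_add_eq_0 add.commute image_iff)
  also have "card \<dots> = N" by (subst card_image) (auto simp: inj_on_def N_def F_def freq_count_def)
  also have "of_nat N / of_nat N ^ 2 = complex_of_real (1 / real N)"
    using assms by (simp add: N_def power2_eq_square)
  finally show ?thesis by (simp only: of_real_eq_iff N_def)
qed

lemma integral_covariance_fourth:
  fixes y :: "real ^ 'n::finite"
  shows "(\<integral>x. (covariance E x y) ^ 4 \<partial>torus)
    = real (card (zero_sum_quadruples (frequencies E :: (real ^ 'n) set))) / real (freq_count TYPE('n) E) ^ 4"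
proof -
  define F where "F = (frequencies E :: (real ^ 'n) set)"
  define N where "N = freq_count TYPE('n) E"
  have finF: "finite F" by (simp add: F_def finite_frequencies)
  define g where "g = (\<lambda>p :: (real ^ 'n) \<times> (real ^ 'n) \<times> (real ^ 'n) \<times> (real ^ 'n).
    fst p + (fst (snd p) + (fst (snd (snd p)) + snd (snd (snd p)))))"
  have pow: "t ^ 4 = t * (t * (t * t))" for t :: complex by (simp add: power4_eq_xxxx mult.assoc)
  have "complex_of_real ((covariance E x y) ^ 4) = (\<Sum>p\<in>F \<times> F \<times> F \<times> F. cis (2 * pi * (g p \<bullet> (x - y)))) / of_nat N ^ 4" for x
    by (simp add: covariance_cis F_def[symmetric] N_def[symmetric] power_divide)
       (simp add: pow exponential_sum_mult g_def)
  then have "complex_of_real (\<integral>x. (covariance E x y) ^ 4 \<partial>torus) = (\<integral>x. (\<Sum>p\<in>F \<times> F \<times> F \<times> F. cis (2 * pi * (g p \<bullet> (x - y)))) \<partial>torus) / of_nat N ^ 4"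
    by (simp flip: integral_complex_of_real)
  also have "\<dots> = of_nat (card {p \<in> F \<times> F \<times> F \<times> F. g p = 0}) / of_nat N ^ 4"
    by (subst integral_torus_exponential_sum) (use finF in \<open>auto simp: F_def frequencies_Ints g_def\<close>)
  also have "{p \<in> F \<times> F \<times> F \<times> F. g p = 0} = zero_sum_quadruples F"
    by (auto simp: zero_sum_quadruples_def g_def add.assoc)
  finally have "complex_of_real (\<integral>x. (covariance E x y) ^ 4 \<partial>torus) = complex_of_real (real (card (zero_sum_quadruples F)) / real N ^ 4)"
    by simp
  then show ?thesis by (simp only: of_real_eq_iff F_def N_def)
qed

section \<open>The singular set of the covariance\<close>

lemma sum_frequencies_symmetry:
  fixes T :: "real ^ 'n::finite \<Rightarrow> real ^ 'n"
  assumes "\<And>l. l \<in> frequencies E \<Longrightarrow> T l \<in> frequencies E" "\<And>l. T (T l) = l"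
  shows "(\<Sum>l\<in>frequencies E. g (T l)) = (\<Sum>l\<in>frequencies E. g l)"
  by (rule sum.reindex_bij_witness[of _ T T]) (use assms in auto)

lemma frequencies_iff_sum:
  "l \<in> frequencies E \<longleftrightarrow> (\<forall>i. l $ i \<in> \<int>) \<and> (\<Sum>i\<in>UNIV. (l $ i)\<^sup>2) = real E"
  unfolding frequencies_def power2_norm_eq_inner inner_vec_def by (simp add: power2_eq_square)

text \<open>Reflecting the single coordinate \<open>i\<close> preserves the frequencies and changes
  the sign of the sum.\<close>

lemma sum_frequencies_mixed:
  fixes i j :: "'n::finite"
  assumes "i \<noteq> j"
  shows "(\<Sum>l\<in>frequencies E. l $ i * l $ j) = 0"
proof -
  define T :: "real ^ 'n \<Rightarrow> real ^ 'n" where "T = (\<lambda>l. \<chi> m. if m = i then - l $ m else l $ m)"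
  have "(\<Sum>l\<in>frequencies E. l $ i * l $ j) = (\<Sum>l\<in>frequencies E. T l $ i * T l $ j)"
  proof (rule sum_frequencies_symmetry[symmetric])
    fix l :: "real ^ 'n" assume "l \<in> frequencies E"
    moreover have "(T l $ m)\<^sup>2 = (l $ m)\<^sup>2" for m by (simp add: T_def)
    ultimately show "T l \<in> frequencies E" by (simp add: frequencies_iff_sum) (simp add: T_def)
  qed (simp add: T_def vec_eq_iff)
  also have "\<dots> = - (\<Sum>l\<in>frequencies E. l $ i * l $ j)"
    using assms by (simp add: T_def sum_negf)
  finally show ?thesis by simp
qed

lemma sum_frequencies_square_eq:
  fixes i j :: "'n::finite"
  shows "(\<Sum>l\<in>frequencies E. (l $ i)\<^sup>2) = (\<Sum>l\<in>frequencies E. (l $ j)\<^sup>2)"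
proof -
  define \<tau> where "\<tau> = (\<lambda>m. if m = i then j else if m = j then i else m)"
  have \<tau>: "\<tau> (\<tau> m) = m" for m by (simp add: \<tau>_def)
  define T :: "real ^ 'n \<Rightarrow> real ^ 'n" where "T = (\<lambda>l. \<chi> m. l $ \<tau> m)"
  have "(\<Sum>l\<in>frequencies E. (l $ i)\<^sup>2) = (\<Sum>l\<in>frequencies E. (T l $ i)\<^sup>2)"
  proof (rule sum_frequencies_symmetry[symmetric])
    fix l :: "real ^ 'n" assume "l \<in> frequencies E"
    moreover have "(\<Sum>m\<in>UNIV. (l $ \<tau> m)\<^sup>2) = (\<Sum>m\<in>UNIV. (l $ m)\<^sup>2)"
      by (rule sum.reindex_bij_witness[of _ \<tau> \<tau>]) (use \<tau> in auto)
    ultimately show "T l \<in> frequencies E" by (simp add: frequencies_iff_sum T_def)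
  qed (simp add: T_def vec_eq_iff \<tau>)
  then show ?thesis by (simp add: T_def \<tau>_def)
qed

text \<open>Isotropy: reflections kill the mixed terms, and coordinate swaps make the diagonal ones
  equal, so each is \<open>1 / d\<close> of the sum of \<open>norm l\<close> squared.\<close>

lemma sum_frequencies_inner_square:
  fixes v :: "real ^ 'n::finite"
  shows "(\<Sum>l\<in>frequencies E. (l \<bullet> v)\<^sup>2) = real (freq_count TYPE('n) E) * real E / real CARD('n) * (v \<bullet> v)"
proof -
  fix i0 :: 'n
  define S where "S = (\<Sum>l\<in>(frequencies E :: (real ^ 'n) set). (l $ i0)\<^sup>2)"
  have S: "(\<Sum>l\<in>frequencies E. (l $ i)\<^sup>2) = S" for i :: 'n
    unfolding S_def by (rule sum_frequencies_square_eq)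
  have "real CARD('n) * S = (\<Sum>i\<in>(UNIV :: 'n set). S)" by simp
  also have "\<dots> = (\<Sum>i\<in>(UNIV :: 'n set). \<Sum>l\<in>frequencies E. (l $ i)\<^sup>2)" by (simp only: S)
  also have "\<dots> = (\<Sum>l\<in>frequencies E. \<Sum>i\<in>(UNIV :: 'n set). (l $ i)\<^sup>2)" by (rule sum.swap)
  also have "\<dots> = (\<Sum>l\<in>(frequencies E :: (real ^ 'n) set). real E)"
    by (intro sum.cong) (auto simp: frequencies_iff_sum)
  also have "\<dots> = real (freq_count TYPE('n) E) * real E" by (simp add: freq_count_def)
  finally have S_eq: "S = real (freq_count TYPE('n) E) * real E / real CARD('n)" by (simp add: field_simps)
  have "(\<Sum>l\<in>frequencies E. (l \<bullet> v)\<^sup>2) = (\<Sum>l\<in>frequencies E. \<Sum>i\<in>UNIV. \<Sum>j\<in>UNIV. (v $ i * v $ j) * (l $ i * l $ j))"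
    by (simp add: inner_vec_def power2_eq_square sum_product algebra_simps)
  also have "\<dots> = (\<Sum>i\<in>UNIV. \<Sum>l\<in>frequencies E. \<Sum>j\<in>UNIV. (v $ i * v $ j) * (l $ i * l $ j))"
    by (rule sum.swap)
  also have "\<dots> = (\<Sum>i\<in>UNIV. \<Sum>j\<in>UNIV. \<Sum>l\<in>frequencies E. (v $ i * v $ j) * (l $ i * l $ j))"
    by (intro sum.cong refl sum.swap)
  also have "\<dots> = (\<Sum>i\<in>UNIV. \<Sum>j\<in>UNIV. (v $ i * v $ j) * (if j = i then S else 0))"
  proof (intro sum.cong refl)
    fix i j :: 'n
    have "(\<Sum>l\<in>frequencies E. l $ i * l $ j) = (if j = i then S else 0)"
      using sum_frequencies_mixed[of i j E] S[of i] by (auto simp: power2_eq_square)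
    then show "(\<Sum>l\<in>frequencies E. (v $ i * v $ j) * (l $ i * l $ j)) = (v $ i * v $ j) * (if j = i then S else 0)"
      by (simp flip: sum_distrib_left)
  qed
  also have "\<dots> = (\<Sum>i\<in>UNIV. v $ i * v $ i * S)" by (simp add: if_distrib cong: if_cong)
  also have "\<dots> = S * (v \<bullet> v)" by (simp add: inner_vec_def sum_distrib_left mult.commute)
  finally show ?thesis by (simp add: S_eq)
qed

lemma abs_cos_diff_le: "\<bar>cos a - cos b\<bar> \<le> \<bar>a - b\<bar>" for a b :: real
  using abs_Re_le_cmod[of "cis a - cis b"] norm_cis_diff_le[of a b] by simp

lemma abs_inner_frequency_le:
  assumes "l \<in> frequencies E"
  shows "\<bar>l \<bullet> v\<bar> \<le> sqrt (real E) * norm v"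
proof -
  have "norm l = sqrt (real E)" using assms by (auto simp: frequencies_def intro: real_sqrt_unique[symmetric])
  then show ?thesis using Cauchy_Schwarz_ineq2[of l v] by simp
qed

lemma covariance_lipschitz:
  fixes x x' y :: "real ^ 'n::finite"
  assumes "freq_count TYPE('n) E > 0"
  shows "\<bar>covariance E x y - covariance E x' y\<bar> \<le> 2 * pi * sqrt (real E) * norm (x - x')"
proof -
  define N where "N = real (freq_count TYPE('n) E)"
  have N: "N > 0" using assms by (simp add: N_def)
  have "\<bar>\<Sum>l\<in>frequencies E. cos (2 * pi * (l \<bullet> (x - y))) - cos (2 * pi * (l \<bullet> (x' - y)))\<bar>
      \<le> (\<Sum>l\<in>(frequencies E :: (real ^ 'n) set). 2 * pi * sqrt (real E) * norm (x - x'))"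
  proof (intro order_trans[OF sum_abs] sum_mono)
    fix l :: "real ^ 'n" assume l: "l \<in> frequencies E"
    have "\<bar>cos (2 * pi * (l \<bullet> (x - y))) - cos (2 * pi * (l \<bullet> (x' - y)))\<bar> \<le> \<bar>2 * pi * (l \<bullet> (x - y)) - 2 * pi * (l \<bullet> (x' - y))\<bar>"
      by (rule abs_cos_diff_le)
    also have "2 * pi * (l \<bullet> (x - y)) - 2 * pi * (l \<bullet> (x' - y)) = 2 * pi * (l \<bullet> (x - x'))"
      by (simp add: inner_diff_right algebra_simps)
    also have "\<bar>2 * pi * (l \<bullet> (x - x'))\<bar> = 2 * pi * \<bar>l \<bullet> (x - x')\<bar>" by (simp add: abs_mult)
    also have "\<dots> \<le> 2 * pi * (sqrt (real E) * norm (x - x'))"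
      by (intro mult_left_mono abs_inner_frequency_le l) auto
    finally show "\<bar>cos (2 * pi * (l \<bullet> (x - y))) - cos (2 * pi * (l \<bullet> (x' - y)))\<bar> \<le> 2 * pi * sqrt (real E) * norm (x - x')"
      by (simp add: mult.assoc)
  qed
  also have "\<dots> = N * (2 * pi * sqrt (real E) * norm (x - x'))" by (simp add: N_def freq_count_def)
  finally have "\<bar>\<Sum>l\<in>frequencies E. cos (2 * pi * (l \<bullet> (x - y))) - cos (2 * pi * (l \<bullet> (x' - y)))\<bar> / N \<le> 2 * pi * sqrt (real E) * norm (x - x')"
    using N by (simp add: pos_divide_le_eq mult.commute)
  moreover have "covariance E x y - covariance E x' y = (\<Sum>l\<in>frequencies E. cos (2 * pi * (l \<bullet> (x - y))) - cos (2 * pi * (l \<bullet> (x' - y)))) / N"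
    by (simp add: covariance_def N_def sum_subtractf diff_divide_distrib)
  ultimately show ?thesis using N by (simp add: abs_divide)
qed

lemma abs_covariance_le: "\<bar>covariance E x y\<bar> \<le> 1"
proof -
  have "\<bar>\<Sum>l\<in>frequencies E. cos (2 * pi * (l \<bullet> (x - y)))\<bar> \<le> (\<Sum>l\<in>(frequencies E :: (real ^ 'a) set). 1)"
    by (intro order_trans[OF sum_abs] sum_mono) auto
  then show ?thesis by (auto simp: covariance_def freq_count_def abs_divide divide_le_eq_1)
qed

text \<open>Where \<open>\<sigma> * covariance\<close> is close to \<open>1\<close>, almost all cosines are close to \<open>\<sigma>\<close>, and isotropy of the
  frequencies makes the Hessian of \<open>1 - \<sigma> * covariance\<close> comparable to \<open>E\<close> times the identity.\<close>

lemma covariance_strongly_convex: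
  fixes x0 v y :: "real ^ 'n::finite"
  assumes N0: "freq_count TYPE('n) E > 0" and \<sigma>: "\<sigma> = 1 \<or> \<sigma> = -1"
    and near: "\<And>t. 0 \<le> t \<Longrightarrow> t \<le> 1 \<Longrightarrow> 1 - \<sigma> * covariance E (x0 + t *\<^sub>R v) y \<le> 1 / (2 * real CARD('n))"
    and min: "1 - \<sigma> * covariance E x0 y \<le> 1 - \<sigma> * covariance E (x0 + (1/2) *\<^sub>R v) y"
  shows "pi\<^sup>2 * real E / (2 * real CARD('n)) * (norm v)\<^sup>2 \<le> 1 - \<sigma> * covariance E (x0 + v) y"
proof -
  define N where "N = real (freq_count TYPE('n) E)"
  have N: "N > 0" using N0 by (simp add: N_def)
  define d where "d = real CARD('n)"
  have d: "d > 0" by (simp add: d_def)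
  \<comment> \<open>Half the mean of \<open>(b l)\<^sup>2\<close>, which is \<open>2 * A\<close> by
    isotropy. The deficits \<open>\<kappa> l = 1 - \<sigma> * cos\<close> average at most
    \<open>1 / (2 * d)\<close>, and each \<open>(b l)\<^sup>2\<close> is at most
    \<open>2 * d * A\<close>, so they cost at most \<open>A\<close>; a second derivative of at least
    \<open>A\<close> remains.\<close>
  define A where "A = 2 * pi\<^sup>2 * real E / d * (norm v)\<^sup>2"
  define a b where "a = (\<lambda>l :: real ^ 'n. 2 * pi * (l \<bullet> (x0 - y)))" and "b = (\<lambda>l :: real ^ 'n. 2 * pi * (l \<bullet> v))"
  define g where "g = (\<lambda>t. 1 - \<sigma> * covariance E (x0 + t *\<^sub>R v) y)"
  have cov: "covariance E (x0 + t *\<^sub>R v) y = (\<Sum>l\<in>frequencies E. cos (a l + b l * t)) / N" for t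
    unfolding covariance_def N_def by (intro arg_cong2[where f = "(/)"] sum.cong refl arg_cong[where f = cos])
      (simp add: a_def b_def inner_diff_right inner_add_right algebra_simps)
  define f where "f = (\<lambda>t. g t - A / 2 * t\<^sup>2)"
  define f' where "f' = (\<lambda>t. \<sigma> * (\<Sum>l\<in>frequencies E. b l * sin (a l + b l * t)) / N - A * t)"
  define f'' where "f'' = (\<lambda>t. \<sigma> * (\<Sum>l\<in>frequencies E. (b l)\<^sup>2 * cos (a l + b l * t)) / N - A)"
  have "convex_on {0..1} f"
  proof (rule f''_ge0_imp_convex)
    fix t :: real assume t: "t \<in> {0..1}"
    have "((\<lambda>t. cos (a l + b l * t)) has_real_derivative - (b l * sin (a l + b l * t))) (at t)" for l
      by (auto intro!: derivative_eq_intros)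
    then have "((\<lambda>t. \<Sum>l\<in>frequencies E. cos (a l + b l * t)) has_real_derivative (\<Sum>l\<in>frequencies E. - (b l * sin (a l + b l * t)))) (at t)"
      by (intro DERIV_sum)
    moreover have "((\<lambda>t. t\<^sup>2) has_real_derivative 2 * t) (at t)" by (auto intro!: derivative_eq_intros)
    ultimately have "((\<lambda>t. 1 - \<sigma> * ((\<Sum>l\<in>frequencies E. cos (a l + b l * t)) / N) - A / 2 * t\<^sup>2) has_real_derivative
       0 - \<sigma> * ((\<Sum>l\<in>frequencies E. - (b l * sin (a l + b l * t))) / N) - A / 2 * (2 * t)) (at t)"
      by (intro DERIV_diff DERIV_const DERIV_cmult DERIV_cdivide)
    then show "(f has_real_derivative f' t) (at t)"
      unfolding f_def g_def cov by (rule DERIV_cong) (simp add: f'_def sum_negf)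
    have "((\<lambda>t. b l * sin (a l + b l * t)) has_real_derivative (b l)\<^sup>2 * cos (a l + b l * t)) (at t)" for l
      by (auto intro!: derivative_eq_intros simp: power2_eq_square)
    then have "((\<lambda>t. \<Sum>l\<in>frequencies E. b l * sin (a l + b l * t)) has_real_derivative (\<Sum>l\<in>frequencies E. (b l)\<^sup>2 * cos (a l + b l * t))) (at t)"
      by (intro DERIV_sum)
    then have "(f' has_real_derivative \<sigma> * (\<Sum>l\<in>frequencies E. (b l)\<^sup>2 * cos (a l + b l * t)) / N - A * 1) (at t)"
      unfolding f'_def by (intro DERIV_diff DERIV_cmult DERIV_cdivide DERIV_ident)
    then show "(f' has_real_derivative f'' t) (at t)" by (simp add: f''_def)
    define \<kappa> where "\<kappa> = (\<lambda>l. 1 - \<sigma> * cos (a l + b l * t))"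
    have \<kappa>0: "\<kappa> l \<ge> 0" for l using \<sigma> by (auto simp: \<kappa>_def)
    have "(\<Sum>l\<in>frequencies E. \<kappa> l) = N * g t"
      using N by (simp add: \<kappa>_def g_def cov sum_subtractf sum_distrib_left N_def freq_count_def field_simps)
    also have "\<dots> \<le> N * (1 / (2 * d))" using near[of t] t N by (intro mult_left_mono) (auto simp: g_def d_def)
    finally have \<kappa>s: "(\<Sum>l\<in>frequencies E. \<kappa> l) \<le> N / (2 * d)" by simp
    have bsq: "(b l)\<^sup>2 \<le> 4 * pi\<^sup>2 * (real E * (norm v)\<^sup>2)" if "l \<in> frequencies E" for l
    proof -
      have "\<bar>l \<bullet> v\<bar>\<^sup>2 \<le> (sqrt (real E) * norm v)\<^sup>2" by (intro power_mono abs_inner_frequency_le that) auto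
      then show ?thesis by (simp add: b_def power_mult_distrib)
    qed
    have "(\<Sum>l\<in>frequencies E. (b l)\<^sup>2 * \<kappa> l) \<le> (\<Sum>l\<in>frequencies E. 4 * pi\<^sup>2 * (real E * (norm v)\<^sup>2) * \<kappa> l)"
      using bsq \<kappa>0 by (intro sum_mono mult_right_mono) auto
    also have "\<dots> = 4 * pi\<^sup>2 * (real E * (norm v)\<^sup>2) * (\<Sum>l\<in>frequencies E. \<kappa> l)" by (simp add: sum_distrib_left)
    also have "\<dots> \<le> 4 * pi\<^sup>2 * (real E * (norm v)\<^sup>2) * (N / (2 * d))" using \<kappa>s by (intro mult_left_mono) auto
    also have "\<dots> = N * A" by (simp add: A_def)
    finally have 1: "(\<Sum>l\<in>frequencies E. (b l)\<^sup>2 * \<kappa> l) \<le> N * A" .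
    have "(\<Sum>l\<in>frequencies E. (b l)\<^sup>2) = 4 * pi\<^sup>2 * (\<Sum>l\<in>frequencies E. (l \<bullet> v)\<^sup>2)"
      by (simp add: b_def power_mult_distrib sum_distrib_left)
    also have "\<dots> = 2 * (N * A)"
      unfolding sum_frequencies_inner_square by (simp add: A_def N_def d_def power2_norm_eq_inner)
    finally have 2: "(\<Sum>l\<in>frequencies E. (b l)\<^sup>2) = 2 * (N * A)" .
    have "\<sigma> * (\<Sum>l\<in>frequencies E. (b l)\<^sup>2 * cos (a l + b l * t)) = (\<Sum>l\<in>frequencies E. (b l)\<^sup>2) - (\<Sum>l\<in>frequencies E. (b l)\<^sup>2 * \<kappa> l)"
      by (simp add: \<kappa>_def algebra_simps sum_subtractf sum_distrib_left)
    then have "N * A \<le> \<sigma> * (\<Sum>l\<in>frequencies E. (b l)\<^sup>2 * cos (a l + b l * t))" using 1 2 by linarith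
    then show "f'' t \<ge> 0" using N by (simp add: f''_def pos_le_divide_eq mult.commute)
  qed simp
  \<comment> \<open>Comparing with the midpoint replaces a vanishing gradient at \<open>x0\<close>,
    so the minimum may lie on the boundary of a cube.\<close>
  from convex_onD[OF this, of "1/2" 0 1] have "f (1/2) \<le> (f 0 + f 1) / 2" by simp
  moreover have "g 0 \<le> g (1/2)" using min by (simp add: g_def)
  ultimately have "g 0 + A / 4 \<le> g 1" by (simp add: f_def power2_eq_square)
  moreover have "g 0 \<ge> 0"
  proof -
    have "\<bar>\<sigma> * covariance E (x0 + 0 *\<^sub>R v) y\<bar> \<le> 1" using \<sigma> abs_covariance_le[of E x0 y] by auto
    then show ?thesis by (simp add: g_def)
  qed
  moreover have "A / 4 = pi\<^sup>2 * real E / (2 * real CARD('n)) * (norm v)\<^sup>2" by (simp add: A_def d_def)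
  ultimately have "pi\<^sup>2 * real E / (2 * real CARD('n)) * (norm v)\<^sup>2 \<le> g 1" by linarith
  then show ?thesis by (simp add: g_def)
qed

section \<open>Singular integrals over small cubes\<close>

lemma nn_integral_inverse_powr_0:
  fixes q h :: real
  assumes "0 \<le> q" "q < 1" "h > 0"
  shows "(\<integral>\<^sup>+t. ennreal (t powr (- q)) * indicator {0..h} t \<partial>lborel) = ennreal (h powr (1 - q) / (1 - q))"
proof -
  have "((\<lambda>t. t powr (- q)) has_integral (h powr (- q + 1) / (- q + 1))) {0..h}"
    by (rule has_integral_powr_from_0) (use assms in auto)
  then have "((\<lambda>t. t powr (- q) * indicator {0..h} t) has_integral (h powr (1 - q) / (1 - q))) UNIV"
    by (subst (asm) has_integral_restrict_UNIV[symmetric])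
       (simp add: indicator_def of_bool_def if_distrib cong: if_cong)
  then have "(\<integral>\<^sup>+t. ennreal (t powr (- q) * indicator {0..h} t) \<partial>lborel) = ennreal (h powr (1 - q) / (1 - q))"
    by (intro nn_integral_has_integral_lborel) auto
  then show ?thesis by (simp add: ennreal_mult'' ennreal_indicator)
qed

text \<open>The interval is split at the singular point \<open>x\<close>; each side is no longer
  than \<open>h\<close>, which accounts for the factor 2.\<close>

lemma nn_integral_inverse_abs_powr:
  fixes q h a x :: real
  assumes q: "0 \<le> q" "q < 1" and h: "h > 0" and x: "a \<le> x" "x \<le> a + h"
  shows "(\<integral>\<^sup>+t. inverse (ennreal (\<bar>t - x\<bar> powr q)) * indicator {a..a + h} t \<partial>lborel) \<le> ennreal (2 * h powr (1 - q) / (1 - q))"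
proof -
  define F where "F = (\<lambda>s. ennreal (s powr (- q)) * indicator {0..h} s)"
  have [measurable]: "F \<in> borel_measurable borel" unfolding F_def by measurable
  have F: "(\<integral>\<^sup>+s. F s \<partial>lborel) = ennreal (h powr (1 - q) / (1 - q))"
    unfolding F_def by (rule nn_integral_inverse_powr_0[OF q h])
  have "AE t in lborel. inverse (ennreal (\<bar>t - x\<bar> powr q)) * indicator {a..a + h} t \<le> F (t - x) + F (x - t)"
    using AE_lborel_singleton[of x]
  proof eventually_elim
    case (elim t)
    have "inverse (ennreal (\<bar>t - x\<bar> powr q)) = ennreal (\<bar>t - x\<bar> powr (- q))"
      using elim by (simp add: inverse_ennreal powr_minus)
    then show ?case using x by (cases "t \<ge> x") (auto simp: F_def split: split_indicator)
  qed
  then have "(\<integral>\<^sup>+t. inverse (ennreal (\<bar>t - x\<bar> powr q)) * indicator {a..a + h} t \<partial>lborel) \<le> (\<integral>\<^sup>+t. F (t - x) + F (x - t) \<partial>lborel)"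
    by (rule nn_integral_mono_AE)
  also have "\<dots> = (\<integral>\<^sup>+t. F (t - x) \<partial>lborel) + (\<integral>\<^sup>+t. F (x - t) \<partial>lborel)"
    by (rule nn_integral_add) auto
  also have "(\<integral>\<^sup>+t. F (t - x) \<partial>lborel) = (\<integral>\<^sup>+s. F s \<partial>lborel)"
    by (subst nn_integral_real_affine[of F 1 "- x"]) simp_all
  also have "(\<integral>\<^sup>+t. F (x - t) \<partial>lborel) = (\<integral>\<^sup>+s. F s \<partial>lborel)"
    by (subst nn_integral_real_affine[of F "-1" x]) simp_all
  finally show ?thesis using q by (simp add: F flip: ennreal_plus)
qed

text \<open>Cubes of side \<open>1 / K\<close>; they are half-open so that they partition the unit
  cube, and written without division so that membership is a statement about floors.\<close>

definition grid_cube :: "nat \<Rightarrow> ('n::finite \<Rightarrow> int) \<Rightarrow> (real ^ 'n) set" where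
  "grid_cube K m = {x. \<forall>i. real_of_int (m i) \<le> real K * x $ i \<and> real K * x $ i < real_of_int (m i) + 1}"

definition grid_index :: "nat \<Rightarrow> ('n::finite \<Rightarrow> int) set" where
  "grid_index K = {m. \<forall>i. m i \<in> {0..<int K}}"

lemma finite_grid_index: "finite (grid_index K :: ('n::finite \<Rightarrow> int) set)"
proof -
  have "grid_index K = (\<Pi>\<^sub>E i\<in>(UNIV :: 'n set). {0..<int K})"
    by (auto simp: grid_index_def PiE_UNIV_domain)
  then show ?thesis by (simp add: finite_PiE)
qed

lemma mem_grid_cube_iff: "x \<in> grid_cube K m \<longleftrightarrow> m = (\<lambda>i. \<lfloor>real K * x $ i\<rfloor>)"
proof
  assume "x \<in> grid_cube K m"
  then have "\<lfloor>real K * x $ i\<rfloor> = m i" for i by (auto simp: grid_cube_def intro!: floor_unique)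
  then show "m = (\<lambda>i. \<lfloor>real K * x $ i\<rfloor>)" by auto
qed (auto simp: grid_cube_def intro: floor_correct[THEN conjunct2])

lemma floor_mem_grid_index_iff:
  assumes "K > 0"
  shows "(\<lambda>i. \<lfloor>real K * x $ i\<rfloor>) \<in> grid_index K \<longleftrightarrow> x \<in> unit_cube"
proof -
  have "\<lfloor>real K * t\<rfloor> \<in> {0..<int K} \<longleftrightarrow> 0 \<le> t \<and> t < 1" for t
    using assms by (auto simp: zero_le_floor floor_less_iff zero_le_mult_iff)
  then show ?thesis by (auto simp: grid_index_def unit_cube_def)
qed

lemma indicator_unit_cube_grid:
  assumes "K > 0"
  shows "indicator unit_cube x = (\<Sum>m\<in>grid_index K. indicator (grid_cube K m) x :: ennreal)"
proof -
  have "(\<Sum>m\<in>grid_index K. indicator (grid_cube K m) x :: ennreal)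
      = (\<Sum>m\<in>grid_index K. if m = (\<lambda>i. \<lfloor>real K * x $ i\<rfloor>) then 1 else 0)"
    by (intro sum.cong refl) (simp add: indicator_def mem_grid_cube_iff)
  also have "\<dots> = indicator unit_cube x"
    unfolding sum.delta[OF finite_grid_index] floor_mem_grid_index_iff[OF assms] by (simp add: indicator_def)
  finally show ?thesis by simp
qed

lemma grid_cube_measurable [measurable]: "grid_cube K m \<in> sets borel"
  unfolding grid_cube_def by measurable

lemma nn_integral_torus_grid:
  fixes F :: "real ^ 'n::finite \<Rightarrow> ennreal"
  assumes "K > 0" and [measurable]: "F \<in> borel_measurable borel"
  shows "(\<integral>\<^sup>+x. F x \<partial>torus) = (\<Sum>m\<in>grid_index K. \<integral>\<^sup>+x. F x * indicator (grid_cube K m) x \<partial>lborel)"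
  unfolding nn_integral_torus indicator_unit_cube_grid[OF assms(1)] sum_distrib_left
  by (rule nn_integral_sum) simp

lemma indicator_grid_cube_le:
  assumes "K > 0"
  shows "indicator (grid_cube K m) x \<le> (\<Prod>i\<in>UNIV. indicator {real_of_int (m i) / real K..real_of_int (m i) / real K + 1 / real K} (x $ i) :: ennreal)"
proof (cases "x \<in> grid_cube K m")
  case True
  then have "x $ i \<in> {real_of_int (m i) / real K..real_of_int (m i) / real K + 1 / real K}" for i
    using assms by (auto simp: grid_cube_def field_simps less_imp_le)
  then show ?thesis using True by simp
qed simp

lemma emeasure_grid_cube:
  fixes m :: "'n::finite \<Rightarrow> int"
  assumes "K > 0"
  shows "emeasure lborel (grid_cube K m) = ennreal ((1 / real K) ^ CARD('n))"
proof -
  have ind: "indicator (grid_cube K m) x = (\<Prod>i\<in>UNIV. indicator {real_of_int (m i) / real K..<(real_of_int (m i) + 1) / real K} (x $ i) :: ennreal)" for x :: "real ^ 'n"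
  proof (cases "x \<in> grid_cube K m")
    case True
    then have "x $ i \<in> {real_of_int (m i) / real K..<(real_of_int (m i) + 1) / real K}" for i
      using assms by (auto simp: grid_cube_def field_simps)
    then show ?thesis using True by simp
  next
    case False
    then obtain i where "x $ i \<notin> {real_of_int (m i) / real K..<(real_of_int (m i) + 1) / real K}"
      using assms by (auto simp: grid_cube_def field_simps)
    then have "(indicator {real_of_int (m i) / real K..<(real_of_int (m i) + 1) / real K} (x $ i) :: ennreal) = 0" by (rule indicator_simps(2))
    then have "(\<Prod>i\<in>UNIV. indicator {real_of_int (m i) / real K..<(real_of_int (m i) + 1) / real K} (x $ i) :: ennreal) = 0"
      by (intro prod_zero) auto
    then show ?thesis using False by simp
  qed
  have "emeasure lborel (grid_cube K m) = (\<integral>\<^sup>+x. indicator (grid_cube K m) x \<partial>lborel)" by simp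
  also have "\<dots> = (\<Prod>i\<in>(UNIV :: 'n set). \<integral>\<^sup>+t. indicator {real_of_int (m i) / real K..<(real_of_int (m i) + 1) / real K} t \<partial>lborel)"
    unfolding ind by (rule nn_integral_prod_vec) simp
  also have "\<dots> = (\<Prod>i\<in>(UNIV :: 'n set). ennreal (1 / real K))"
    using assms by (intro prod.cong) (auto simp: divide_right_mono add_divide_distrib)
  also have "\<dots> = ennreal ((1 / real K) ^ CARD('n))" by (simp add: ennreal_power)
  finally show ?thesis .
qed

lemma inverse_ennreal_prod:
  assumes "finite I" "\<And>i. i \<in> I \<Longrightarrow> f i \<ge> 0"
  shows "inverse (ennreal (\<Prod>i\<in>I. f i)) = (\<Prod>i\<in>I. inverse (ennreal (f i)))"
  using assms
proof (induction I rule: finite_induct)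
  case (insert i I)
  have "ennreal (\<Prod>i\<in>insert i I. f i) = ennreal (f i) * ennreal (\<Prod>i\<in>I. f i)"
    using insert by (simp add: ennreal_mult prod_nonneg)
  then show ?case using insert by (simp add: ennreal_inverse_mult del: prod.insert) simp
qed simp

lemma inverse_ennreal_antimono: "a \<le> b \<Longrightarrow> inverse b \<le> (inverse a :: ennreal)"
proof (cases "a = 0 \<or> b = \<top>")
  case False
  assume "a \<le> b"
  then obtain x y where "a = ennreal x" "b = ennreal y" "x > 0" "y > 0"
    using False by (cases a; cases b) (auto simp: less_le top_unique)
  then show ?thesis using \<open>a \<le> b\<close> by (simp add: inverse_ennreal ennreal_le_iff le_imp_inverse_le)
qed auto

text \<open>Dominates the radial singularity \<open>norm x powr (- 2 * p)\<close> by the product of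
  \<open>\<bar>x $ i\<bar> powr (- 2 * p / d)\<close>. The integral over a cube then factors into
  one-dimensional ones, which converge when \<open>2 * p < d\<close>.\<close>

lemma prod_component_le_norm_power:
  "(\<Prod>i\<in>UNIV. \<bar>x $ i\<bar>) \<le> norm (x :: real ^ 'n::finite) ^ CARD('n)"
proof -
  have "(\<Prod>i\<in>UNIV. \<bar>x $ i\<bar>) \<le> (\<Prod>i\<in>(UNIV :: 'n set). norm x)"
    by (intro prod_mono) (auto simp: component_le_norm_cart)
  then show ?thesis by simp
qed

lemma grid_cube_convex_point:
  assumes "K > 0" and Q: "Q = {x :: real ^ 'n::finite. \<forall>i. real_of_int (m i) \<le> real K * x $ i \<and> real K * x $ i \<le> real_of_int (m i) + 1}"
    and "x \<in> Q" "x' \<in> Q" "0 \<le> t" "t \<le> 1"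
  shows "x + t *\<^sub>R (x' - x) \<in> Q" "norm (x - x') \<le> real CARD('n) / real K"
proof -
  have "real_of_int (m i) \<le> real K * (x + t *\<^sub>R (x' - x)) $ i \<and> real K * (x + t *\<^sub>R (x' - x)) $ i \<le> real_of_int (m i) + 1" for i
  proof -
    have eq: "real K * (x + t *\<^sub>R (x' - x)) $ i = (1 - t) * (real K * x $ i) + t * (real K * x' $ i)"
      by (simp add: algebra_simps)
    have "(1 - t) * real_of_int (m i) + t * real_of_int (m i) \<le> (1 - t) * (real K * x $ i) + t * (real K * x' $ i)"
      using assms by (intro add_mono mult_left_mono) auto
    moreover have "(1 - t) * (real K * x $ i) + t * (real K * x' $ i) \<le> (1 - t) * (real_of_int (m i) + 1) + t * (real_of_int (m i) + 1)"
      using assms by (intro add_mono mult_left_mono) auto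
    ultimately show ?thesis unfolding eq by (simp add: algebra_simps)
  qed
  then show "x + t *\<^sub>R (x' - x) \<in> Q" using Q by blast
  have "\<bar>(x - x') $ i\<bar> \<le> 1 / real K" for i
  proof -
    have "real_of_int (m i) \<le> real K * x $ i" "real K * x $ i \<le> real_of_int (m i) + 1"
      "real_of_int (m i) \<le> real K * x' $ i" "real K * x' $ i \<le> real_of_int (m i) + 1"
      using assms by auto
    then have "\<bar>real K * x $ i - real K * x' $ i\<bar> \<le> 1" by linarith
    then have "real K * \<bar>(x - x') $ i\<bar> \<le> 1" by (simp add: abs_mult flip: right_diff_distrib)
    then show ?thesis using assms(1) by (simp add: pos_le_divide_eq mult.commute)
  qed
  then have "(\<Sum>i\<in>UNIV. \<bar>(x - x') $ i\<bar>) \<le> (\<Sum>i\<in>(UNIV :: 'n set). 1 / real K)" by (intro sum_mono) auto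
  then show "norm (x - x') \<le> real CARD('n) / real K" using norm_le_l1_cart[of "x - x'"] by simp
qed

text \<open>The weight is written with the \<open>ennreal\<close> inverse, which is \<open>\<infinity>\<close> at the singular points, not \<open>0\<close> as in \<open>real\<close>.\<close>

lemma bad_cube:
  fixes m :: "'n::finite \<Rightarrow> int" and y :: "real ^ 'n"
  defines "d \<equiv> real CARD('n)"
  assumes N0: "freq_count TYPE('n) E > 0" and E0: "E > 0" and K0: "K > 0"
    and fine: "2 * pi * sqrt (real E) * (d / real K) \<le> 1 / (4 * d)"
    and p: "0 < p" "2 * p < d"
    and xq: "xq \<in> grid_cube K m" and sing: "\<bar>covariance E xq y\<bar> > 1 - 1 / (4 * d)"
  shows "\<And>x. x \<in> grid_cube K m \<Longrightarrow> 1/2 \<le> \<bar>covariance E x y\<bar>"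
    and "(\<integral>\<^sup>+x. inverse (ennreal ((1 - (covariance E x y)\<^sup>2) powr p)) * indicator (grid_cube K m) x \<partial>lborel)
      \<le> ennreal ((2 * d * (real K)\<^sup>2 / (pi\<^sup>2 * real E)) powr p * (2 / (1 - 2 * p / d)) ^ CARD('n)) * emeasure lborel (grid_cube K m)"
proof -
  have d1: "d \<ge> 1" by (simp add: d_def Suc_leI)
  define q where "q = 2 * p / d"
  have q: "0 \<le> q" "q < 1" using p d1 by (auto simp: q_def)
  define \<sigma> :: real where "\<sigma> = (if covariance E xq y \<ge> 0 then 1 else -1)"
  have \<sigma>: "\<sigma> = 1 \<or> \<sigma> = -1" by (simp add: \<sigma>_def)
  define g where "g = (\<lambda>x. 1 - \<sigma> * covariance E x y)"
  have gq: "g xq < 1 / (4 * d)" using sing by (auto simp: g_def \<sigma>_def)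
  \<comment> \<open>The closed cube: by compactness \<open>1 - \<sigma> * covariance\<close> attains
    its minimum there, at the point \<open>x0\<close> that serves as centre of the quadratic lower
    bound.\<close>
  define Q where "Q = {x :: real ^ 'n. \<forall>i. real_of_int (m i) \<le> real K * x $ i \<and> real K * x $ i \<le> real_of_int (m i) + 1}"
  have sub: "grid_cube K m \<subseteq> Q" by (auto simp: grid_cube_def Q_def less_imp_le)
  have near: "g x \<le> 1 / (2 * d)" if "x \<in> Q" for x
  proof -
    have "\<bar>covariance E x y - covariance E xq y\<bar> \<le> 2 * pi * sqrt (real E) * norm (x - xq)"
      by (rule covariance_lipschitz[OF N0])
    also have "\<dots> \<le> 2 * pi * sqrt (real E) * (d / real K)"
      using grid_cube_convex_point(2)[OF K0 Q_def that _ _, of xq 0] xq sub unfolding d_def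
      by (intro mult_left_mono) auto
    finally have "\<bar>covariance E x y - covariance E xq y\<bar> \<le> 1 / (4 * d)" using fine by linarith
    then have "g x \<le> g xq + 1 / (4 * d)" using \<sigma> by (auto simp: g_def)
    moreover have "1 / (4 * d) + 1 / (4 * d) = 1 / (2 * d)" by simp
    ultimately show ?thesis using gq by linarith
  qed
  have half: "1 / (2 * d) \<le> 1/2" using d1 by (simp add: field_simps)
  have pos: "\<sigma> * covariance E x y \<ge> 1/2" if "x \<in> Q" for x using near[OF that] half by (simp add: g_def)
  show "1/2 \<le> \<bar>covariance E x y\<bar>" if "x \<in> grid_cube K m" for x
    using pos[of x] sub that \<sigma> by auto
  have Qbox: "Q = cbox (\<chi> i. real_of_int (m i) / real K) (\<chi> i. (real_of_int (m i) + 1) / real K)"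
    using K0 by (auto simp: Q_def mem_box_cart field_simps)
  have "continuous_on Q g" unfolding g_def covariance_def by (intro continuous_intros) (use N0 in simp)
  moreover have "compact Q" unfolding Qbox by (rule compact_cbox)
  moreover have "Q \<noteq> {}" using xq sub by auto
  ultimately obtain x0 where x0: "x0 \<in> Q" "\<And>x. x \<in> Q \<Longrightarrow> g x0 \<le> g x"
    using continuous_attains_inf[of Q g] by blast
  define \<kappa> where "\<kappa> = pi\<^sup>2 * real E / (2 * d)"
  have \<kappa>: "\<kappa> > 0" using E0 d1 by (simp add: \<kappa>_def)
  have lower: "\<kappa> powr p * (\<Prod>i\<in>UNIV. \<bar>x $ i - x0 $ i\<bar> powr q) \<le> (1 - (covariance E x y)\<^sup>2) powr p" if x: "x \<in> Q" for x
  proof -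
    have "\<kappa> * (norm (x - x0))\<^sup>2 \<le> 1 - \<sigma> * covariance E (x0 + (x - x0)) y"
      unfolding \<kappa>_def d_def
    proof (rule covariance_strongly_convex[OF N0 \<sigma>])
      fix t :: real assume "0 \<le> t" "t \<le> 1"
      then have "x0 + t *\<^sub>R (x - x0) \<in> Q" by (rule grid_cube_convex_point(1)[OF K0 Q_def x0(1) x])
      from near[OF this] show "1 - \<sigma> * covariance E (x0 + t *\<^sub>R (x - x0)) y \<le> 1 / (2 * real CARD('n))"
        by (simp add: g_def d_def)
    next
      have "x0 + (1/2) *\<^sub>R (x - x0) \<in> Q" by (rule grid_cube_convex_point(1)[OF K0 Q_def x0(1) x]) auto
      from x0(2)[OF this] show "1 - \<sigma> * covariance E x0 y \<le> 1 - \<sigma> * covariance E (x0 + (1/2) *\<^sub>R (x - x0)) y"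
        by (simp add: g_def)
    qed
    then have "\<kappa> * (norm (x - x0))\<^sup>2 \<le> g x" by (simp add: g_def)
    also have "g x = g x * 1" by simp
    \<comment> \<open>With \<open>g = 1 - \<sigma> * u\<close> one has
      \<open>1 - u\<^sup>2 = g * (1 + \<sigma> * u)\<close>, and the second factor is at least 1 on
      the cube.\<close>
    also have "\<dots> \<le> g x * (1 + \<sigma> * covariance E x y)"
    proof (rule mult_left_mono)
      have "\<bar>\<sigma> * covariance E x y\<bar> \<le> 1" using \<sigma> abs_covariance_le[of E x y] by auto
      then show "0 \<le> g x" by (simp add: g_def)
    qed (use pos[OF x] in simp)
    also have "\<dots> = 1 - (covariance E x y)\<^sup>2" using \<sigma> by (auto simp: g_def power2_eq_square algebra_simps)
    finally have 1: "\<kappa> * (norm (x - x0))\<^sup>2 \<le> 1 - (covariance E x y)\<^sup>2" .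
    have "(\<Prod>i\<in>UNIV. \<bar>x $ i - x0 $ i\<bar> powr q) = (\<Prod>i\<in>UNIV. \<bar>(x - x0) $ i\<bar>) powr q"
      by (subst prod_powr_distrib[symmetric]) auto
    also have "\<dots> \<le> (norm (x - x0) ^ CARD('n)) powr q"
      using q by (intro powr_mono2 prod_component_le_norm_power prod_nonneg) auto
    also have "\<dots> = ((norm (x - x0))\<^sup>2) powr p"
    proof (cases "x = x0")
      case False
      then have n0: "norm (x - x0) > 0" by simp
      have dq: "d * q = 2 * p" using d1 by (simp add: q_def)
      have "(norm (x - x0) ^ CARD('n)) powr q = (norm (x - x0) powr d) powr q"
        by (simp only: d_def powr_realpow[OF n0])
      also have "\<dots> = (norm (x - x0) powr 2) powr p" by (simp only: powr_powr dq)
      finally show ?thesis by simp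
    qed (use p in simp)
    finally have "\<kappa> powr p * (\<Prod>i\<in>UNIV. \<bar>x $ i - x0 $ i\<bar> powr q) \<le> \<kappa> powr p * ((norm (x - x0))\<^sup>2) powr p"
      by (intro mult_left_mono) auto
    also have "\<dots> = (\<kappa> * (norm (x - x0))\<^sup>2) powr p" using \<kappa> by (simp add: powr_mult)
    also have "\<dots> \<le> (1 - (covariance E x y)\<^sup>2) powr p" using 1 p \<kappa> by (intro powr_mono2) auto
    finally show ?thesis .
  qed
  define a where "a = (\<lambda>i. real_of_int (m i) / real K)"
  define h where "h = 1 / real K"
  have h: "h > 0" using K0 by (simp add: h_def)
  define \<phi> where "\<phi> = (\<lambda>i t. inverse (ennreal (\<bar>t - x0 $ i\<bar> powr q)) * indicator {a i..a i + h} t)"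
  have \<phi>: "(\<integral>\<^sup>+t. \<phi> i t \<partial>lborel) \<le> ennreal (2 * h powr (1 - q) / (1 - q))" for i
    unfolding \<phi>_def using x0(1) K0
    by (intro nn_integral_inverse_abs_powr[OF q h]) (auto simp: Q_def a_def h_def field_simps)
  have "inverse (ennreal ((1 - (covariance E x y)\<^sup>2) powr p)) * indicator (grid_cube K m) x
      \<le> inverse (ennreal (\<kappa> powr p)) * (\<Prod>i\<in>UNIV. \<phi> i (x $ i))" for x
  proof (cases "x \<in> grid_cube K m")
    case True
    have "inverse (ennreal ((1 - (covariance E x y)\<^sup>2) powr p))
        \<le> inverse (ennreal (\<kappa> powr p * (\<Prod>i\<in>UNIV. \<bar>x $ i - x0 $ i\<bar> powr q)))"
      using lower[of x] True sub by (intro inverse_ennreal_antimono ennreal_leI) auto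
    also have "\<dots> = inverse (ennreal (\<kappa> powr p)) * (\<Prod>i\<in>UNIV. inverse (ennreal (\<bar>x $ i - x0 $ i\<bar> powr q)))"
      by (subst ennreal_mult) (auto simp: prod_nonneg ennreal_inverse_mult inverse_ennreal_prod)
    finally have "inverse (ennreal ((1 - (covariance E x y)\<^sup>2) powr p)) * indicator (grid_cube K m) x
      \<le> (inverse (ennreal (\<kappa> powr p)) * (\<Prod>i\<in>UNIV. inverse (ennreal (\<bar>x $ i - x0 $ i\<bar> powr q))))
        * (\<Prod>i\<in>UNIV. indicator {a i..a i + h} (x $ i))"
      using indicator_grid_cube_le[OF K0, of m x] unfolding a_def h_def by (intro mult_mono) auto
    then show ?thesis by (simp add: \<phi>_def prod.distrib mult.assoc)
  qed simp
  then have "(\<integral>\<^sup>+x. inverse (ennreal ((1 - (covariance E x y)\<^sup>2) powr p)) * indicator (grid_cube K m) x \<partial>lborel)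
    \<le> (\<integral>\<^sup>+x. inverse (ennreal (\<kappa> powr p)) * (\<Prod>i\<in>UNIV. \<phi> i (x $ i)) \<partial>lborel)"
    by (intro nn_integral_mono)
  also have "\<dots> = inverse (ennreal (\<kappa> powr p)) * (\<Prod>i\<in>UNIV. \<integral>\<^sup>+t. \<phi> i t \<partial>lborel)"
  proof -
    have m: "\<phi> i \<in> borel_measurable borel" for i unfolding \<phi>_def by measurable
    have m2: "(\<lambda>x :: real ^ 'n. \<phi> i (x $ i)) \<in> borel_measurable lborel" for i
      by (rule measurable_compose[OF _ m]) simp
    have "(\<lambda>x. \<Prod>i\<in>UNIV. \<phi> i (x $ i)) \<in> borel_measurable (lborel :: (real ^ 'n) measure)"
      by (rule borel_measurable_prod_ennreal) (rule m2)
    then show ?thesis by (simp only: nn_integral_cmult nn_integral_prod_vec[OF m])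
  qed
  also have "\<dots> \<le> inverse (ennreal (\<kappa> powr p)) * (\<Prod>i\<in>(UNIV :: 'n set). ennreal (2 * h powr (1 - q) / (1 - q)))"
    using \<phi> by (intro mult_left_mono prod_mono_ennreal) auto
  also have "\<dots> = ennreal (\<kappa> powr (- p) * (2 * h powr (1 - q) / (1 - q)) ^ CARD('n))"
    using \<kappa> q h by (simp add: inverse_ennreal powr_minus ennreal_power ennreal_mult)
  \<comment> \<open>The \<open>d\<close> factors \<open>h powr (1 - q)\<close> give the volume of
    the cube times \<open>K powr (2 * p)\<close>. Together with \<open>\<kappa> powr (- p)\<close>
    the latter forms a power of \<open>K\<^sup>2 / E\<close>, bounded once \<open>K\<close> is
    comparable to \<open>sqrt E\<close>.\<close>
  also have "\<kappa> powr (- p) * (2 * h powr (1 - q) / (1 - q)) ^ CARD('n)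
      = ((2 * d * (real K)\<^sup>2 / (pi\<^sup>2 * real E)) powr p * (2 / (1 - 2 * p / d)) ^ CARD('n)) * (1 / real K) ^ CARD('n)"
  proof -
    have "(h powr (1 - q)) ^ CARD('n) = h powr ((1 - q) * d)" using h by (simp add: d_def powr_powr flip: powr_realpow)
    also have "(1 - q) * d = d + - (2 * p)" using d1 by (simp add: q_def algebra_simps)
    also have "h powr (d + - (2 * p)) = h powr d * h powr (- (2 * p))" by (rule powr_add)
    also have "h powr (- (2 * p)) = (h powr (- 2)) powr p" by (simp add: powr_powr)
    also have "h powr d = (1 / real K) ^ CARD('n)" using h by (simp add: d_def powr_realpow h_def)
    also have "h powr (- 2) = (real K)\<^sup>2" using K0 by (simp add: h_def powr_minus powr_numeral field_simps)
    finally have 1: "(h powr (1 - q)) ^ CARD('n) = (1 / real K) ^ CARD('n) * ((real K)\<^sup>2) powr p" .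
    have "2 * d * (real K)\<^sup>2 / (pi\<^sup>2 * real E) = (real K)\<^sup>2 / \<kappa>" by (simp add: \<kappa>_def)
    moreover have "((real K)\<^sup>2 / \<kappa>) powr p = ((real K)\<^sup>2) powr p * \<kappa> powr (- p)"
      using \<kappa> by (simp add: powr_divide powr_minus_divide)
    ultimately have 2: "(2 * d * (real K)\<^sup>2 / (pi\<^sup>2 * real E)) powr p = ((real K)\<^sup>2) powr p * \<kappa> powr (- p)" by simp
    have "(2 * h powr (1 - q) / (1 - q)) ^ CARD('n) = (2 / (1 - q) * h powr (1 - q)) ^ CARD('n)" by simp
    also have "\<dots> = (2 / (1 - q)) ^ CARD('n) * (h powr (1 - q)) ^ CARD('n)" by (rule power_mult_distrib)
    finally show ?thesis unfolding 1 2 q_def[symmetric] by simp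
  qed
  also have "ennreal \<dots> = ennreal ((2 * d * (real K)\<^sup>2 / (pi\<^sup>2 * real E)) powr p * (2 / (1 - 2 * p / d)) ^ CARD('n)) * emeasure lborel (grid_cube K m)"
    using q by (subst ennreal_mult) (auto simp: emeasure_grid_cube[OF K0] q_def)
  finally show "(\<integral>\<^sup>+x. inverse (ennreal ((1 - (covariance E x y)\<^sup>2) powr p)) * indicator (grid_cube K m) x \<partial>lborel)
      \<le> ennreal ((2 * d * (real K)\<^sup>2 / (pi\<^sup>2 * real E)) powr p * (2 / (1 - 2 * p / d)) ^ CARD('n)) * emeasure lborel (grid_cube K m)" .
qed

text \<open>In terms of \<open>w = sqrt (1 - c\<^sup>2)\<close> the remainder is
  \<open>(1 - w)\<^sup>2 * (w + 2) / (2 * w)\<close>, while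
  \<open>c ^ 4 = (1 - w)\<^sup>2 * (1 + w)\<^sup>2\<close>; the common factor shows the order of
  vanishing.\<close>

lemma inverse_sqrt_expansion:
  fixes c :: real
  assumes "0 < \<eta>" "\<eta> \<le> 1" "\<eta> \<le> 1 - c\<^sup>2"
  shows "\<bar>inverse (sqrt (1 - c\<^sup>2)) - 1 - c\<^sup>2 / 2\<bar> \<le> 3 / (2 * \<eta>) * c ^ 4"
proof -
  define w where "w = sqrt (1 - c\<^sup>2)"
  have w2: "w\<^sup>2 = 1 - c\<^sup>2" using assms by (simp add: w_def)
  have "0 < w" using assms by (simp add: w_def)
  have "w\<^sup>2 \<le> 1" using w2 by simp
  then have "w \<le> 1" by (simp add: w_def)
  have "\<eta> \<le> w * w" using assms w2 by (simp add: power2_eq_square)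
  also have "\<dots> \<le> w * 1" using \<open>0 < w\<close> \<open>w \<le> 1\<close> by (intro mult_left_mono) auto
  finally have "\<eta> \<le> w" by simp
  have c2: "c\<^sup>2 = (1 - w) * (1 + w)" using w2 by (simp add: power2_eq_square algebra_simps)
  have "inverse w - 1 - c\<^sup>2 / 2 = (1 - w)\<^sup>2 * (w + 2) / (2 * w)"
    unfolding c2 using \<open>0 < w\<close> by (simp add: field_simps power2_eq_square)
  also have "\<bar>\<dots>\<bar> = (1 - w)\<^sup>2 * ((w + 2) / (2 * w))" using \<open>0 < w\<close> by simp
  also have "\<dots> \<le> (1 - w)\<^sup>2 * (3 / (2 * \<eta>) * (1 + w)\<^sup>2)"
  proof (rule mult_left_mono)
    have "(w + 2) / (2 * w) \<le> 3 / (2 * \<eta>)"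
      using \<open>0 < w\<close> \<open>w \<le> 1\<close> \<open>\<eta> \<le> w\<close> assms by (intro frac_le) auto
    also have "\<dots> \<le> 3 / (2 * \<eta>) * (1 + w)\<^sup>2"
      using \<open>0 < w\<close> assms by (intro mult_le_cancel_left1[THEN iffD2]) (auto simp: power2_eq_square algebra_simps)
    finally show "(w + 2) / (2 * w) \<le> 3 / (2 * \<eta>) * (1 + w)\<^sup>2" .
  qed simp
  also have "\<dots> = 3 / (2 * \<eta>) * (c\<^sup>2)\<^sup>2" unfolding c2 by (simp add: power_mult_distrib)
  finally show ?thesis by (simp add: w_def)
qed

text \<open>The point is that \<open>C\<close> depends on the dimension alone. Cubes where
  \<open>\<bar>u\<bar>\<close> somewhere exceeds \<open>1 - 1 / (4 * d)\<close> are called bad and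
  fall under \<open>bad_cube\<close>; on the others \<open>1 - u\<^sup>2\<close> is bounded below
  and the expansion applies pointwise.\<close>

theorem covariance_integrals:
  assumes d2: "CARD('n::finite) \<ge> 2"
  shows "\<exists>C>0. \<forall>E (y :: real ^ 'n). E > 0 \<longrightarrow> freq_count TYPE('n) E > 0 \<longrightarrow>
    (\<integral>\<^sup>+x. inverse (ennreal ((1 - (covariance E x y)\<^sup>2) powr (3/4))) \<partial>torus) \<le> ennreal C \<and>
    integrable torus (\<lambda>x. inverse (sqrt (1 - (covariance E x y)\<^sup>2))) \<and>
    \<bar>(\<integral>x. inverse (sqrt (1 - (covariance E x y)\<^sup>2)) \<partial>torus) - 1 - 1 / (2 * real (freq_count TYPE('n) E))\<bar>
      \<le> C * (\<integral>x. (covariance E x y) ^ 4 \<partial>torus)"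
proof -
  define d where "d = real CARD('n)"
  have d: "d \<ge> 2" using d2 by (simp add: d_def)
  define \<eta> where "\<eta> = 1 / (4 * d)"
  have \<eta>: "0 < \<eta>" "\<eta> \<le> 1/8" using d by (auto simp: \<eta>_def field_simps)
  define A where "A = (\<lambda>p. (162 * d ^ 5) powr p * (2 / (1 - 2 * p / d)) ^ CARD('n))"
  have A0: "A p \<ge> 0" if "2 * p < d" for p using that d by (simp add: A_def)
  define C1 where "C1 = max (A (3/4)) (inverse (\<eta> powr (3/4)))"
  define C2 where "C2 = max (16 * (A (1/2) + 3/2)) (3 / (2 * \<eta>))"
  define C where "C = max C1 C2"
  have C1: "0 < C1" using \<eta> by (simp add: C1_def less_max_iff_disj)
  show ?thesis
  proof (intro exI[of _ C] conjI allI impI)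
    show "C > 0" using C1 by (simp add: C_def less_max_iff_disj)
    fix E and y :: "real ^ 'n" assume E0: "E > 0" and N0: "freq_count TYPE('n) E > 0"
    define c where "c = (\<lambda>x. covariance E x y)"
    have [measurable]: "c \<in> borel_measurable borel" unfolding c_def by simp
    \<comment> \<open>Fine enough that the Lipschitz bound makes the covariance vary by at most
      \<open>1 / (4 * d)\<close> over a cube, yet at most
      \<open>9 * pi * d\<^sup>2 * sqrt E\<close>, which yields the constant
      \<open>162 * d ^ 5 = 2 * d * 81 * d ^ 4\<close> independent of \<open>E\<close>.\<close>
    define K where "K = nat \<lceil>8 * pi * d\<^sup>2 * sqrt (real E)\<rceil>"
    define B where "B = 8 * pi * d\<^sup>2 * sqrt (real E)"
    have sE: "sqrt (real E) \<ge> 1" using E0 by simp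
    have "pi * d\<^sup>2 * sqrt (real E) \<ge> 1 * 1 * 1"
      using pi_gt3 d sE by (intro mult_mono) auto
    then have B1: "B \<ge> 8" "B + 1 \<le> 9 * pi * d\<^sup>2 * sqrt (real E)" by (simp_all add: B_def mult_ac)
    have K: "B \<le> real K" "real K \<le> B + 1" using B1(1) unfolding K_def B_def[symmetric] by linarith+
    have K0: "K > 0" using K B1 by simp
    have fine: "2 * pi * sqrt (real E) * (d / real K) \<le> 1 / (4 * d)"
    proof -
      have "2 * pi * sqrt (real E) * d * (4 * d) = B" by (simp add: B_def power2_eq_square)
      also have "\<dots> \<le> real K" by (rule K)
      finally show ?thesis using K0 d by (simp add: field_simps)
    qed
    have K2: "2 * d * (real K)\<^sup>2 / (pi\<^sup>2 * real E) \<le> 162 * d ^ 5"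
    proof -
      have "(real K)\<^sup>2 \<le> (9 * pi * d\<^sup>2 * sqrt (real E))\<^sup>2" using K B1 by (intro power_mono) auto
      also have "\<dots> = 81 * d ^ 4 * (pi\<^sup>2 * real E)" by (simp add: power_mult_distrib flip: power_mult)
      finally have "2 * d * (real K)\<^sup>2 \<le> 2 * d * (81 * d ^ 4 * (pi\<^sup>2 * real E))" using d by (intro mult_left_mono) auto
      also have "\<dots> = 162 * d ^ 5 * (pi\<^sup>2 * real E)" by (simp add: eval_nat_numeral)
      finally show ?thesis using E0 by (simp add: pos_divide_le_eq)
    qed
    define W where "W = (\<lambda>p x. inverse (ennreal ((1 - (c x)\<^sup>2) powr p)))"
    have Wm [measurable]: "W p \<in> borel_measurable borel" for p unfolding W_def by measurable
    define bad where "bad = (\<lambda>m. \<exists>x\<in>grid_cube K m. \<bar>c x\<bar> > 1 - 1 / (4 * d))"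
    have badW: "(\<integral>\<^sup>+x. W p x * indicator (grid_cube K m) x \<partial>lborel) \<le> ennreal (A p) * emeasure lborel (grid_cube K m)"
      if b: "bad m" and p: "0 < p" "2 * p < d" for m p
    proof -
      obtain xq where xq: "xq \<in> grid_cube K m" "\<bar>c xq\<bar> > 1 - 1 / (4 * d)" using b by (auto simp: bad_def)
      have "(\<integral>\<^sup>+x. W p x * indicator (grid_cube K m) x \<partial>lborel) \<le>
        ennreal ((2 * d * (real K)\<^sup>2 / (pi\<^sup>2 * real E)) powr p * (2 / (1 - 2 * p / d)) ^ CARD('n)) * emeasure lborel (grid_cube K m)"
        unfolding W_def c_def d_def
        by (rule bad_cube(2)[OF N0 E0 K0 fine[unfolded d_def] p[unfolded d_def] xq[unfolded c_def d_def]])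
      also have "\<dots> \<le> ennreal (A p) * emeasure lborel (grid_cube K m)"
        unfolding A_def using K2 p d by (intro mult_right_mono ennreal_leI powr_mono2) auto
      finally show ?thesis .
    qed
    have badc: "1/2 \<le> \<bar>c x\<bar>" if b: "bad m" "x \<in> grid_cube K m" for m x
    proof -
      obtain xq where xq: "xq \<in> grid_cube K m" "\<bar>c xq\<bar> > 1 - 1 / (4 * d)" using b by (auto simp: bad_def)
      show ?thesis unfolding c_def
        by (rule bad_cube(1)[OF N0 E0 K0 fine[unfolded d_def] _ _ xq[unfolded c_def d_def] b(2), of "1/2"]) (use d2 in auto)
    qed
    have good: "\<eta> \<le> 1 - (c x)\<^sup>2" if "\<not> bad m" "x \<in> grid_cube K m" for m x
    proof -
      have "\<bar>c x\<bar> \<le> 1 - \<eta>" using that by (auto simp: bad_def \<eta>_def not_less)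
      then have "\<bar>c x\<bar>\<^sup>2 \<le> (1 - \<eta>)\<^sup>2" using \<eta> by (intro power_mono) auto
      also have "(1 - \<eta>)\<^sup>2 \<le> 1 - \<eta>" using \<eta> by (simp add: power2_eq_square algebra_simps mult_left_le)
      finally show ?thesis by simp
    qed
    show "(\<integral>\<^sup>+x. inverse (ennreal ((1 - (covariance E x y)\<^sup>2) powr (3/4))) \<partial>torus) \<le> ennreal C"
    proof -
      have "(\<integral>\<^sup>+x. W (3/4) x \<partial>torus) = (\<Sum>m\<in>grid_index K. \<integral>\<^sup>+x. W (3/4) x * indicator (grid_cube K m) x \<partial>lborel)"
        by (rule nn_integral_torus_grid[OF K0 Wm])
      also have "\<dots> \<le> (\<Sum>m\<in>grid_index K. ennreal C1 * emeasure lborel (grid_cube K m :: (real ^ 'n) set))"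
      proof (rule sum_mono)
        fix m :: "'n \<Rightarrow> int"
        show "(\<integral>\<^sup>+x. W (3/4) x * indicator (grid_cube K m) x \<partial>lborel) \<le> ennreal C1 * emeasure lborel (grid_cube K m)"
        proof (cases "bad m")
          case True
          have "(\<integral>\<^sup>+x. W (3/4) x * indicator (grid_cube K m) x \<partial>lborel) \<le> ennreal (A (3/4)) * emeasure lborel (grid_cube K m)"
            using d by (intro badW True) auto
          also have "\<dots> \<le> ennreal C1 * emeasure lborel (grid_cube K m)"
            by (intro mult_right_mono ennreal_leI) (auto simp: C1_def)
          finally show ?thesis .
        next
          case False
          have "W (3/4) x * indicator (grid_cube K m) x \<le> ennreal C1 * indicator (grid_cube K m) x" for x
          proof (cases "x \<in> grid_cube K m")
            case True
            have "inverse (ennreal ((1 - (c x)\<^sup>2) powr (3/4))) \<le> inverse (ennreal (\<eta> powr (3/4)))"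
              using good[OF False True] \<eta> by (intro inverse_ennreal_antimono ennreal_leI powr_mono2) auto
            also have "\<dots> = ennreal (inverse (\<eta> powr (3/4)))" using \<eta> by (simp add: inverse_ennreal)
            also have "\<dots> \<le> ennreal C1" by (intro ennreal_leI) (simp add: C1_def)
            finally show ?thesis using True by (simp add: W_def)
          qed simp
          then have "(\<integral>\<^sup>+x. W (3/4) x * indicator (grid_cube K m) x \<partial>lborel) \<le> (\<integral>\<^sup>+x. ennreal C1 * indicator (grid_cube K m) x \<partial>lborel)"
            by (intro nn_integral_mono)
          then show ?thesis by (simp add: nn_integral_cmult)
        qed
      qed
      also have "\<dots> = (\<integral>\<^sup>+x. ennreal C1 \<partial>(torus :: (real ^ 'n) measure))"
        by (subst nn_integral_torus_grid[OF K0]) (auto simp: nn_integral_cmult)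
      also have "\<dots> = ennreal C1" by (simp add: torus.emeasure_space_1)
      also have "\<dots> \<le> ennreal C" by (intro ennreal_leI) (simp add: C_def)
      finally show ?thesis by (simp add: W_def c_def)
    qed
    define H where "H = (\<lambda>x. inverse (sqrt (1 - (c x)\<^sup>2)) - 1 - (c x)\<^sup>2 / 2)"
    have [measurable]: "H \<in> borel_measurable borel" unfolding H_def by measurable
    have c1: "(c x)\<^sup>2 \<le> 1" for x using abs_covariance_le[of E x y] by (simp add: c_def abs_square_le_1)
    have c4int: "integrable torus (\<lambda>x. (c x) ^ 4)"
    proof (rule torus.integrable_const_bound[of _ 1])
      have "(c x) ^ 4 \<le> 1" for x using c1[of x] power_mono[of "(c x)\<^sup>2" 1 2] by simp
      then show "AE x in torus. norm ((c x) ^ 4) \<le> 1" by simp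
    qed (rule borel_measurable_torus, measurable)
    have c2int: "integrable torus (\<lambda>x. (c x)\<^sup>2)"
      by (rule torus.integrable_const_bound[of _ 1]) (use c1 in \<open>auto intro!: borel_measurable_torus\<close>)
    have HI: "(\<integral>\<^sup>+x. ennreal \<bar>H x\<bar> \<partial>torus) \<le> ennreal C2 * (\<integral>\<^sup>+x. ennreal ((c x) ^ 4) \<partial>torus)"
    proof -
      have "(\<integral>\<^sup>+x. ennreal \<bar>H x\<bar> \<partial>torus) = (\<Sum>m\<in>grid_index K. \<integral>\<^sup>+x. ennreal \<bar>H x\<bar> * indicator (grid_cube K m) x \<partial>lborel)"
        by (rule nn_integral_torus_grid[OF K0]) simp
      also have "\<dots> \<le> (\<Sum>m\<in>grid_index K. ennreal C2 * (\<integral>\<^sup>+x. ennreal ((c x) ^ 4) * indicator (grid_cube K m) x \<partial>lborel))"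
      proof (rule sum_mono)
        fix m :: "'n \<Rightarrow> int"
        let ?Q = "grid_cube K m :: (real ^ 'n) set"
        show "(\<integral>\<^sup>+x. ennreal \<bar>H x\<bar> * indicator ?Q x \<partial>lborel) \<le> ennreal C2 * (\<integral>\<^sup>+x. ennreal ((c x) ^ 4) * indicator ?Q x \<partial>lborel)"
        proof (cases "bad m")
          \<comment> \<open>On a bad cube the remainder \<open>H\<close> need not be small, but its
            integral is at most a constant times the volume, and \<open>(c x) ^ 4 \<ge> 1/16\<close>
            there, so the volume is at most 16 times the integral of the fourth power.\<close>
          case True
          have "ennreal \<bar>H x\<bar> * indicator ?Q x \<le> W (1/2) x * indicator ?Q x + ennreal (3/2) * indicator ?Q x" for x
          proof -
            define s where "s = inverse (sqrt (1 - (c x)\<^sup>2))"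
            have s0: "s \<ge> 0" using c1[of x] by (simp add: s_def)
            have "0 \<le> (c x)\<^sup>2 / 2" "(c x)\<^sup>2 / 2 \<le> 1/2" using c1[of x] by auto
            then have "\<bar>H x\<bar> \<le> s + 3/2" using s0 unfolding H_def s_def[symmetric] by linarith
            then have "ennreal \<bar>H x\<bar> \<le> ennreal s + ennreal (3/2)" using s0 ennreal_leI[of "\<bar>H x\<bar>" "s + 3/2"] by (simp only: ennreal_plus[OF s0, of "3/2"])
            also have "ennreal s \<le> W (1/2) x"
            proof (cases "1 - (c x)\<^sup>2 = 0")
              case True
              then show ?thesis by (simp add: s_def)
            next
              case False
              then have "1 - (c x)\<^sup>2 > 0" using c1[of x] by linarith
              then show ?thesis by (simp add: s_def W_def inverse_ennreal powr_half_sqrt)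
            qed
            finally show ?thesis by (auto split: split_indicator)
          qed
          then have "(\<integral>\<^sup>+x. ennreal \<bar>H x\<bar> * indicator ?Q x \<partial>lborel) \<le> (\<integral>\<^sup>+x. W (1/2) x * indicator ?Q x + ennreal (3/2) * indicator ?Q x \<partial>lborel)"
            by (intro nn_integral_mono)
          also have "\<dots> = (\<integral>\<^sup>+x. W (1/2) x * indicator ?Q x \<partial>lborel) + (\<integral>\<^sup>+x. ennreal (3/2) * indicator ?Q x \<partial>lborel)"
            by (rule nn_integral_add) auto
          also have "\<dots> \<le> ennreal (A (1/2)) * emeasure lborel ?Q + ennreal (3/2) * emeasure lborel ?Q"
            using d by (intro add_mono badW True) (auto simp: nn_integral_cmult)
          also have "\<dots> = ennreal (A (1/2) + 3/2) * emeasure lborel ?Q"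
            using A0[of "1/2"] d by (subst ennreal_plus) (auto simp: distrib_right)
          also have "\<dots> = ennreal (16 * (A (1/2) + 3/2)) * (ennreal (1/16) * emeasure lborel ?Q)"
          proof -
            have "ennreal (16 * (A (1/2) + 3/2)) * ennreal (1/16) = ennreal (A (1/2) + 3/2)"
              using A0[of "1/2"] d by (subst ennreal_mult[symmetric]) (auto intro!: arg_cong[where f = ennreal] simp del: ennreal_plus)
            then show ?thesis by (simp only: mult.assoc[symmetric])
          qed
          also have "ennreal (1/16) * emeasure lborel ?Q = (\<integral>\<^sup>+x. ennreal (1/16) * indicator ?Q x \<partial>lborel)"
            by (simp add: nn_integral_cmult)
          also have "\<dots> \<le> (\<integral>\<^sup>+x. ennreal ((c x) ^ 4) * indicator ?Q x \<partial>lborel)"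
          proof (rule nn_integral_mono)
            fix x
            show "ennreal (1/16) * indicator ?Q x \<le> ennreal ((c x) ^ 4) * indicator ?Q x"
            proof (cases "x \<in> ?Q")
              case True
              then have "(1/2) ^ 4 \<le> \<bar>c x\<bar> ^ 4" using badc[OF \<open>bad m\<close> True] by (intro power_mono) auto
              then show ?thesis using True by (simp add: power_divide ennreal_leI power_even_abs)
            qed simp
          qed
          then have "ennreal (16 * (A (1/2) + 3/2)) * (\<integral>\<^sup>+x. ennreal (1/16) * indicator ?Q x \<partial>lborel)
             \<le> ennreal C2 * (\<integral>\<^sup>+x. ennreal ((c x) ^ 4) * indicator ?Q x \<partial>lborel)"
            by (intro mult_mono ennreal_leI) (auto simp: C2_def)
          finally show ?thesis .
        next
          case False
          have "ennreal \<bar>H x\<bar> * indicator ?Q x \<le> ennreal C2 * (ennreal ((c x) ^ 4) * indicator ?Q x)" for x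
          proof (cases "x \<in> ?Q")
            case True
            have "\<bar>H x\<bar> \<le> 3 / (2 * \<eta>) * (c x) ^ 4"
              unfolding H_def using \<eta> by (intro inverse_sqrt_expansion good[OF False True]) auto
            also have "\<dots> \<le> C2 * (c x) ^ 4" by (intro mult_right_mono) (auto simp: C2_def)
            finally have "ennreal \<bar>H x\<bar> \<le> ennreal (C2 * (c x) ^ 4)" by (rule ennreal_leI)
            then show ?thesis using True by (simp add: ennreal_mult'')
          qed simp
          then have "(\<integral>\<^sup>+x. ennreal \<bar>H x\<bar> * indicator ?Q x \<partial>lborel) \<le> (\<integral>\<^sup>+x. ennreal C2 * (ennreal ((c x) ^ 4) * indicator ?Q x) \<partial>lborel)"
            by (intro nn_integral_mono)
          then show ?thesis by (simp add: nn_integral_cmult)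
        qed
      qed
      also have "\<dots> = ennreal C2 * (\<Sum>m\<in>grid_index K. \<integral>\<^sup>+x. ennreal ((c x) ^ 4) * indicator (grid_cube K m) x \<partial>lborel)"
        by (simp add: sum_distrib_left)
      also have "\<dots> = ennreal C2 * (\<integral>\<^sup>+x. ennreal ((c x) ^ 4) \<partial>torus)"
        by (subst nn_integral_torus_grid[OF K0]) auto
      finally show ?thesis .
    qed
    have c4eq: "(\<integral>\<^sup>+x. ennreal ((c x) ^ 4) \<partial>torus) = ennreal (\<integral>x. (c x) ^ 4 \<partial>torus)"
      by (rule nn_integral_eq_integral[OF c4int]) simp
    have Hint: "integrable torus H"
    proof (rule integrableI_bounded)
      show "H \<in> borel_measurable torus" by (rule borel_measurable_torus) simp
      have "(\<integral>\<^sup>+x. ennreal (norm (H x)) \<partial>torus) \<le> ennreal C2 * ennreal (\<integral>x. (c x) ^ 4 \<partial>torus)"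
        using HI unfolding c4eq by simp
      also have "\<dots> < \<infinity>" by (simp add: ennreal_mult_less_top)
      finally show "(\<integral>\<^sup>+x. ennreal (norm (H x)) \<partial>torus) < \<infinity>" .
    qed
    have eq: "inverse (sqrt (1 - (c x)\<^sup>2)) = H x + (1 + (c x)\<^sup>2 / 2)" for x by (simp add: H_def)
    have one: "integrable (torus :: (real ^ 'n) measure) (\<lambda>_. 1 :: real)" by simp
    show "integrable torus (\<lambda>x. inverse (sqrt (1 - (covariance E x y)\<^sup>2)))"
    proof -
      have "integrable torus (\<lambda>x. H x + (1 + (c x)\<^sup>2 / 2))"
        by (intro Bochner_Integration.integrable_add integrable_divide Hint c2int one)
      then show ?thesis unfolding eq[symmetric] by (simp only: c_def)
    qed
    have "(\<integral>x. inverse (sqrt (1 - (c x)\<^sup>2)) \<partial>torus) = (\<integral>x. H x \<partial>torus) + (1 + (\<integral>x. (c x)\<^sup>2 \<partial>torus) / 2)"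
      unfolding eq using Hint c2int one by (simp add: torus.prob_space)
    also have "(\<integral>x. (c x)\<^sup>2 \<partial>torus) = 1 / real (freq_count TYPE('n) E)"
      unfolding c_def by (rule integral_covariance_square[OF N0])
    finally have "(\<integral>x. inverse (sqrt (1 - (c x)\<^sup>2)) \<partial>torus) - 1 - 1 / (2 * real (freq_count TYPE('n) E)) = (\<integral>x. H x \<partial>torus)"
      by simp
    also have "\<bar>\<dots>\<bar> \<le> (\<integral>x. \<bar>H x\<bar> \<partial>torus)" by (rule integral_abs_bound)
    also have "\<dots> \<le> C2 * (\<integral>x. (c x) ^ 4 \<partial>torus)"
    proof -
      have C20: "C2 \<ge> 0" using \<eta> by (simp add: C2_def le_max_iff_disj)
      have "ennreal (\<integral>x. \<bar>H x\<bar> \<partial>torus) = (\<integral>\<^sup>+x. ennreal \<bar>H x\<bar> \<partial>torus)"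
        by (rule nn_integral_eq_integral[symmetric]) (use Hint in auto)
      also have "\<dots> \<le> ennreal (C2 * (\<integral>x. (c x) ^ 4 \<partial>torus))"
        using HI C20 unfolding c4eq by (simp add: ennreal_mult)
      finally show ?thesis using C20 by (subst (asm) ennreal_le_iff) auto
    qed
    also have "\<dots> \<le> C * (\<integral>x. (c x) ^ 4 \<partial>torus)" by (intro mult_right_mono) (auto simp: C_def)
    finally show "\<bar>(\<integral>x. inverse (sqrt (1 - (covariance E x y)\<^sup>2)) \<partial>torus) - 1 - 1 / (2 * real (freq_count TYPE('n) E))\<bar>
      \<le> C * (\<integral>x. (covariance E x y) ^ 4 \<partial>torus)" by (simp add: c_def)
  qed
qed

section \<open>Joint laws of Gaussian linear forms\<close>

lemma borel_measurable_cis [measurable]: "cis \<in> borel_measurable borel"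
  by (intro borel_measurable_continuous_onI continuous_intros)

text \<open>Dividing by the total mass turns the weights into probability densities, to which Levy's
  uniqueness theorem applies. The masses agree by the hypothesis at \<open>s = 0\<close>; mass zero
  is treated apart.\<close>

lemma char_weighted_eq_imp:
  fixes X :: "'a \<Rightarrow> real" and X' :: "'b \<Rightarrow> real" and w :: "'a \<Rightarrow> real" and w' :: "'b \<Rightarrow> real"
  assumes M: "prob_space M" and M': "prob_space M'"
    and [measurable]: "X \<in> borel_measurable M" "X' \<in> borel_measurable M'" "w \<in> borel_measurable M" "w' \<in> borel_measurable M'"
    and w: "\<And>x. 0 \<le> w x" "\<And>x. w x \<le> K" and w': "\<And>x. 0 \<le> w' x" "\<And>x. w' x \<le> K"
    and char: "\<And>s. (\<integral>x. complex_of_real (w x) * cis (s * X x) \<partial>M) = (\<integral>x. complex_of_real (w' x) * cis (s * X' x) \<partial>M')"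
    and A: "A \<in> sets borel"
  shows "(\<integral>x. w x * indicator A (X x) \<partial>M) = (\<integral>x. w' x * indicator A (X' x) \<partial>M')"
proof -
  interpret M: prob_space M by fact
  interpret M': prob_space M' by fact
  have wi: "integrable M w" by (rule M.integrable_const_bound[of _ K]) (use w in auto)
  have wi': "integrable M' w'" by (rule M'.integrable_const_bound[of _ K]) (use w' in auto)
  define c where "c = (\<integral>x. w x \<partial>M)"
  have "complex_of_real c = complex_of_real (\<integral>x. w' x \<partial>M')"
    using char[of 0] by (simp add: c_def flip: integral_complex_of_real)
  then have c': "c = (\<integral>x. w' x \<partial>M')" by (simp only: of_real_eq_iff)
  have c0: "c \<ge> 0" unfolding c_def using w by (intro Bochner_Integration.integral_nonneg) auto
  show ?thesis
  proof (cases "c = 0")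
    case True
    have "AE x in M. w x = 0"
      using True wi w by (subst integral_nonneg_eq_0_iff_AE[symmetric]) (auto simp: c_def)
    then have "(\<integral>x. w x * indicator A (X x) \<partial>M) = (\<integral>x. 0 \<partial>M)" using A by (intro integral_cong_AE) auto
    moreover have "AE x in M'. w' x = 0"
      using True wi' w' by (subst integral_nonneg_eq_0_iff_AE[symmetric]) (auto simp: c')
    then have "(\<integral>x. w' x * indicator A (X' x) \<partial>M') = (\<integral>x. 0 \<partial>M')" using A by (intro integral_cong_AE) auto
    ultimately show ?thesis by simp
  next
    case False
    then have cp: "c > 0" using c0 by simp
    define D where "D = density M (\<lambda>x. ennreal (w x / c))"
    define D' where "D' = density M' (\<lambda>x. ennreal (w' x / c))"
    have "emeasure D (space D) = (\<integral>\<^sup>+x. ennreal (w x / c) \<partial>M)"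
      by (simp add: D_def emeasure_density cong: nn_integral_cong)
    also have "\<dots> = ennreal (\<integral>x. w x / c \<partial>M)" using wi w cp by (intro nn_integral_eq_integral) auto
    also have "\<dots> = 1" using cp by (simp add: c_def)
    finally interpret D: prob_space D by (rule prob_spaceI)
    have "emeasure D' (space D') = (\<integral>\<^sup>+x. ennreal (w' x / c) \<partial>M')"
      by (simp add: D'_def emeasure_density cong: nn_integral_cong)
    also have "\<dots> = ennreal (\<integral>x. w' x / c \<partial>M')" using wi' w' cp by (intro nn_integral_eq_integral) auto
    also have "\<dots> = 1" using cp by (simp add: c')
    finally interpret D': prob_space D' by (rule prob_spaceI)
    have mX [measurable]: "X \<in> borel_measurable D" "X' \<in> borel_measurable D'" by (simp_all add: D_def D'_def)
    have "char (distr D borel X) s = char (distr D' borel X') s" for s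
    proof -
      have "char (distr D borel X) s = (\<integral>x. cis (s * X x) \<partial>D)"
        unfolding char_def by (subst integral_distr) (auto simp: cis_conv_exp)
      also have "\<dots> = (\<integral>x. (w x / c) *\<^sub>R cis (s * X x) \<partial>M)"
        unfolding D_def using w cp by (subst integral_density) auto
      also have "\<dots> = (\<integral>x. complex_of_real (w x) * cis (s * X x) \<partial>M) / c"
        by (simp add: scaleR_conv_of_real)
      also have "\<dots> = (\<integral>x. complex_of_real (w' x) * cis (s * X' x) \<partial>M') / c" by (simp only: char)
      also have "\<dots> = (\<integral>x. (w' x / c) *\<^sub>R cis (s * X' x) \<partial>M')"
        by (simp add: scaleR_conv_of_real)
      also have "\<dots> = (\<integral>x. cis (s * X' x) \<partial>D')"
        unfolding D'_def using w' cp by (subst integral_density) auto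
      also have "\<dots> = char (distr D' borel X') s"
        unfolding char_def by (subst integral_distr) (auto simp: cis_conv_exp)
      finally show ?thesis .
    qed
    then have eq: "distr D borel X = distr D' borel X'"
      by (intro Levy_uniqueness D.real_distribution_distr D'.real_distribution_distr ext mX)
    have "(\<integral>x. indicator A (X x) \<partial>D) = (\<integral>x. (indicator A x :: real) \<partial>distr D borel X)"
      using A by (subst integral_distr) auto
    also have "\<dots> = (\<integral>x. indicator A x \<partial>distr D' borel X')" by (simp only: eq)
    also have "\<dots> = (\<integral>x. (indicator A (X' x) :: real) \<partial>D')"
      using A by (subst integral_distr) auto
    finally have "(\<integral>x. indicator A (X x) \<partial>D) = (\<integral>x. (indicator A (X' x) :: real) \<partial>D')" .
    then have "(\<integral>x. (w x / c) *\<^sub>R indicator A (X x) \<partial>M) = (\<integral>x. (w' x / c) *\<^sub>R (indicator A (X' x) :: real) \<partial>M')"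
      unfolding D_def D'_def using w w' cp A by (simp add: integral_density)
    then show ?thesis using cp by simp
  qed
qed

text \<open>
  Uniqueness for pairs follows from uniqueness on the line, applied first to the law of \<open>X\<close> weighted by the positive
  function \<open>2 + cos (t Y - \<phi>)\<close>, then to the law of \<open>Y\<close> on the event \<open>X \<in> A\<close>.
\<close>

lemma joint_char_eq_imp:
  fixes X Y :: "'a \<Rightarrow> real" and X' Y' :: "'b \<Rightarrow> real"
  assumes M: "prob_space M" and M': "prob_space M'"
    and [measurable]: "X \<in> borel_measurable M" "X' \<in> borel_measurable M'" "Y \<in> borel_measurable M" "Y' \<in> borel_measurable M'"
    and char: "\<And>s t. (\<integral>x. cis (s * X x + t * Y x) \<partial>M) = (\<integral>x. cis (s * X' x + t * Y' x) \<partial>M')"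
    and A: "A \<in> sets borel" and B: "B \<in> sets borel"
  shows "(\<integral>x. indicator A (X x) * indicator B (Y x) \<partial>M) = (\<integral>x. indicator A (X' x) * (indicator B (Y' x) :: real) \<partial>M')"
proof -
  interpret M: prob_space M by fact
  interpret M': prob_space M' by fact
  have ci: "integrable M (\<lambda>x. cis (s * X x + t * Y x))" for s t
    by (rule M.integrable_const_bound[of _ 1]) auto
  have ci': "integrable M' (\<lambda>x. cis (s * X' x + t * Y' x))" for s t
    by (rule M'.integrable_const_bound[of _ 1]) auto
  have Ai: "integrable M (\<lambda>x. f x * indicator A (X x))" if [measurable]: "f \<in> borel_measurable M" and "\<And>x. \<bar>f x\<bar> \<le> 1" for f :: "'a \<Rightarrow> real"
    using that A by (intro M.integrable_const_bound[of _ 1]) (auto simp: abs_mult split: split_indicator)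
  have Ai': "integrable M' (\<lambda>x. f x * indicator A (X' x))" if [measurable]: "f \<in> borel_measurable M'" and "\<And>x. \<bar>f x\<bar> \<le> 1" for f :: "'b \<Rightarrow> real"
    using that A by (intro M'.integrable_const_bound[of _ 1]) (auto simp: abs_mult split: split_indicator)
  have mcos: "(\<lambda>x. cos (t * Y x - \<phi>)) \<in> borel_measurable M" "(\<lambda>x. cos (t * Y' x - \<phi>)) \<in> borel_measurable M'" for t \<phi>
    by measurable
  have weighted: "(\<integral>x. (2 + cos (t * Y x - \<phi>)) * indicator A (X x) \<partial>M) = (\<integral>x. (2 + cos (t * Y' x - \<phi>)) * indicator A (X' x) \<partial>M')" for t \<phi>
  proof (rule char_weighted_eq_imp[OF M M' _ _ _ _ _ _ _ _ _ A, of X X' "\<lambda>x. 2 + cos (t * Y x - \<phi>)" "\<lambda>x. 2 + cos (t * Y' x - \<phi>)" 3])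
    fix s
    \<comment> \<open>Writing the cosine as two exponentials expresses the weighted transform
      through joint characteristic functions at \<open>(s, 0)\<close>, \<open>(s, t)\<close> and
      \<open>(s, -t)\<close>.\<close>
    have expand: "complex_of_real (2 + cos (t * v - \<phi>)) * cis (s * u)
      = 2 * cis (s * u + 0 * v) + (cis (- \<phi>) / 2) * cis (s * u + t * v) + (cis \<phi> / 2) * cis (s * u + (- t) * v)" for u v
    proof -
      have "complex_of_real (cos \<theta>) = (cis \<theta> + cis (- \<theta>)) / 2" for \<theta>
        by (simp add: complex_eq_iff)
      then have "complex_of_real (2 + cos (t * v - \<phi>)) * cis (s * u) = 2 * cis (s * u) + (cis (t * v - \<phi>) * cis (s * u)) / 2 + (cis (- (t * v - \<phi>)) * cis (s * u)) / 2"
        by (simp only: of_real_add of_real_numeral distrib_right add_divide_distrib times_divide_eq_left add.assoc)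
      then show ?thesis by (simp add: cis_mult algebra_simps)
    qed
    show "(\<integral>x. complex_of_real (2 + cos (t * Y x - \<phi>)) * cis (s * X x) \<partial>M)
        = (\<integral>x. complex_of_real (2 + cos (t * Y' x - \<phi>)) * cis (s * X' x) \<partial>M')"
      unfolding expand using ci ci' by (simp only: Bochner_Integration.integral_add Bochner_Integration.integrable_add
          integrable_mult_right integral_mult_right_zero char)
  next
    fix x show "0 \<le> 2 + cos (t * Y x - \<phi>)" "2 + cos (t * Y x - \<phi>) \<le> 3"
      using cos_ge_minus_one[of "t * Y x - \<phi>"] cos_le_one[of "t * Y x - \<phi>"] by linarith+
  next
    fix x show "0 \<le> 2 + cos (t * Y' x - \<phi>)" "2 + cos (t * Y' x - \<phi>) \<le> 3"
      using cos_ge_minus_one[of "t * Y' x - \<phi>"] cos_le_one[of "t * Y' x - \<phi>"] by linarith+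
  qed (use mcos in auto)
  have split: "(\<integral>x. (2 + cos (t * Y x - \<phi>)) * indicator A (X x) \<partial>M) = 2 * (\<integral>x. indicator A (X x) \<partial>M) + (\<integral>x. cos (t * Y x - \<phi>) * indicator A (X x) \<partial>M)" for t \<phi>
    using Ai[OF mcos(1), of t \<phi>] Ai[of "\<lambda>_. 1"] by (simp add: distrib_right)
  have split': "(\<integral>x. (2 + cos (t * Y' x - \<phi>)) * indicator A (X' x) \<partial>M') = 2 * (\<integral>x. indicator A (X' x) \<partial>M') + (\<integral>x. cos (t * Y' x - \<phi>) * indicator A (X' x) \<partial>M')" for t \<phi>
    using Ai'[OF mcos(2), of t \<phi>] Ai'[of "\<lambda>_. 1"] by (simp add: distrib_right)
  \<comment> \<open>At \<open>t = 0\<close> and \<open>\<phi> = 0\<close> the weight is the constant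
    3.\<close>
  have PA: "(\<integral>x. indicator A (X x) \<partial>M) = (\<integral>x. (indicator A (X' x) :: real) \<partial>M')"
    using weighted[of 0 0] unfolding split split' by simp
  have cosA: "(\<integral>x. cos (t * Y x - \<phi>) * indicator A (X x) \<partial>M) = (\<integral>x. cos (t * Y' x - \<phi>) * indicator A (X' x) \<partial>M')" for t \<phi>
    using weighted[of t \<phi>] PA unfolding split split' by simp
  have "(\<integral>x. indicator A (X x) * indicator B (Y x) \<partial>M) = (\<integral>x. indicator A (X' x) * (indicator B (Y' x) :: real) \<partial>M')"
  proof (rule char_weighted_eq_imp[OF M M' _ _ _ _ _ _ _ _ _ B, of Y Y' "\<lambda>x. indicator A (X x)" "\<lambda>x. indicator A (X' x)" 1])
    fix t
    \<comment> \<open>The phases \<open>0\<close> and \<open>pi / 2\<close> provide the real and the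
      imaginary part of the exponential.\<close>
    have e: "complex_of_real (indicator A u) * cis (t * v) = complex_of_real (cos (t * v - 0) * indicator A u) + \<i> * complex_of_real (cos (t * v - pi / 2) * indicator A u)" for u v
      by (simp add: complex_eq_iff cos_diff)
    have i1: "integrable M (\<lambda>x. complex_of_real (cos (t * Y x - \<phi>) * indicator A (X x)))" for \<phi>
      using Ai[OF mcos(1), of t \<phi>] by (intro integrable_of_real) simp
    have i2: "integrable M' (\<lambda>x. complex_of_real (cos (t * Y' x - \<phi>) * indicator A (X' x)))" for \<phi>
      using Ai'[OF mcos(2), of t \<phi>] by (intro integrable_of_real) simp
    show "(\<integral>x. complex_of_real (indicator A (X x)) * cis (t * Y x) \<partial>M) = (\<integral>x. complex_of_real (indicator A (X' x)) * cis (t * Y' x) \<partial>M')"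
      unfolding e using i1 i2 by (simp only: Bochner_Integration.integral_add integrable_mult_right integral_mult_right_zero integral_complex_of_real cosA)
  qed (use A in auto)
  then show ?thesis .
qed

lemma char_std_normal_sum:
  assumes M: "prob_space M" and fin: "finite I"
    and ind: "prob_space.indep_vars M (\<lambda>_. borel) \<xi> I"
    and gauss: "\<And>i. i \<in> I \<Longrightarrow> distributed M lborel (\<xi> i) std_normal_density"
  shows "(\<integral>x. cis (\<Sum>i\<in>I. a i * \<xi> i x) \<partial>M) = exp (- (\<Sum>i\<in>I. (a i)\<^sup>2) / 2)"
proof -
  interpret prob_space M by fact
  have m: "\<xi> i \<in> borel_measurable M" if "i \<in> I" for i
    using distributed_measurable[OF gauss[OF that]] by simp
  have each: "char (distr M borel (\<lambda>x. a i * \<xi> i x)) 1 = exp (- (a i)\<^sup>2 / 2)" if i: "i \<in> I" for i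
  proof -
    have "char (distr M borel (\<lambda>x. a i * \<xi> i x)) 1 = (\<integral>x. iexp (a i * \<xi> i x) \<partial>M)"
      unfolding char_def using m[OF i] by (subst integral_distr) auto
    also have "\<dots> = char (distr M lborel (\<xi> i)) (a i)"
      unfolding char_def using m[OF i] by (subst integral_distr) auto
    also have "distr M lborel (\<xi> i) = std_normal_distribution"
      using distributed_distr_eq_density[OF gauss[OF i]] by simp
    finally show ?thesis by (simp add: char_std_normal_distribution)
  qed
  have "indep_vars (\<lambda>_. borel) (\<lambda>i x. a i * \<xi> i x) I"
    using indep_vars_compose2[OF ind, of "\<lambda>i t. a i * t" "\<lambda>_. borel"] by simp
  then have "char (distr M borel (\<lambda>x. \<Sum>i\<in>I. a i * \<xi> i x)) 1 = (\<Prod>i\<in>I. char (distr M borel (\<lambda>x. a i * \<xi> i x)) 1)"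
    by (rule char_distr_sum)
  also have "\<dots> = (\<Prod>i\<in>I. exp (- complex_of_real ((a i)\<^sup>2) / 2))" using each by (intro prod.cong) (auto simp flip: exp_of_real)
  also have "\<dots> = exp (\<Sum>i\<in>I. - complex_of_real ((a i)\<^sup>2) / 2)" using fin by (simp add: exp_sum)
  also have "(\<Sum>i\<in>I. - complex_of_real ((a i)\<^sup>2) / 2) = complex_of_real (- (\<Sum>i\<in>I. (a i)\<^sup>2) / 2)"
    by (simp add: sum_divide_distrib[symmetric] sum_negf)
  finally have "char (distr M borel (\<lambda>x. \<Sum>i\<in>I. a i * \<xi> i x)) 1 = exp (complex_of_real (- (\<Sum>i\<in>I. (a i)\<^sup>2) / 2))" .
  moreover have "char (distr M borel (\<lambda>x. \<Sum>i\<in>I. a i * \<xi> i x)) 1 = (\<integral>x. cis (\<Sum>i\<in>I. a i * \<xi> i x) \<partial>M)"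
    unfolding char_def using m by (subst integral_distr) (auto simp: cis_conv_exp intro!: borel_measurable_sum)
  ultimately show ?thesis by (simp only: exp_of_real)
qed

text \<open>
  A standard Gaussian pair with correlation \<open>\<rho>\<close> is modelled as \<open>(X, \<rho> X + \<tau> Z)\<close>, where \<open>(X, Z)\<close> has law \<open>gauss2\<close> and
  \<open>\<tau> = sqrt (1 - \<rho>\<^sup>2)\<close>.
\<close>

definition gauss2 :: "(real \<times> real) measure" where
  "gauss2 = std_normal_distribution \<Otimes>\<^sub>M std_normal_distribution"

lemma prob_space_gauss2: "prob_space gauss2"
proof -
  interpret N: prob_space std_normal_distribution by (rule real_dist_normal_dist[THEN real_distribution.axioms(1)])
  interpret P: pair_prob_space std_normal_distribution std_normal_distribution ..
  show ?thesis unfolding gauss2_def by (rule P.prob_space_axioms)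
qed

lemma integral_cis_gauss2:
  "(\<integral>z. cis (s * fst z + t * (\<rho> * fst z + \<tau> * snd z)) \<partial>gauss2) = exp (- ((s + t * \<rho>)\<^sup>2 + (t * \<tau>)\<^sup>2) / 2)"
proof -
  interpret N: prob_space std_normal_distribution by (rule real_dist_normal_dist[THEN real_distribution.axioms(1)])
  interpret P: pair_prob_space std_normal_distribution std_normal_distribution ..
  have meas: "(\<lambda>x. cis (f x)) \<in> borel_measurable N" if "f \<in> borel_measurable N" for f :: "'c \<Rightarrow> real" and N
    by (rule measurable_compose[OF that]) (auto intro!: borel_measurable_continuous_onI continuous_intros)
  have c: "(\<integral>x. cis (u * x) \<partial>std_normal_distribution) = exp (- u\<^sup>2 / 2)" for u
    using fun_cong[OF char_std_normal_distribution, of u] by (simp add: char_def cis_conv_exp)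
  have i: "integrable std_normal_distribution (\<lambda>x. cis (u * x))" for u
    by (rule N.integrable_const_bound[of _ 1]) (auto intro!: meas)
  have "(\<integral>z. cis (s * fst z + t * (\<rho> * fst z + \<tau> * snd z)) \<partial>gauss2)
      = (\<integral>z. cis ((s + t * \<rho>) * fst z) * cis ((t * \<tau>) * snd z) \<partial>gauss2)"
    by (simp add: cis_mult algebra_simps)
  also have "\<dots> = (\<integral>x. (\<integral>y. cis ((s + t * \<rho>) * x) * cis ((t * \<tau>) * y) \<partial>std_normal_distribution) \<partial>std_normal_distribution)"
    unfolding gauss2_def
    by (subst P.integral_fst'[symmetric]) (auto intro!: P.integrable_const_bound[of _ 1] borel_measurable_times meas simp: norm_mult)
  also have "\<dots> = (\<integral>x. cis ((s + t * \<rho>) * x) * exp (- (t * \<tau>)\<^sup>2 / 2) \<partial>std_normal_distribution)"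
    using i by (simp add: c)
  also have "\<dots> = exp (- (s + t * \<rho>)\<^sup>2 / 2) * exp (- (t * \<tau>)\<^sup>2 / 2)"
    using i by (simp add: c)
  also have "\<dots> = exp (- ((s + t * \<rho>)\<^sup>2 + (t * \<tau>)\<^sup>2) / 2)" by (simp flip: exp_add add: algebra_simps)
  finally show ?thesis .
qed

text \<open>Both pairs have the joint characteristic function
  \<open>exp (- (s\<^sup>2 + 2 * \<rho> * s * t + t\<^sup>2) / 2)\<close>. The degenerate
  correlations \<open>1\<close> and \<open>-1\<close> are included, so the law is available at every
  pair of points.\<close>

lemma gaussian_pair_law:
  assumes M: "prob_space M" and fin: "finite I"
    and ind: "prob_space.indep_vars M (\<lambda>_. borel) \<xi> I"
    and gauss: "\<And>i. i \<in> I \<Longrightarrow> distributed M lborel (\<xi> i) std_normal_density"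
    and a: "(\<Sum>i\<in>I. (a i)\<^sup>2) = 1" and b: "(\<Sum>i\<in>I. (b i)\<^sup>2) = 1" and ab: "(\<Sum>i\<in>I. a i * b i) = \<rho>"
    and A: "A \<in> sets borel" and B: "B \<in> sets borel"
  shows "(\<integral>x. indicator A (\<Sum>i\<in>I. a i * \<xi> i x) * indicator B (\<Sum>i\<in>I. b i * \<xi> i x) \<partial>M)
    = (\<integral>z. indicator A (fst z) * (indicator B (\<rho> * fst z + sqrt (1 - \<rho>\<^sup>2) * snd z) :: real) \<partial>gauss2)"
proof (rule joint_char_eq_imp[OF M prob_space_gauss2])
  interpret prob_space M by fact
  have m: "\<xi> i \<in> borel_measurable M" if "i \<in> I" for i
    using distributed_measurable[OF gauss[OF that]] by simp
  show "(\<lambda>x. \<Sum>i\<in>I. a i * \<xi> i x) \<in> borel_measurable M" "(\<lambda>x. \<Sum>i\<in>I. b i * \<xi> i x) \<in> borel_measurable M"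
    using m by (auto intro!: borel_measurable_sum)
  show "fst \<in> borel_measurable gauss2" "(\<lambda>z. \<rho> * fst z + sqrt (1 - \<rho>\<^sup>2) * snd z) \<in> borel_measurable gauss2"
    unfolding gauss2_def by measurable
  fix s t :: real
  have "\<rho>\<^sup>2 \<le> (\<Sum>i\<in>I. (a i)\<^sup>2) * (\<Sum>i\<in>I. (b i)\<^sup>2)"
    unfolding ab[symmetric] by (rule Cauchy_Schwarz_ineq_sum)
  then have \<tau>: "(sqrt (1 - \<rho>\<^sup>2))\<^sup>2 = 1 - \<rho>\<^sup>2" using a b by simp
  have "(\<Sum>i\<in>I. (s * a i + t * b i)\<^sup>2) = s\<^sup>2 * (\<Sum>i\<in>I. (a i)\<^sup>2) + 2 * s * t * (\<Sum>i\<in>I. a i * b i) + t\<^sup>2 * (\<Sum>i\<in>I. (b i)\<^sup>2)"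
    by (simp add: power2_eq_square algebra_simps sum.distrib sum_distrib_left)
  also have "\<dots> = (s + t * \<rho>)\<^sup>2 + (t * sqrt (1 - \<rho>\<^sup>2))\<^sup>2"
    unfolding a b ab by (simp add: power_mult_distrib \<tau>) (simp add: power2_eq_square algebra_simps)
  finally have sq: "(\<Sum>i\<in>I. (s * a i + t * b i)\<^sup>2) = (s + t * \<rho>)\<^sup>2 + (t * sqrt (1 - \<rho>\<^sup>2))\<^sup>2" .
  have "s * (\<Sum>i\<in>I. a i * \<xi> i x) + t * (\<Sum>i\<in>I. b i * \<xi> i x) = (\<Sum>i\<in>I. (s * a i + t * b i) * \<xi> i x)" for x
    by (simp add: sum_distrib_left distrib_right sum.distrib mult.assoc)
  then show "(\<integral>x. cis (s * (\<Sum>i\<in>I. a i * \<xi> i x) + t * (\<Sum>i\<in>I. b i * \<xi> i x)) \<partial>M)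
    = (\<integral>z. cis (s * fst z + t * (\<rho> * fst z + sqrt (1 - \<rho>\<^sup>2) * snd z)) \<partial>gauss2)"
    unfolding integral_cis_gauss2 sq[symmetric] by (simp add: char_std_normal_sum[OF M fin ind gauss])
qed (rule A B)+

section \<open>Gaussian pairs in thin strips\<close>

lemma std_normal_prob_space: "prob_space std_normal_distribution"
  by (rule real_dist_normal_dist[THEN real_distribution.axioms(1)])

text \<open>Bounds the density above by its value at 0 and below by
  \<open>exp t \<ge> 1 + t\<close>.\<close>

lemma std_normal_interval:
  fixes a b r :: real
  assumes ab: "a \<le> b"
  shows "(\<integral>z. indicator {a<..<b} z \<partial>std_normal_distribution) \<le> (b - a) / sqrt (2 * pi)"
    and "(\<And>z. a < z \<Longrightarrow> z < b \<Longrightarrow> \<bar>z\<bar> \<le> r) \<Longrightarrow>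
      (b - a) / sqrt (2 * pi) * (1 - r\<^sup>2 / 2) \<le> (\<integral>z. indicator {a<..<b} z \<partial>std_normal_distribution)"
proof -
  define J where "J = (\<integral>z. std_normal_density z * indicator {a<..<b} z \<partial>lborel)"
  have J: "(\<integral>z. indicator {a<..<b} z \<partial>std_normal_distribution) = J"
    unfolding J_def by (subst integral_density) auto
  have ic: "integrable lborel (\<lambda>z. k * indicator {a<..<b} z)" for k :: real
    using ab by (intro integrable_mult_right integrable_real_indicator) auto
  have vc: "(\<integral>z. k * indicator {a<..<b} z \<partial>lborel) = k * (b - a)" for k :: real
    using ab by simp
  have dens: "std_normal_density z \<le> 1 / sqrt (2 * pi)" "1 / sqrt (2 * pi) * (1 - z\<^sup>2 / 2) \<le> std_normal_density z" for z
    using exp_ge_add_one_self[of "- z\<^sup>2 / 2"] by (auto simp: std_normal_density_def divide_right_mono)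
  have iJ: "integrable lborel (\<lambda>z. std_normal_density z * indicator {a<..<b} z)"
    by (rule Bochner_Integration.integrable_bound[OF ic[of "1 / sqrt (2 * pi)"]])
       (use dens in \<open>auto simp: normal_density_nonneg split: split_indicator\<close>)
  have "J \<le> (\<integral>z. 1 / sqrt (2 * pi) * indicator {a<..<b} z \<partial>lborel)"
    unfolding J_def by (intro integral_mono iJ ic) (use dens in \<open>auto split: split_indicator\<close>)
  then show "(\<integral>z. indicator {a<..<b} z \<partial>std_normal_distribution) \<le> (b - a) / sqrt (2 * pi)"
    unfolding J vc by simp
  assume r: "\<And>z. a < z \<Longrightarrow> z < b \<Longrightarrow> \<bar>z\<bar> \<le> r"
  have "(\<integral>z. (1 / sqrt (2 * pi) * (1 - r\<^sup>2 / 2)) * indicator {a<..<b} z \<partial>lborel) \<le> J"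
    unfolding J_def
  proof (intro integral_mono iJ ic)
    fix z
    show "(1 / sqrt (2 * pi) * (1 - r\<^sup>2 / 2)) * indicator {a<..<b} z \<le> std_normal_density z * indicator {a<..<b} z"
    proof (cases "z \<in> {a<..<b}")
      case True
      then have "\<bar>z\<bar> \<le> \<bar>r\<bar>" using r[of z] by auto
      then have "z\<^sup>2 \<le> r\<^sup>2" by (simp add: abs_le_square_iff)
      then have "1 / sqrt (2 * pi) * (1 - r\<^sup>2 / 2) \<le> 1 / sqrt (2 * pi) * (1 - z\<^sup>2 / 2)" by (intro mult_left_mono) auto
      then show ?thesis using True dens(2)[of z] by simp
    qed simp
  qed
  then show "(b - a) / sqrt (2 * pi) * (1 - r\<^sup>2 / 2) \<le> (\<integral>z. indicator {a<..<b} z \<partial>std_normal_distribution)"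
    unfolding J vc by (simp add: mult.commute)
qed

text \<open>Given the first coordinate \<open>s\<close>, the second condition confines the
  independent variable to an interval of length \<open>2 * \<delta> / \<tau>\<close> inside
  \<open>[-x, x]\<close> with \<open>x = (\<epsilon> + \<delta>) / \<tau>\<close>. Each of the two
  interval estimates loses at most a factor \<open>1 - x\<^sup>2 / 2\<close>. For
  \<open>x \<ge> 1\<close> the lower bound is trivial because its left side is not positive.\<close>

lemma gauss2_strip_bounds:
  fixes \<epsilon> \<delta> \<rho> :: real
  assumes \<epsilon>: "\<epsilon> > 0" and \<delta>: "\<delta> > 0" and \<rho>: "\<bar>\<rho>\<bar> < 1"
  defines "\<tau> \<equiv> sqrt (1 - \<rho>\<^sup>2)"
  defines "P \<equiv> (\<integral>z. indicator {-\<epsilon><..<\<epsilon>} (fst z) * (indicator {-\<delta><..<\<delta>} (\<rho> * fst z + \<tau> * snd z) :: real) \<partial>gauss2)"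
  shows "P \<le> 4 * \<epsilon> * \<delta> / (2 * pi * \<tau>)"
    and "4 * \<epsilon> * \<delta> / (2 * pi * \<tau>) * (1 - ((\<epsilon> + \<delta>) / \<tau>)\<^sup>2) \<le> P"
proof -
  let ?N = std_normal_distribution
  interpret N: prob_space ?N by (rule std_normal_prob_space)
  interpret PP: pair_prob_space ?N ?N ..
  have "\<rho>\<^sup>2 < 1" using \<rho> by (simp add: abs_square_less_1)
  then have \<tau>: "0 < \<tau>" "\<tau> \<le> 1" by (simp_all add: \<tau>_def)
  define h where "h = (\<lambda>s. \<integral>z. (indicator {-\<delta><..<\<delta>} (\<rho> * s + \<tau> * z) :: real) \<partial>?N)"
  define x where "x = (\<epsilon> + \<delta>) / \<tau>"
  define u where "u = 2 * \<delta> / \<tau> / sqrt (2 * pi)"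
  define I where "I = (\<integral>s. (indicator {-\<epsilon><..<\<epsilon>} s :: real) \<partial>?N)"
  have u0: "u \<ge> 0" using \<tau> \<delta> by (simp add: u_def)
  have ind: "indicator {-\<delta><..<\<delta>} (\<rho> * s + \<tau> * z) = (indicator {(-\<delta> - \<rho> * s) / \<tau><..<(\<delta> - \<rho> * s) / \<tau>} z :: real)" for s z
    using \<tau> by (auto simp: indicator_def field_simps)
  have h_upper: "h s \<le> u" for s
  proof -
    have "h s \<le> ((\<delta> - \<rho> * s) / \<tau> - (-\<delta> - \<rho> * s) / \<tau>) / sqrt (2 * pi)"
      unfolding h_def ind by (rule std_normal_interval(1))
        (use \<tau> \<delta> in \<open>auto intro!: divide_right_mono\<close>)
    also have "\<dots> = u" by (simp add: u_def flip: diff_divide_distrib)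
    finally show ?thesis .
  qed
  have h_lower: "u * (1 - x\<^sup>2 / 2) \<le> h s" if s: "s \<in> {-\<epsilon><..<\<epsilon>}" for s
  proof -
    have "\<bar>\<rho> * s\<bar> \<le> 1 * \<epsilon>" unfolding abs_mult using s \<rho> by (intro mult_mono) auto
    then have rs: "\<bar>\<rho> * s\<bar> \<le> \<epsilon>" by simp
    have "((\<delta> - \<rho> * s) / \<tau> - (-\<delta> - \<rho> * s) / \<tau>) / sqrt (2 * pi) * (1 - x\<^sup>2 / 2) \<le> h s"
      unfolding h_def ind
    proof (rule std_normal_interval(2))
      show "(-\<delta> - \<rho> * s) / \<tau> \<le> (\<delta> - \<rho> * s) / \<tau>" using \<tau> \<delta> by (intro divide_right_mono) auto
      fix z assume "(-\<delta> - \<rho> * s) / \<tau> < z" "z < (\<delta> - \<rho> * s) / \<tau>"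
      then have "-\<delta> - \<rho> * s < z * \<tau>" "z * \<tau> < \<delta> - \<rho> * s" using \<tau> by (auto simp: field_simps)
      then have "\<bar>z * \<tau>\<bar> \<le> \<epsilon> + \<delta>" using rs by linarith
      then show "\<bar>z\<bar> \<le> x" using \<tau> by (simp add: x_def abs_mult pos_le_divide_eq)
    qed
    moreover have "((\<delta> - \<rho> * s) / \<tau> - (-\<delta> - \<rho> * s) / \<tau>) / sqrt (2 * pi) = u" by (simp add: u_def flip: diff_divide_distrib)
    ultimately show ?thesis by simp
  qed
  have P: "P = (\<integral>s. indicator {-\<epsilon><..<\<epsilon>} s * h s \<partial>?N)"
  proof -
    have "P = (\<integral>s. (\<integral>z. indicator {-\<epsilon><..<\<epsilon>} s * (indicator {-\<delta><..<\<delta>} (\<rho> * s + \<tau> * z) :: real) \<partial>?N) \<partial>?N)"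
      unfolding P_def gauss2_def
      by (subst PP.integral_fst'[symmetric]) (auto intro!: PP.integrable_const_bound[of _ 1] simp: abs_mult split: split_indicator)
    also have "\<dots> = (\<integral>s. indicator {-\<epsilon><..<\<epsilon>} s * h s \<partial>?N)"
      unfolding h_def by simp
    finally show ?thesis .
  qed
  have h_meas [measurable]: "h \<in> borel_measurable borel"
  proof -
    have "h \<in> borel_measurable ?N" unfolding h_def
      by (rule N.borel_measurable_lebesgue_integral) (simp add: split_beta)
    then show ?thesis by simp
  qed
  have h0: "0 \<le> h s" for s unfolding h_def by (intro Bochner_Integration.integral_nonneg) auto
  have ih: "integrable ?N (\<lambda>s. indicator {-\<epsilon><..<\<epsilon>} s * h s)"
    by (rule N.integrable_const_bound[of _ u]) (use h0 h_upper u0 in \<open>auto split: split_indicator\<close>)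
  have iI: "integrable ?N (\<lambda>s. indicator {-\<epsilon><..<\<epsilon>} s * k)" for k :: real
    by (rule N.integrable_const_bound[of _ "\<bar>k\<bar>"]) (auto split: split_indicator)
  have I_upper: "I \<le> 2 * \<epsilon> / sqrt (2 * pi)" and I_lower: "2 * \<epsilon> / sqrt (2 * pi) * (1 - \<epsilon>\<^sup>2 / 2) \<le> I"
    using std_normal_interval(1)[of "- \<epsilon>" \<epsilon>] std_normal_interval(2)[of "- \<epsilon>" \<epsilon> \<epsilon>] \<epsilon> by (auto simp: I_def)
  have uI: "u * (2 * \<epsilon> / sqrt (2 * pi)) = 4 * \<epsilon> * \<delta> / (2 * pi * \<tau>)"
    using \<tau> by (simp add: u_def field_simps)
  have "P \<le> (\<integral>s. indicator {-\<epsilon><..<\<epsilon>} s * u \<partial>?N)"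
    unfolding P by (intro integral_mono ih iI) (use h_upper in \<open>auto split: split_indicator\<close>)
  also have "\<dots> = u * I" by (simp add: I_def mult.commute)
  also have "\<dots> \<le> u * (2 * \<epsilon> / sqrt (2 * pi))" using I_upper u0 by (intro mult_left_mono)
  finally show "P \<le> 4 * \<epsilon> * \<delta> / (2 * pi * \<tau>)" by (simp only: uI)
  show "4 * \<epsilon> * \<delta> / (2 * pi * \<tau>) * (1 - ((\<epsilon> + \<delta>) / \<tau>)\<^sup>2) \<le> P"
  proof (cases "x < 1")
    case False
    then have "1 - x\<^sup>2 \<le> 0" by (simp add: power2_eq_square) (metis linorder_not_less mult_mono' mult_1 zero_le_one)
    then have "4 * \<epsilon> * \<delta> / (2 * pi * \<tau>) * (1 - x\<^sup>2) \<le> 0" using \<epsilon> \<delta> \<tau> by (intro mult_nonneg_nonpos) auto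
    also have "0 \<le> P" unfolding P using h0 by (intro Bochner_Integration.integral_nonneg) auto
    finally show ?thesis by (simp add: x_def)
  next
    case True
    have "\<epsilon> + \<delta> \<le> x" using \<tau> \<epsilon> \<delta> by (simp add: x_def pos_le_divide_eq mult_left_le)
    then have "\<epsilon> \<le> x" "0 < x" using \<epsilon> \<delta> by auto
    then have x2: "\<epsilon>\<^sup>2 \<le> x\<^sup>2" "x\<^sup>2 < 1" using \<epsilon> True by (auto intro: power_mono simp: abs_square_less_1)
    have "1 - x\<^sup>2 \<le> (1 - x\<^sup>2 / 2) * (1 - x\<^sup>2 / 2)" by (simp add: algebra_simps)
    also have "\<dots> \<le> (1 - x\<^sup>2 / 2) * (1 - \<epsilon>\<^sup>2 / 2)" using x2 by (intro mult_left_mono) auto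
    finally have "4 * \<epsilon> * \<delta> / (2 * pi * \<tau>) * (1 - x\<^sup>2) \<le> 4 * \<epsilon> * \<delta> / (2 * pi * \<tau>) * ((1 - x\<^sup>2 / 2) * (1 - \<epsilon>\<^sup>2 / 2))"
      using \<epsilon> \<delta> \<tau> by (intro mult_left_mono) auto
    also have "\<dots> = u * (1 - x\<^sup>2 / 2) * (2 * \<epsilon> / sqrt (2 * pi) * (1 - \<epsilon>\<^sup>2 / 2))" unfolding uI[symmetric] by simp
    also have "\<dots> \<le> u * (1 - x\<^sup>2 / 2) * I" using I_lower u0 x2 by (intro mult_left_mono mult_nonneg_nonneg) auto
    also have "\<dots> = (\<integral>s. indicator {-\<epsilon><..<\<epsilon>} s * (u * (1 - x\<^sup>2 / 2)) \<partial>?N)" by (simp add: I_def mult.commute)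
    also have "\<dots> \<le> P" unfolding P by (intro integral_mono ih iI) (use h_lower in \<open>auto split: split_indicator\<close>)
    finally show ?thesis by (simp add: x_def)
  qed
qed

text \<open>The deviation from \<open>k = 1 / (2 * pi * \<tau>)\<close> is at most
  \<open>k * x\<^sup>2\<close> and also at most \<open>k\<close>, hence at most
  \<open>k * sqrt x\<close> for every \<open>x\<close>. This interpolation keeps the singularity at
  \<open>\<tau> powr (-3/2)\<close>; using \<open>x\<^sup>2\<close> throughout would give
  \<open>\<tau> powr (-3)\<close>.\<close>

lemma gauss2_strip_density:
  fixes \<epsilon> \<delta> \<rho> :: real
  assumes \<epsilon>: "\<epsilon> > 0" and \<delta>: "\<delta> > 0" and \<rho>: "\<bar>\<rho>\<bar> < 1"
  shows "\<bar>(\<integral>z. indicator {-\<epsilon><..<\<epsilon>} (fst z) * (indicator {-\<delta><..<\<delta>} (\<rho> * fst z + sqrt (1 - \<rho>\<^sup>2) * snd z) :: real) \<partial>gauss2) / (4 * \<epsilon> * \<delta>)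
      - inverse (sqrt (1 - \<rho>\<^sup>2)) / (2 * pi)\<bar> \<le> sqrt (\<epsilon> + \<delta>) / (2 * pi) * inverse ((1 - \<rho>\<^sup>2) powr (3/4))"
proof -
  define \<tau> where "\<tau> = sqrt (1 - \<rho>\<^sup>2)"
  define P where "P = (\<integral>z. indicator {-\<epsilon><..<\<epsilon>} (fst z) * (indicator {-\<delta><..<\<delta>} (\<rho> * fst z + \<tau> * snd z) :: real) \<partial>gauss2)"
  define k where "k = 1 / (2 * pi * \<tau>)"
  define x where "x = (\<epsilon> + \<delta>) / \<tau>"
  have "\<rho>\<^sup>2 < 1" using \<rho> by (simp add: abs_square_less_1)
  then have \<tau>: "0 < \<tau>" by (simp add: \<tau>_def)
  have k0: "k > 0" using \<tau> by (simp add: k_def)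
  have x0: "x > 0" using \<epsilon> \<delta> \<tau> by (simp add: x_def)
  have u: "P \<le> 4 * \<epsilon> * \<delta> * k" and l: "4 * \<epsilon> * \<delta> * k * (1 - x\<^sup>2) \<le> P"
    using gauss2_strip_bounds[OF assms] by (simp_all add: P_def \<tau>_def k_def x_def)
  have ed: "4 * \<epsilon> * \<delta> > 0" using \<epsilon> \<delta> by simp
  have u': "P / (4 * \<epsilon> * \<delta>) \<le> k" using u ed by (simp add: pos_divide_le_eq mult.commute)
  have l': "k * (1 - x\<^sup>2) \<le> P / (4 * \<epsilon> * \<delta>)" using l ed by (simp add: pos_le_divide_eq mult_ac)
  have P0: "0 \<le> P / (4 * \<epsilon> * \<delta>)"
    using ed unfolding P_def by (intro divide_nonneg_pos Bochner_Integration.integral_nonneg) auto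
  have "\<bar>P / (4 * \<epsilon> * \<delta>) - k\<bar> \<le> k * sqrt x"
  proof (cases "x \<le> 1")
    case True
    have "k * x\<^sup>2 \<le> k * sqrt x"
    proof (intro mult_left_mono)
      have "x\<^sup>2 \<le> x" using True x0 by (simp add: power2_eq_square mult_left_le)
      also have "x \<le> sqrt x" using True x0 by (simp add: real_le_rsqrt power2_eq_square mult_left_le)
      finally show "x\<^sup>2 \<le> sqrt x" .
    qed (use k0 in simp)
    then show ?thesis using u' l' by (simp add: algebra_simps)
  next
    case False
    then have "k * 1 \<le> k * sqrt x" using k0 by (intro mult_left_mono) auto
    then show ?thesis using u' P0 by simp
  qed
  also have "k * sqrt x = sqrt (\<epsilon> + \<delta>) / (2 * pi) * (1 / (\<tau> * sqrt \<tau>))"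
    by (simp add: k_def x_def real_sqrt_divide)
  also have "\<tau> * sqrt \<tau> = (1 - \<rho>\<^sup>2) powr (3/4)"
  proof -
    have "\<tau> = (1 - \<rho>\<^sup>2) powr (1/2)" using \<open>\<rho>\<^sup>2 < 1\<close> by (simp add: \<tau>_def powr_half_sqrt)
    moreover have "sqrt \<tau> = \<tau> powr (1/2)" using \<tau> by (simp add: powr_half_sqrt)
    ultimately have "\<tau> * sqrt \<tau> = (1 - \<rho>\<^sup>2) powr (1/2) * ((1 - \<rho>\<^sup>2) powr (1/2)) powr (1/2)" by metis
    then show ?thesis by (simp add: powr_powr flip: powr_add)
  qed
  finally show ?thesis by (simp add: P_def k_def \<tau>_def inverse_eq_divide mult.commute)
qed

lemma gauss2_strip_marginal:
  assumes "\<epsilon> > 0"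
  shows "\<bar>(\<integral>z. indicator {-\<epsilon><..<\<epsilon>} (fst z) \<partial>gauss2) / (2 * \<epsilon>) - 1 / sqrt (2 * pi)\<bar> \<le> \<epsilon>\<^sup>2"
proof -
  let ?N = std_normal_distribution
  interpret N: prob_space ?N by (rule std_normal_prob_space)
  interpret PP: pair_prob_space ?N ?N ..
  have "measure ?N UNIV = 1" using N.prob_space by simp
  define I where "I = (\<integral>s. (indicator {-\<epsilon><..<\<epsilon>} s :: real) \<partial>?N)"
  have "(\<integral>z. (indicator {-\<epsilon><..<\<epsilon>} (fst z) :: real) \<partial>gauss2) = I"
    unfolding gauss2_def I_def
    by (subst PP.integral_fst'[symmetric]) (auto intro!: PP.integrable_const_bound[of _ 1] simp: \<open>measure ?N UNIV = 1\<close>)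
  moreover have "I \<le> 2 * \<epsilon> / sqrt (2 * pi)" "2 * \<epsilon> / sqrt (2 * pi) * (1 - \<epsilon>\<^sup>2 / 2) \<le> I"
    using std_normal_interval(1)[of "- \<epsilon>" \<epsilon>] std_normal_interval(2)[of "- \<epsilon>" \<epsilon> \<epsilon>] assms by (auto simp: I_def)
  then have "I / (2 * \<epsilon>) \<le> 1 / sqrt (2 * pi)" "1 / sqrt (2 * pi) * (1 - \<epsilon>\<^sup>2 / 2) \<le> I / (2 * \<epsilon>)"
    using assms by (simp_all add: pos_divide_le_eq pos_le_divide_eq mult_ac)
  moreover have "1 / sqrt (2 * pi) * (\<epsilon>\<^sup>2 / 2) \<le> 1 * \<epsilon>\<^sup>2"
    using pi_gt3 by (intro mult_mono) auto
  ultimately show ?thesis by (simp add: algebra_simps)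
qed

section \<open>Occupation measures of the random wave\<close>

lemma representatives_split:
  assumes "representatives E (R :: (real ^ 'n::finite) set)"
  shows "R \<union> uminus ` R = frequencies E" "R \<inter> uminus ` R = {}"
proof -
  have sub: "R \<subseteq> frequencies E" and ch: "\<And>l. l \<in> frequencies E \<Longrightarrow> l \<in> R \<longleftrightarrow> - l \<notin> R"
    using assms by (auto simp: representatives_def)
  have "uminus ` R \<subseteq> frequencies E" using sub uminus_frequencies[of E] by blast
  moreover have "l \<in> R \<union> uminus ` R" if "l \<in> frequencies E" for l
  proof (cases "l \<in> R")
    case False
    then have "- l \<in> R" using ch[OF that] by simp
    then show ?thesis using image_eqI[of l uminus "- l" R] by simp
  qed simp
  ultimately show "R \<union> uminus ` R = frequencies E" using sub by blast
  show "R \<inter> uminus ` R = {}" using sub ch by auto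
qed

lemma finite_representatives:
  assumes "representatives E (R :: (real ^ 'n::finite) set)"
  shows "finite R"
  using assms finite_subset[OF _ finite_frequencies[of E]] by (auto simp: representatives_def)

lemma sum_representatives:
  fixes g :: "real ^ 'n::finite \<Rightarrow> real"
  assumes "representatives E R" and even: "\<And>l. g (- l) = g l"
  shows "(\<Sum>l\<in>frequencies E. g l) = 2 * (\<Sum>l\<in>R. g l)"
proof -
  have fin: "finite R" by (rule finite_representatives) fact
  have "(\<Sum>l\<in>frequencies E. g l) = (\<Sum>l\<in>R. g l) + (\<Sum>l\<in>uminus ` R. g l)"
    unfolding representatives_split(1)[OF assms(1), symmetric]
    using fin representatives_split(2)[OF assms(1)] by (intro sum.union_disjoint) auto
  also have "(\<Sum>l\<in>uminus ` R. g l) = (\<Sum>l\<in>R. g l)"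
    by (subst sum.reindex) (auto simp: inj_on_def even)
  finally show ?thesis by simp
qed

text \<open>Coordinates of the evaluation at \<open>x\<close> with respect to the independent family
  \<open>case_sum b c\<close> on \<open>R <+> R\<close>; they exhibit the wave as a Gaussian linear
  form.\<close>

definition wave_coeff :: "nat \<Rightarrow> real ^ 'n::finite \<Rightarrow> (real ^ 'n) + (real ^ 'n) \<Rightarrow> real" where
  "wave_coeff E x = (\<lambda>i. sqrt (2 / real (freq_count TYPE('n) E)) *
     (case i of Inl l \<Rightarrow> cos (2 * pi * (l \<bullet> x)) | Inr l \<Rightarrow> - sin (2 * pi * (l \<bullet> x))))"

text \<open>The addition formula for the cosine merges the two halves; the sum over representatives
  is half the sum over all frequencies, which the factor \<open>2 / N\<close> compensates.\<close>

lemma sum_wave_coeff: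
  fixes x y :: "real ^ 'n::finite"
  assumes R: "representatives E R"
  shows "(\<Sum>i\<in>R <+> R. wave_coeff E x i * wave_coeff E y i) = covariance E x y"
proof -
  define N where "N = real (freq_count TYPE('n) E)"
  have sq: "sqrt (2 / N) * sqrt (2 / N) = 2 / N" by (simp add: N_def)
  have "(\<Sum>i\<in>R <+> R. wave_coeff E x i * wave_coeff E y i)
      = (\<Sum>l\<in>R. (2 / N) * (cos (2 * pi * (l \<bullet> x)) * cos (2 * pi * (l \<bullet> y)))) + (\<Sum>l\<in>R. (2 / N) * (sin (2 * pi * (l \<bullet> x)) * sin (2 * pi * (l \<bullet> y))))"
  proof -
    have mm: "(sqrt (2 / N) * u) * (sqrt (2 / N) * v) = (2 / N) * (u * v)" for u v
    proof -
      have "(r * u) * (r * v) = (r * r) * (u * v)" for r :: real by (simp only: mult_ac)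
      then show ?thesis by (simp only: sq)
    qed
    show ?thesis using finite_representatives[OF R]
      by (simp only: sum.Plus wave_coeff_def N_def[symmetric] mm sum.case) simp
  qed
  also have "\<dots> = (2 / N) * (\<Sum>l\<in>R. cos (2 * pi * (l \<bullet> (x - y))))"
    by (simp add: sum_distrib_left cos_diff inner_diff_right right_diff_distrib sum.distrib[symmetric] distrib_left)
  also have "\<dots> = (2 * (\<Sum>l\<in>R. cos (2 * pi * (l \<bullet> (x - y))))) / N" by simp
  also have "2 * (\<Sum>l\<in>R. cos (2 * pi * (l \<bullet> (x - y)))) = (\<Sum>l\<in>frequencies E. cos (2 * pi * (l \<bullet> (x - y))))"
    by (rule sum_representatives[OF R, symmetric]) simp
  finally show ?thesis by (simp add: covariance_def N_def)
qed

lemma covariance_diagonal: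
  fixes x :: "real ^ 'n::finite"
  assumes "freq_count TYPE('n) E > 0"
  shows "covariance E x x = 1"
  using assms by (simp add: covariance_def freq_count_def)

lemma eigenfunction_eq_sum:
  assumes "finite R"
  shows "eigenfunction E R (\<lambda>l. b l w) (\<lambda>l. c l w) x = (\<Sum>i\<in>R <+> R. wave_coeff E x i * case_sum b c i w)"
  using assms by (simp add: eigenfunction_def sum.Plus wave_coeff_def sum_distrib_left sum.distrib[symmetric] algebra_simps)

lemma torus_ident_measurable: "(\<lambda>x. x) \<in> borel_measurable torus"
  by (rule borel_measurable_torus) simp

locale random_wave = prob_space M
  for M :: "'w measure" and E :: nat and R :: "(real ^ 'n::finite) set" and b c :: "real ^ 'n \<Rightarrow> 'w \<Rightarrow> real" +
  assumes dim: "CARD('n) \<ge> 2" and E_pos: "E > 0" and N_pos: "freq_count TYPE('n) E > 0"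
    and reps: "representatives E R" and coeffs: "gaussian_coefficients M R b c"
begin

definition wave :: "real ^ 'n \<Rightarrow> 'w \<Rightarrow> real" where
  "wave x w = eigenfunction E R (\<lambda>l. b l w) (\<lambda>l. c l w) x"

definition strip :: "real \<Rightarrow> real ^ 'n \<Rightarrow> 'w \<Rightarrow> real" where
  "strip \<epsilon> x w = indicator {-\<epsilon><..<\<epsilon>} (wave x w)"

text \<open>The approximation \<open>L\<^sub>\<epsilon>\<close> to the Leray measure.\<close>

definition occ :: "real \<Rightarrow> 'w \<Rightarrow> real" where
  "occ \<epsilon> w = (\<integral>x. strip \<epsilon> x w \<partial>torus) / (2 * \<epsilon>)"

lemma finite_R: "finite R" by (rule finite_representatives[OF reps])

lemma gauss: "i \<in> R <+> R \<Longrightarrow> distributed M lborel (case_sum b c i) std_normal_density"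
  using coeffs by (auto simp: gaussian_coefficients_def)

lemma indep: "indep_vars (\<lambda>_. borel) (case_sum b c) (R <+> R)"
  using coeffs by (auto simp: gaussian_coefficients_def)

lemma measurable_coeff: "i \<in> R <+> R \<Longrightarrow> case_sum b c i \<in> borel_measurable M"
  using distributed_measurable[OF gauss] by simp

lemma wave_sum: "wave x w = (\<Sum>i\<in>R <+> R. wave_coeff E x i * case_sum b c i w)"
  unfolding wave_def by (rule eigenfunction_eq_sum[OF finite_R])

lemma measurable_wave:
  assumes X: "X \<in> borel_measurable N" and W: "W \<in> measurable N M"
  shows "(\<lambda>z. wave (X z) (W z)) \<in> borel_measurable N"
  unfolding wave_sum
proof (rule borel_measurable_sum)
  fix i assume i: "i \<in> R <+> R"
  have "continuous_on UNIV (\<lambda>x :: real ^ 'n. wave_coeff E x i)"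
    unfolding wave_coeff_def by (cases i) (auto intro!: continuous_intros)
  then have "(\<lambda>z. wave_coeff E (X z) i) \<in> borel_measurable N"
    using measurable_compose[OF X borel_measurable_continuous_onI] by blast
  moreover have "(\<lambda>z. case_sum b c i (W z)) \<in> borel_measurable N"
    by (rule measurable_compose[OF W measurable_coeff[OF i]])
  ultimately show "(\<lambda>z. wave_coeff E (X z) i * case_sum b c i (W z)) \<in> borel_measurable N"
    by (rule borel_measurable_times)
qed

lemma measurable_strip:
  assumes X: "X \<in> borel_measurable N" and W: "W \<in> measurable N M"
  shows "(\<lambda>z. strip \<epsilon> (X z) (W z)) \<in> borel_measurable N"
  unfolding strip_def by (rule measurable_compose[OF measurable_wave[OF X W]]) simp

lemma strip_bounds: "0 \<le> strip \<epsilon> x w" "strip \<epsilon> x w \<le> 1"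
  by (simp_all add: strip_def)

lemma strip_pair_expectation:
  "expectation (\<lambda>w. strip \<epsilon> x w * strip \<delta> y w)
    = (\<integral>z. indicator {-\<epsilon><..<\<epsilon>} (fst z) * (indicator {-\<delta><..<\<delta>} (covariance E x y * fst z + sqrt (1 - (covariance E x y)\<^sup>2) * snd z) :: real) \<partial>gauss2)"
proof -
  have "(\<Sum>i\<in>R <+> R. (wave_coeff E x i)\<^sup>2) = 1" for x
    using sum_wave_coeff[OF reps, of x x] covariance_diagonal[OF N_pos] by (simp add: power2_eq_square)
  then show ?thesis unfolding strip_def wave_sum
    by (intro gaussian_pair_law[OF prob_space_axioms _ indep gauss]) (auto simp: finite_R sum_wave_coeff[OF reps])
qed

lemma strip_expectation:
  "expectation (\<lambda>w. strip \<epsilon> x w) = (\<integral>z. indicator {-\<epsilon><..<\<epsilon>} (fst z) \<partial>gauss2)"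
proof -
  have "(\<Sum>i\<in>R <+> R. (wave_coeff E x i)\<^sup>2) = 1" for x
    using sum_wave_coeff[OF reps, of x x] covariance_diagonal[OF N_pos] by (simp add: power2_eq_square)
  \<comment> \<open>The one-point law is read off from the pair law with both points equal to
    \<open>x\<close> and no condition on the second value.\<close>
  then have "(\<integral>w. indicator {-\<epsilon><..<\<epsilon>} (\<Sum>i\<in>R <+> R. wave_coeff E x i * case_sum b c i w) * indicator UNIV (\<Sum>i\<in>R <+> R. wave_coeff E x i * case_sum b c i w) \<partial>M)
    = (\<integral>z. indicator {-\<epsilon><..<\<epsilon>} (fst z) * (indicator UNIV (covariance E x x * fst z + sqrt (1 - (covariance E x x)\<^sup>2) * snd z) :: real) \<partial>gauss2)"
    by (intro gaussian_pair_law[OF prob_space_axioms _ indep gauss]) (auto simp: finite_R sum_wave_coeff[OF reps])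
  then show ?thesis by (simp add: strip_def wave_sum)
qed

lemma borel_measurable_occ: "occ \<epsilon> \<in> borel_measurable M"
proof -
  have "(\<lambda>w. \<integral>x. strip \<epsilon> x w \<partial>torus) \<in> borel_measurable M"
    by (rule torus.borel_measurable_lebesgue_integral)
       (unfold case_prod_unfold, intro measurable_strip measurable_compose[OF measurable_snd torus_ident_measurable] measurable_fst)
  then show ?thesis unfolding occ_def by (intro borel_measurable_divide) auto
qed

lemma integrable_strip: "integrable torus (\<lambda>x. strip \<epsilon> x w)" if "w \<in> space M"
  by (rule torus.integrable_const_bound[of _ 1])
     (use strip_bounds that in \<open>auto simp: abs_of_nonneg intro!: measurable_strip borel_measurable_torus\<close>)

lemma occ_nonneg: "\<epsilon> > 0 \<Longrightarrow> 0 \<le> occ \<epsilon> w"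
  unfolding occ_def using strip_bounds by (intro divide_nonneg_pos Bochner_Integration.integral_nonneg) auto

lemma occ_le: "\<epsilon> > 0 \<Longrightarrow> w \<in> space M \<Longrightarrow> occ \<epsilon> w \<le> 1 / (2 * \<epsilon>)"
proof -
  assume e: "\<epsilon> > 0" and w: "w \<in> space M"
  have "(\<integral>x. strip \<epsilon> x w \<partial>torus) \<le> (\<integral>x. 1 \<partial>(torus :: (real ^ 'n) measure))"
    by (intro integral_mono integrable_strip w) (auto simp: strip_bounds)
  then show ?thesis using e by (simp add: occ_def torus.prob_space divide_right_mono)
qed

lemma expectation_occ:
  assumes \<epsilon>: "\<epsilon> > 0"
  shows "\<bar>expectation (occ \<epsilon>) - 1 / sqrt (2 * pi)\<bar> \<le> \<epsilon>\<^sup>2"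
proof -
  interpret P: pair_prob_space "torus :: (real ^ 'n) measure" M ..
  have "(\<lambda>p. strip \<epsilon> (fst p) (snd p)) \<in> borel_measurable (torus \<Otimes>\<^sub>M M)"
    by (intro measurable_strip measurable_compose[OF measurable_fst torus_ident_measurable] measurable_snd)
  then have int: "integrable (torus \<Otimes>\<^sub>M M) (\<lambda>(x, w). strip \<epsilon> x w)"
    unfolding case_prod_unfold by (rule P.integrable_const_bound[of _ 1, rotated]) (simp add: strip_bounds abs_of_nonneg)
  have "expectation (\<lambda>w. \<integral>x. strip \<epsilon> x w \<partial>torus) = (\<integral>x. expectation (\<lambda>w. strip \<epsilon> x w) \<partial>torus)"
    by (rule P.Fubini_integral[OF int])
  also have "\<dots> = (\<integral>z. indicator {-\<epsilon><..<\<epsilon>} (fst z) \<partial>gauss2)"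
    unfolding strip_expectation by (simp add: torus.prob_space)
  finally have "expectation (occ \<epsilon>) = (\<integral>z. indicator {-\<epsilon><..<\<epsilon>} (fst z) \<partial>gauss2) / (2 * \<epsilon>)"
    unfolding occ_def by simp
  then show ?thesis using gauss2_strip_marginal[OF \<epsilon>] by simp
qed

text \<open>Fubini twice: the product of two torus integrals becomes a double integral, then the
  expectation moves inside. The integration over \<open>x\<close> is innermost, as in
  \<open>mutual_energy\<close>.\<close>

lemma expectation_occ_mult:
  "expectation (\<lambda>w. occ \<epsilon> w * occ \<delta> w)
    = (\<integral>y. (\<integral>x. expectation (\<lambda>w. strip \<epsilon> x w * strip \<delta> y w) / (4 * \<epsilon> * \<delta>) \<partial>torus) \<partial>torus)"
proof -
  let ?T = "torus :: (real ^ 'n) measure"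
  interpret TT: pair_prob_space ?T ?T ..
  interpret P: pair_prob_space "?T \<Otimes>\<^sub>M ?T" M ..
  have m1: "(\<lambda>p. fst (fst p)) \<in> borel_measurable ((?T \<Otimes>\<^sub>M ?T) \<Otimes>\<^sub>M M)" "(\<lambda>p. snd (fst p)) \<in> borel_measurable ((?T \<Otimes>\<^sub>M ?T) \<Otimes>\<^sub>M M)"
    by (rule measurable_compose[OF measurable_compose[OF measurable_fst measurable_fst] torus_ident_measurable]
          measurable_compose[OF measurable_compose[OF measurable_fst measurable_snd] torus_ident_measurable])+
  have m2: "fst \<in> borel_measurable (?T \<Otimes>\<^sub>M ?T)" "snd \<in> borel_measurable (?T \<Otimes>\<^sub>M ?T)"
    by (rule measurable_compose[OF measurable_fst torus_ident_measurable] measurable_compose[OF measurable_snd torus_ident_measurable])+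
  have bd: "\<bar>strip \<epsilon> x w * strip \<delta> y w\<bar> \<le> 1" for x y w
    using strip_bounds[of \<epsilon> x w] strip_bounds[of \<delta> y w] by (simp add: abs_mult mult_le_one)
  have "(\<lambda>z. strip \<epsilon> (fst (fst z)) (snd z) * strip \<delta> (snd (fst z)) (snd z)) \<in> borel_measurable ((?T \<Otimes>\<^sub>M ?T) \<Otimes>\<^sub>M M)"
    by (intro borel_measurable_times measurable_strip m1 measurable_snd)
  then have int: "integrable ((?T \<Otimes>\<^sub>M ?T) \<Otimes>\<^sub>M M) (\<lambda>(p, w). strip \<epsilon> (fst p) w * strip \<delta> (snd p) w)"
    unfolding case_prod_unfold by (rule P.integrable_const_bound[of _ 1, rotated]) (simp add: bd)
  have prod: "(\<integral>x. strip \<epsilon> x w \<partial>?T) * (\<integral>y. strip \<delta> y w \<partial>?T) = (\<integral>p. strip \<epsilon> (fst p) w * strip \<delta> (snd p) w \<partial>(?T \<Otimes>\<^sub>M ?T))"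
    if w: "w \<in> space M" for w
  proof -
    have "integrable (?T \<Otimes>\<^sub>M ?T) (\<lambda>p. strip \<epsilon> (fst p) w * strip \<delta> (snd p) w)"
      by (rule TT.integrable_const_bound[of _ 1])
         (use bd w in \<open>auto intro!: borel_measurable_times measurable_strip m2\<close>)
    from TT.integral_fst'[OF this] show ?thesis by simp
  qed
  have "expectation (\<lambda>w. (\<integral>x. strip \<epsilon> x w \<partial>?T) * (\<integral>y. strip \<delta> y w \<partial>?T))
      = expectation (\<lambda>w. \<integral>p. strip \<epsilon> (fst p) w * strip \<delta> (snd p) w \<partial>(?T \<Otimes>\<^sub>M ?T))"
    by (intro Bochner_Integration.integral_cong refl prod)
  also have "\<dots> = (\<integral>p. expectation (\<lambda>w. strip \<epsilon> (fst p) w * strip \<delta> (snd p) w) \<partial>(?T \<Otimes>\<^sub>M ?T))"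
    by (rule P.Fubini_integral[OF int])
  also have "\<dots> = (\<integral>y. (\<integral>x. expectation (\<lambda>w. strip \<epsilon> x w * strip \<delta> y w) \<partial>?T) \<partial>?T)"
  proof -
    have "integrable (?T \<Otimes>\<^sub>M ?T) (\<lambda>p. expectation (\<lambda>w. strip \<epsilon> (fst p) w * strip \<delta> (snd p) w))"
      using P.integrable_fst'[OF int] by simp
    then have "integrable (?T \<Otimes>\<^sub>M ?T) (\<lambda>(x, y). expectation (\<lambda>w. strip \<epsilon> x w * strip \<delta> y w))"
      by (simp add: case_prod_unfold)
    from TT.integral_snd[OF this] show ?thesis by (simp add: case_prod_unfold)
  qed
  finally have "expectation (\<lambda>w. (\<integral>x. strip \<epsilon> x w \<partial>?T) * (\<integral>y. strip \<delta> y w \<partial>?T)) / (4 * \<epsilon> * \<delta>)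
     = (\<integral>y. (\<integral>x. expectation (\<lambda>w. strip \<epsilon> x w * strip \<delta> y w) \<partial>?T) \<partial>?T) / (4 * \<epsilon> * \<delta>)" by simp
  then show ?thesis unfolding occ_def by (simp add: mult_ac)
qed

end

section \<open>Almost sure convergence and the variance\<close>

lemma (in prob_space) expectation_abs_le_sqrt:
  fixes D :: "'a \<Rightarrow> real"
  assumes "integrable M D" "integrable M (\<lambda>w. (D w)\<^sup>2)"
  shows "expectation (\<lambda>w. \<bar>D w\<bar>) \<le> sqrt (expectation (\<lambda>w. (D w)\<^sup>2))"
proof (rule real_le_rsqrt)
  have "0 \<le> variance (\<lambda>w. \<bar>D w\<bar>)" by (rule variance_positive)
  also have "\<dots> = expectation (\<lambda>w. \<bar>D w\<bar>\<^sup>2) - (expectation (\<lambda>w. \<bar>D w\<bar>))\<^sup>2"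
    using assms by (intro variance_eq) auto
  finally show "(expectation (\<lambda>w. \<bar>D w\<bar>))\<^sup>2 \<le> expectation (\<lambda>w. (D w)\<^sup>2)" by simp
qed

text \<open>Summability of the root mean square increments gives almost sure convergence; Fatou's
  lemma then transfers the Cauchy estimate to the limit, and the first two moments pass to the
  limit. \<open>Y\<close> is tied to the sequence only where it converges, so its values on the
  exceptional set do not matter.\<close>

lemma (in prob_space) L2_Cauchy_limit:
  fixes X :: "nat \<Rightarrow> 'a \<Rightarrow> real" and Y :: "'a \<Rightarrow> real"
  assumes X [measurable]: "\<And>n. X n \<in> borel_measurable M" and Y [measurable]: "Y \<in> borel_measurable M"
    and bd: "\<And>n w. w \<in> space M \<Longrightarrow> \<bar>X n w\<bar> \<le> K n"
    and cauchy: "\<And>n m. n \<le> m \<Longrightarrow> expectation (\<lambda>w. (X m w - X n w)\<^sup>2) \<le> r n"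
    and r: "\<And>n. r n > 0" "summable (\<lambda>n. sqrt (r n))"
    and lim: "\<And>w. w \<in> space M \<Longrightarrow> convergent (\<lambda>n. X n w) \<Longrightarrow> (\<lambda>n. X n w) \<longlonglongrightarrow> Y w"
    and \<mu>: "(\<lambda>n. expectation (X n)) \<longlonglongrightarrow> \<mu>" and A: "(\<lambda>n. expectation (\<lambda>w. (X n w)\<^sup>2)) \<longlonglongrightarrow> A"
  shows "variance Y = A - \<mu>\<^sup>2"
proof -
  have K0: "K n \<ge> 0" for n using bd[of _ n] not_empty by (meson abs_ge_zero equals0I order_trans)
  have iX: "integrable M (X n)" for n by (rule integrable_const_bound[of _ "K n"]) (use bd in auto)
  have bd2: "\<bar>X m w - X n w\<bar> \<le> K m + K n" if "w \<in> space M" for m n w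
    using bd[OF that, of m] bd[OF that, of n] by linarith
  have iX2: "integrable M (\<lambda>w. (X n w)\<^sup>2)" for n
    by (rule integrable_const_bound[of _ "(K n)\<^sup>2"]) (use bd K0 in \<open>auto simp: abs_le_square_iff[symmetric]\<close>)
  have iD: "integrable M (\<lambda>w. X m w - X n w)" for m n using iX by simp
  have iD2: "integrable M (\<lambda>w. (X m w - X n w)\<^sup>2)" for m n
    by (rule integrable_const_bound[of _ "(K m + K n)\<^sup>2"]) (use bd2 K0 in \<open>auto simp: abs_le_square_iff[symmetric] add_nonneg_nonneg\<close>)
  have step: "(\<integral>\<^sup>+w. ennreal \<bar>X (Suc n) w - X n w\<bar> \<partial>M) \<le> ennreal (sqrt (r n))" for n
  proof -
    have "(\<integral>\<^sup>+w. ennreal \<bar>X (Suc n) w - X n w\<bar> \<partial>M) = ennreal (expectation (\<lambda>w. \<bar>X (Suc n) w - X n w\<bar>))"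
      using iD by (intro nn_integral_eq_integral) auto
    also have "\<dots> \<le> ennreal (sqrt (r n))"
      by (intro ennreal_leI order_trans[OF expectation_abs_le_sqrt[OF iD iD2]] real_sqrt_le_mono cauchy) simp
    finally show ?thesis .
  qed
  have "(\<integral>\<^sup>+w. (\<Sum>n. ennreal \<bar>X (Suc n) w - X n w\<bar>) \<partial>M) = (\<Sum>n. \<integral>\<^sup>+w. ennreal \<bar>X (Suc n) w - X n w\<bar> \<partial>M)"
    by (rule nn_integral_suminf) simp
  also have "\<dots> \<le> (\<Sum>n. ennreal (sqrt (r n)))" by (intro suminf_le step) auto
  also have "\<dots> = ennreal (\<Sum>n. sqrt (r n))" using r by (intro suminf_ennreal2) (auto intro: less_imp_le)
  also have "\<dots> < \<infinity>" by simp
  finally have "(\<integral>\<^sup>+w. (\<Sum>n. ennreal \<bar>X (Suc n) w - X n w\<bar>) \<partial>M) \<noteq> \<infinity>" by simp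
  then have "AE w in M. (\<Sum>n. ennreal \<bar>X (Suc n) w - X n w\<bar>) \<noteq> \<infinity>"
    by (intro nn_integral_noteq_infinite) auto
  then have conv: "AE w in M. (\<lambda>n. X n w) \<longlonglongrightarrow> Y w"
    using AE_space
  proof eventually_elim
    case (elim w)
    have "summable (\<lambda>n. \<bar>X (Suc n) w - X n w\<bar>)"
      by (rule summable_suminf_not_top) (use elim in auto)
    then have "summable (\<lambda>n. X (Suc n) w - X n w)" by (rule summable_rabs_cancel)
    then have "convergent (\<lambda>n. \<Sum>i<n. X (Suc i) w - X i w)" by (simp add: summable_iff_convergent)
    moreover have "(\<Sum>i<n. X (Suc i) w - X i w) = X n w - X 0 w" for n
      by (rule sum_lessThan_telescope)
    ultimately have "convergent (\<lambda>n. X n w - X 0 w)" by simp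
    then have "convergent (\<lambda>n. (X n w - X 0 w) + X 0 w)" by (rule convergent_add) (rule convergent_const)
    then show ?case using lim elim by simp
  qed
  have fatou: "(\<integral>\<^sup>+w. ennreal ((Y w - X n w)\<^sup>2) \<partial>M) \<le> ennreal (r n)" for n
  proof -
    have "(\<integral>\<^sup>+w. ennreal ((Y w - X n w)\<^sup>2) \<partial>M) = (\<integral>\<^sup>+w. liminf (\<lambda>m. ennreal ((X m w - X n w)\<^sup>2)) \<partial>M)"
    proof (rule nn_integral_cong_AE)
      show "AE w in M. ennreal ((Y w - X n w)\<^sup>2) = liminf (\<lambda>m. ennreal ((X m w - X n w)\<^sup>2))"
        using conv
      proof eventually_elim
        case (elim w)
        have "(\<lambda>m. ennreal ((X m w - X n w)\<^sup>2)) \<longlonglongrightarrow> ennreal ((Y w - X n w)\<^sup>2)"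
          by (intro tendsto_ennrealI tendsto_intros elim)
        then show ?case by (rule lim_imp_Liminf[OF trivial_limit_sequentially, symmetric])
      qed
    qed
    also have "\<dots> \<le> liminf (\<lambda>m. \<integral>\<^sup>+w. ennreal ((X m w - X n w)\<^sup>2) \<partial>M)"
      by (rule nn_integral_liminf) simp
    also have "\<dots> \<le> ennreal (r n)"
    proof (rule Liminf_le)
      show "eventually (\<lambda>m. (\<integral>\<^sup>+w. ennreal ((X m w - X n w)\<^sup>2) \<partial>M) \<le> ennreal (r n)) sequentially"
        using eventually_ge_at_top[of n]
      proof eventually_elim
        case (elim m)
        have "(\<integral>\<^sup>+w. ennreal ((X m w - X n w)\<^sup>2) \<partial>M) = ennreal (expectation (\<lambda>w. (X m w - X n w)\<^sup>2))"
          using iD2 by (intro nn_integral_eq_integral) auto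
        also have "\<dots> \<le> ennreal (r n)" by (intro ennreal_leI cauchy elim)
        finally show ?case .
      qed
    qed simp
    finally show ?thesis .
  qed
  have iE2: "integrable M (\<lambda>w. (Y w - X n w)\<^sup>2)" for n
  proof (rule integrableI_bounded)
    have "(\<integral>\<^sup>+w. ennreal (norm ((Y w - X n w)\<^sup>2)) \<partial>M) \<le> ennreal (r n)" using fatou[of n] by simp
    also have "\<dots> < \<infinity>" by simp
    finally show "(\<integral>\<^sup>+w. ennreal (norm ((Y w - X n w)\<^sup>2)) \<partial>M) < \<infinity>" .
  qed simp
  have E2: "expectation (\<lambda>w. (Y w - X n w)\<^sup>2) \<le> r n" for n
  proof -
    have "ennreal (expectation (\<lambda>w. (Y w - X n w)\<^sup>2)) \<le> ennreal (r n)"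
      using fatou[of n] by (subst nn_integral_eq_integral[symmetric]) (auto simp: iE2)
    then show ?thesis using r(1)[of n] by (subst (asm) ennreal_le_iff) auto
  qed
  have iE: "integrable M (\<lambda>w. Y w - X n w)" for n
    by (rule square_integrable_imp_integrable[OF _ iE2]) simp
  have iY: "integrable M Y"
    using Bochner_Integration.integrable_add[OF iE[of 0] iX[of 0]] by simp
  have iY2: "integrable M (\<lambda>w. (Y w)\<^sup>2)"
  proof (rule Bochner_Integration.integrable_bound)
    show "integrable M (\<lambda>w. 2 * (Y w - X 0 w)\<^sup>2 + 2 * (X 0 w)\<^sup>2)" using iE2 iX2 by simp
    have "(Y w)\<^sup>2 \<le> 2 * (Y w - X 0 w)\<^sup>2 + 2 * (X 0 w)\<^sup>2" for w
      using zero_le_power2[of "Y w - 2 * X 0 w"] by (simp add: power2_eq_square algebra_simps)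
    then show "AE w in M. norm ((Y w)\<^sup>2) \<le> norm (2 * (Y w - X 0 w)\<^sup>2 + 2 * (X 0 w)\<^sup>2)" by simp
  qed simp
  have r0: "(\<lambda>n. sqrt (r n)) \<longlonglongrightarrow> 0" by (rule summable_LIMSEQ_zero[OF r(2)])
  have EY: "expectation Y = \<mu>"
  proof (rule LIMSEQ_unique)
    have "(\<lambda>n. expectation Y - expectation (X n)) \<longlonglongrightarrow> 0"
    proof (rule Lim_null_comparison[OF always_eventually r0], rule allI)
      fix n
      have "\<bar>expectation Y - expectation (X n)\<bar> = \<bar>expectation (\<lambda>w. Y w - X n w)\<bar>" using iY iX by simp
      also have "\<dots> \<le> expectation (\<lambda>w. \<bar>Y w - X n w\<bar>)" by (rule integral_abs_bound)
      also have "\<dots> \<le> sqrt (r n)"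
        by (intro order_trans[OF expectation_abs_le_sqrt[OF iE iE2]] real_sqrt_le_mono E2)
      finally show "norm (expectation Y - expectation (X n)) \<le> sqrt (r n)" by simp
    qed
    then have "(\<lambda>n. expectation Y - (expectation Y - expectation (X n))) \<longlonglongrightarrow> expectation Y - 0"
      by (intro tendsto_intros)
    then show "(\<lambda>n. expectation (X n)) \<longlonglongrightarrow> expectation Y" by simp
  qed (rule \<mu>)
  have EY2: "expectation (\<lambda>w. (Y w)\<^sup>2) = A"
  proof (rule LIMSEQ_unique)
    obtain B where B: "\<And>n. \<bar>expectation (\<lambda>w. (X n w)\<^sup>2)\<bar> \<le> B"
      using convergent_imp_Bseq[OF convergentI[OF A]] by (auto simp: Bseq_def)
    have "(\<lambda>n. expectation (\<lambda>w. (Y w)\<^sup>2) - expectation (\<lambda>w. (X n w)\<^sup>2)) \<longlonglongrightarrow> 0"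
    proof (rule Lim_null_comparison[OF always_eventually], rule allI)
      fix n
      \<comment> \<open>Weight for the inequality between \<open>2 * X * (Y - X)\<close> and the
        squares: with \<open>t\<^sup>2 = r n\<close> both \<open>t * X\<^sup>2\<close> and
        \<open>(Y - X)\<^sup>2 / t\<close> have expectation of order \<open>t\<close>.\<close>
      define t where "t = sqrt (r n)"
      have t: "t > 0" "t * t = r n" using r(1)[of n] by (simp_all add: t_def)
      have "\<bar>(Y w)\<^sup>2 - (X n w)\<^sup>2\<bar> \<le> t * (X n w)\<^sup>2 + (1 + 1 / t) * (Y w - X n w)\<^sup>2" for w
      proof -
        have "0 \<le> (t * X n w - (Y w - X n w))\<^sup>2 / t" "0 \<le> (t * X n w + (Y w - X n w))\<^sup>2 / t" using t by auto
        then have "\<bar>2 * X n w * (Y w - X n w)\<bar> \<le> t * (X n w)\<^sup>2 + (Y w - X n w)\<^sup>2 / t"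
          using t(1) by (simp add: power2_eq_square abs_le_iff field_simps)
        moreover have "(Y w)\<^sup>2 - (X n w)\<^sup>2 = 2 * X n w * (Y w - X n w) + (Y w - X n w)\<^sup>2"
          by (simp add: power2_eq_square algebra_simps)
        moreover have "0 \<le> (Y w - X n w)\<^sup>2" by simp
        moreover have "(1 + 1 / t) * (Y w - X n w)\<^sup>2 = (Y w - X n w)\<^sup>2 + (Y w - X n w)\<^sup>2 / t" by (simp add: algebra_simps)
        ultimately show ?thesis by linarith
      qed
      then have "expectation (\<lambda>w. \<bar>(Y w)\<^sup>2 - (X n w)\<^sup>2\<bar>) \<le> expectation (\<lambda>w. t * (X n w)\<^sup>2 + (1 + 1 / t) * (Y w - X n w)\<^sup>2)"
        using iY2 iX2 iE2 by (intro integral_mono) auto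
      also have "\<dots> = t * expectation (\<lambda>w. (X n w)\<^sup>2) + (1 + 1 / t) * expectation (\<lambda>w. (Y w - X n w)\<^sup>2)"
        using iX2 iE2 by simp
      also have "\<dots> \<le> t * B + (1 + 1 / t) * (t * t)"
        using B[of n] E2[of n] t by (intro add_mono mult_left_mono) auto
      also have "\<dots> = t * (B + 1 + t)" using t by (simp add: field_simps)
      finally have "expectation (\<lambda>w. \<bar>(Y w)\<^sup>2 - (X n w)\<^sup>2\<bar>) \<le> t * (B + 1 + t)" .
      moreover have "\<bar>expectation (\<lambda>w. (Y w)\<^sup>2) - expectation (\<lambda>w. (X n w)\<^sup>2)\<bar> \<le> expectation (\<lambda>w. \<bar>(Y w)\<^sup>2 - (X n w)\<^sup>2\<bar>)"
        using integral_abs_bound[of M "\<lambda>w. (Y w)\<^sup>2 - (X n w)\<^sup>2"] iY2 iX2 by simp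
      ultimately show "norm (expectation (\<lambda>w. (Y w)\<^sup>2) - expectation (\<lambda>w. (X n w)\<^sup>2)) \<le> sqrt (r n) * (B + 1 + sqrt (r n))"
        by (simp add: t_def)
    next
      have "(\<lambda>n. sqrt (r n) * (B + 1 + sqrt (r n))) \<longlonglongrightarrow> 0 * (B + 1 + 0)" by (intro tendsto_intros r0)
      then show "(\<lambda>n. sqrt (r n) * (B + 1 + sqrt (r n))) \<longlonglongrightarrow> 0" by simp
    qed
    then have "(\<lambda>n. expectation (\<lambda>w. (Y w)\<^sup>2) - (expectation (\<lambda>w. (Y w)\<^sup>2) - expectation (\<lambda>w. (X n w)\<^sup>2))) \<longlonglongrightarrow> expectation (\<lambda>w. (Y w)\<^sup>2) - 0"
      by (intro tendsto_intros)
    then show "(\<lambda>n. expectation (\<lambda>w. (X n w)\<^sup>2)) \<longlonglongrightarrow> expectation (\<lambda>w. (Y w)\<^sup>2)" by simp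
  qed (rule A)
  show ?thesis using variance_eq[OF iY iY2] EY EY2 by simp
qed

text \<open>
  The exponent makes the fourth root of \<open>mesh n\<close> summable, while \<open>mesh n / mesh (n + 1)\<close> still tends to \<open>1\<close>, so that
  a monotone function is controlled by its values on the mesh.
\<close>

definition mesh :: "nat \<Rightarrow> real" where
  "mesh n = 1 / (real n + 1) ^ 8"

lemma mesh_pos: "mesh n > 0"
  by (simp add: mesh_def)

lemma mesh_antimono: "n \<le> m \<Longrightarrow> mesh m \<le> mesh n"
  unfolding mesh_def by (intro divide_left_mono power_mono) auto

lemma mesh_tendsto: "mesh \<longlonglongrightarrow> 0"
proof (rule Lim_null_comparison[OF always_eventually LIMSEQ_inverse_real_of_nat], rule allI)
  fix n
  have "real n + 1 \<le> (real n + 1) ^ 8" by (rule self_le_power) auto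
  then show "norm (mesh n) \<le> inverse (real (Suc n))"
    by (simp add: mesh_def inverse_eq_divide add.commute frac_le)
qed

lemma mesh_ratio_tendsto: "(\<lambda>n. mesh n / mesh (Suc n)) \<longlonglongrightarrow> 1"
proof -
  have "mesh n / mesh (Suc n) = (1 + 1 / (real n + 1)) ^ 8" for n
    by (simp add: mesh_def divide_simps)
  moreover have "(\<lambda>n. (1 + 1 / (real n + 1)) ^ 8) \<longlonglongrightarrow> (1 + 0) ^ 8"
    using LIMSEQ_inverse_real_of_nat by (intro tendsto_intros) (simp add: inverse_eq_divide add.commute)
  ultimately show ?thesis by simp
qed

text \<open>For \<open>\<epsilon>\<close> between two neighbouring mesh points, monotonicity puts
  the quotient between its values at these points, up to the ratio of the points, which tends to
  1.\<close>

lemma tendsto_at_right_of_mesh: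
  fixes F :: "real \<Rightarrow> real"
  assumes mono: "\<And>a b. 0 < a \<Longrightarrow> a \<le> b \<Longrightarrow> F a \<le> F b" and nn: "\<And>a. 0 \<le> F a"
    and lim: "(\<lambda>n. F (mesh n) / (2 * mesh n)) \<longlonglongrightarrow> l"
  shows "((\<lambda>\<epsilon>. F \<epsilon> / (2 * \<epsilon>)) \<longlongrightarrow> l) (at_right 0)"
proof (rule tendstoI)
  fix e :: real assume e: "e > 0"
  define q where "q = (\<lambda>n. mesh n / mesh (Suc n))"
  define L where "L = (\<lambda>n. F (mesh n) / (2 * mesh n))"
  have up: "(\<lambda>n. q n * L n) \<longlonglongrightarrow> l"
    using tendsto_mult[OF mesh_ratio_tendsto lim] by (simp add: q_def L_def)
  have lo: "(\<lambda>n. L (Suc n) / q n) \<longlonglongrightarrow> l"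
    using tendsto_divide[OF LIMSEQ_Suc[OF lim] mesh_ratio_tendsto] by (simp add: q_def L_def)
  obtain N where N: "\<And>n. n \<ge> N \<Longrightarrow> dist (q n * L n) l < e" "\<And>n. n \<ge> N \<Longrightarrow> dist (L (Suc n) / q n) l < e"
    using eventually_conj[OF tendstoD[OF up e] tendstoD[OF lo e]] by (auto simp: eventually_sequentially)
  have "dist (F \<epsilon> / (2 * \<epsilon>)) l < e" if \<epsilon>: "0 < \<epsilon>" "\<epsilon> < mesh N" for \<epsilon>
  proof -
    have "eventually (\<lambda>n. mesh n < \<epsilon>) sequentially" using order_tendstoD(2)[OF mesh_tendsto \<epsilon>(1)] .
    then obtain m where "mesh m < \<epsilon>" by (auto simp: eventually_sequentially)
    then have ex: "mesh (Suc m) \<le> \<epsilon>" using mesh_antimono[of m "Suc m"] by linarith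
    \<comment> \<open>The least choice gives the bracket
      \<open>mesh (Suc n) \<le> \<epsilon> \<le> mesh n\<close>.\<close>
    define n where "n = (LEAST n. mesh (Suc n) \<le> \<epsilon>)"
    have n1: "mesh (Suc n) \<le> \<epsilon>" unfolding n_def by (rule LeastI[of _ m]) (rule ex)
    have nN: "n \<ge> N"
    proof (rule ccontr)
      assume "\<not> n \<ge> N"
      then have "mesh N \<le> mesh (Suc n)" by (intro mesh_antimono) auto
      then show False using n1 \<epsilon> by linarith
    qed
    have n2: "\<epsilon> \<le> mesh n"
    proof (cases n)
      case 0
      then show ?thesis using \<epsilon> mesh_antimono[of 0 N] by simp
    next
      case (Suc k)
      then have "\<not> mesh (Suc k) \<le> \<epsilon>" using not_less_Least[of k "\<lambda>n. mesh (Suc n) \<le> \<epsilon>"] by (auto simp: n_def)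
      then show ?thesis using Suc by simp
    qed
    note pos = mesh_pos[of n] mesh_pos[of "Suc n"]
    have "F \<epsilon> / (2 * \<epsilon>) \<le> F (mesh n) / (2 * mesh (Suc n))"
      using mono[OF \<epsilon>(1) n2] nn[of \<epsilon>] n1 pos \<epsilon> by (intro frac_le) auto
    also have "\<dots> = q n * L n" using pos by (simp add: q_def L_def)
    finally have 1: "F \<epsilon> / (2 * \<epsilon>) \<le> q n * L n" .
    have "L (Suc n) / q n = F (mesh (Suc n)) / (2 * mesh n)" using pos by (simp add: q_def L_def)
    also have "\<dots> \<le> F \<epsilon> / (2 * \<epsilon>)"
      using mono[OF pos(2) n1] nn[of "mesh (Suc n)"] n2 pos \<epsilon> by (intro frac_le) auto
    finally have 2: "L (Suc n) / q n \<le> F \<epsilon> / (2 * \<epsilon>)" .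
    show ?thesis using N[OF nN] 1 2 by (simp add: dist_real_def abs_less_iff)
  qed
  then show "eventually (\<lambda>\<epsilon>. dist (F \<epsilon> / (2 * \<epsilon>)) l < e) (at_right 0)"
    unfolding eventually_at_right_field using mesh_pos by blast
qed

text \<open>When there is no limit, \<open>Lim\<close> is the junk value \<open>THE l. False\<close>, which does not depend on \<open>F\<close>; this is what makes the Leray measure measurable.\<close>

lemma Lim_at_right_mesh:
  fixes F :: "real \<Rightarrow> real"
  assumes "\<And>a b. 0 < a \<Longrightarrow> a \<le> b \<Longrightarrow> F a \<le> F b" and "\<And>a. 0 \<le> F a"
  shows "Lim (at_right 0) (\<lambda>\<epsilon>. F \<epsilon> / (2 * \<epsilon>)) =
    (if convergent (\<lambda>n. F (mesh n) / (2 * mesh n)) then lim (\<lambda>n. F (mesh n) / (2 * mesh n)) else (THE l. False))"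
proof (cases "convergent (\<lambda>n. F (mesh n) / (2 * mesh n))")
  case True
  then have "(\<lambda>n. F (mesh n) / (2 * mesh n)) \<longlonglongrightarrow> lim (\<lambda>n. F (mesh n) / (2 * mesh n))"
    by (simp add: convergent_LIMSEQ_iff)
  from tendsto_at_right_of_mesh[OF assms this] show ?thesis
    using True by (simp add: tendsto_Lim)
next
  case False
  have "filterlim mesh (at_right 0) sequentially"
    unfolding filterlim_at by (auto simp: mesh_tendsto mesh_pos mesh_pos[THEN less_imp_neq, symmetric])
  then have "\<not> ((\<lambda>\<epsilon>. F \<epsilon> / (2 * \<epsilon>)) \<longlongrightarrow> l) (at_right 0)" for l
    using False filterlim_compose[of "\<lambda>\<epsilon>. F \<epsilon> / (2 * \<epsilon>)" "nhds l" "at_right 0" mesh sequentially] by (auto simp: convergent_def)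
  then show ?thesis using False by (simp add: t2_space_class.Lim_def)
qed

text \<open>Since \<open>1 / (2 * pi * sqrt (1 - u\<^sup>2))\<close> is the joint density at the
  origin of the values at two points with covariance \<open>u\<close>, dividing by
  \<open>2 * pi\<close> gives the limiting second-moment density at \<open>y\<close>.\<close>

definition mutual_energy :: "nat \<Rightarrow> real ^ 'n::finite \<Rightarrow> real" where
  "mutual_energy E y = (\<integral>x. inverse (sqrt (1 - (covariance E x y)\<^sup>2)) \<partial>torus)"

lemma borel_measurable_mutual_energy: "mutual_energy E \<in> borel_measurable (torus :: (real ^ 'n::finite) measure)"
proof -
  have "(\<lambda>p :: (real ^ 'n) \<times> (real ^ 'n). covariance E (snd p) (fst p)) \<in> borel_measurable (torus \<Otimes>\<^sub>M torus)"
    by (intro borel_measurable_covariance measurable_compose[OF measurable_fst torus_ident_measurable]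
        measurable_compose[OF measurable_snd torus_ident_measurable])
  then have "(\<lambda>p :: (real ^ 'n) \<times> (real ^ 'n). inverse (sqrt (1 - (covariance E (snd p) (fst p))\<^sup>2))) \<in> borel_measurable (torus \<Otimes>\<^sub>M torus)"
    by measurable
  then show ?thesis unfolding mutual_energy_def
    by (intro torus.borel_measurable_lebesgue_integral) (simp add: case_prod_unfold)
qed

context random_wave
begin

text \<open>Finiteness of the integral of the weight makes \<open>\<bar>u\<bar> < 1\<close> almost
  everywhere, where the pointwise Gaussian estimate holds; integrating it costs only the constant
  \<open>C\<close>.\<close>

lemma strip_pair_density:
  assumes \<epsilon>: "\<epsilon> > 0" and \<delta>: "\<delta> > 0"
    and W: "(\<integral>\<^sup>+x. inverse (ennreal ((1 - (covariance E x y)\<^sup>2) powr (3/4))) \<partial>torus) \<le> ennreal C"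
    and G: "integrable torus (\<lambda>x. inverse (sqrt (1 - (covariance E x y)\<^sup>2)))" and C: "C \<ge> 0"
  shows "\<bar>(\<integral>x. expectation (\<lambda>w. strip \<epsilon> x w * strip \<delta> y w) / (4 * \<epsilon> * \<delta>) \<partial>torus) - mutual_energy E y / (2 * pi)\<bar> \<le> C * sqrt (\<epsilon> + \<delta>)"
proof -
  define J where "J = (\<lambda>x. expectation (\<lambda>w. strip \<epsilon> x w * strip \<delta> y w) / (4 * \<epsilon> * \<delta>))"
  define g where "g = (\<lambda>x. inverse (sqrt (1 - (covariance E x y)\<^sup>2)) / (2 * pi))"
  define V where "V = (\<lambda>x. inverse (ennreal ((1 - (covariance E x y)\<^sup>2) powr (3/4))))"
  define k where "k = sqrt (\<epsilon> + \<delta>) / (2 * pi)"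
  have k: "0 \<le> k" "k \<le> sqrt (\<epsilon> + \<delta>)" using \<epsilon> \<delta> pi_gt3 by (auto simp: k_def divide_le_eq)
  have "(\<lambda>p. strip \<epsilon> (fst p) (snd p) * strip \<delta> y (snd p)) \<in> borel_measurable (torus \<Otimes>\<^sub>M M)"
    by (intro borel_measurable_times measurable_strip measurable_compose[OF measurable_fst torus_ident_measurable] measurable_snd borel_measurable_const)
  then have "(\<lambda>x. expectation (\<lambda>w. strip \<epsilon> x w * strip \<delta> y w)) \<in> borel_measurable torus"
    by (intro borel_measurable_lebesgue_integral) (simp add: case_prod_unfold)
  then have Jm: "J \<in> borel_measurable torus" unfolding J_def by simp
  have bd: "\<bar>strip \<epsilon> x w * strip \<delta> y w\<bar> \<le> 1" for x w
    using strip_bounds[of \<epsilon> x w] strip_bounds[of \<delta> y w] by (simp add: abs_mult mult_le_one)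
  have J1: "\<bar>J x\<bar> \<le> 1 / (4 * \<epsilon> * \<delta>)" for x
  proof -
    have "\<bar>expectation (\<lambda>w. strip \<epsilon> x w * strip \<delta> y w)\<bar> \<le> expectation (\<lambda>w. \<bar>strip \<epsilon> x w * strip \<delta> y w\<bar>)"
      by (rule integral_abs_bound)
    also have "\<dots> \<le> expectation (\<lambda>w. 1)"
      by (rule integral_mono') (use bd in auto)
    finally show ?thesis using \<epsilon> \<delta> by (simp add: J_def prob_space abs_divide divide_right_mono)
  qed
  have Ji: "integrable torus J" by (rule torus.integrable_const_bound[of _ "1 / (4 * \<epsilon> * \<delta>)"]) (use J1 Jm in auto)
  have gi: "integrable torus g" unfolding g_def using G by simp
  have "(\<lambda>x. covariance E x y) \<in> borel_measurable torus"
    by (intro borel_measurable_covariance torus_ident_measurable borel_measurable_const)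
  then have Vm [measurable]: "V \<in> borel_measurable torus" unfolding V_def by measurable
  have "AE x in torus. V x \<noteq> \<infinity>"
  proof (rule nn_integral_noteq_infinite)
    have "(\<integral>\<^sup>+x. V x \<partial>torus) < \<infinity>" using W unfolding V_def by (rule order.strict_trans1) simp
    then show "(\<integral>\<^sup>+x. V x \<partial>torus) \<noteq> \<infinity>" by simp
  qed (rule Vm)
  then have ae: "AE x in torus. ennreal \<bar>J x - g x\<bar> \<le> ennreal k * V x"
  proof eventually_elim
    case (elim x)
    define c where "c = covariance E x y"
    have "1 - c\<^sup>2 \<noteq> 0" using elim by (auto simp: V_def c_def)
    moreover have "c\<^sup>2 \<le> 1" using abs_covariance_le[of E x y] by (simp add: c_def abs_square_le_1)
    ultimately have c1: "1 - c\<^sup>2 > 0" by linarith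
    then have "\<bar>c\<bar> < 1" by (simp add: abs_square_less_1)
    from gauss2_strip_density[OF \<epsilon> \<delta> this]
    have "\<bar>J x - g x\<bar> \<le> k * inverse ((1 - c\<^sup>2) powr (3/4))"
      unfolding J_def g_def k_def strip_pair_expectation c_def by simp
    then have "ennreal \<bar>J x - g x\<bar> \<le> ennreal (k * inverse ((1 - c\<^sup>2) powr (3/4)))" by (rule ennreal_leI)
    also have "\<dots> = ennreal k * V x" using k c1 by (simp add: V_def c_def inverse_ennreal ennreal_mult)
    finally show ?case .
  qed
  have "ennreal (\<integral>x. \<bar>J x - g x\<bar> \<partial>torus) = (\<integral>\<^sup>+x. ennreal \<bar>J x - g x\<bar> \<partial>torus)"
    using Ji gi by (intro nn_integral_eq_integral[symmetric]) auto
  also have "\<dots> \<le> (\<integral>\<^sup>+x. ennreal k * V x \<partial>torus)" by (rule nn_integral_mono_AE[OF ae])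
  also have "\<dots> = ennreal k * (\<integral>\<^sup>+x. V x \<partial>torus)" by (rule nn_integral_cmult) (rule Vm)
  also have "\<dots> \<le> ennreal k * ennreal C" using W by (intro mult_left_mono) (auto simp: V_def)
  also have "\<dots> = ennreal (k * C)" using k C by (simp add: ennreal_mult)
  finally have "(\<integral>x. \<bar>J x - g x\<bar> \<partial>torus) \<le> k * C" using k C by (subst (asm) ennreal_le_iff) auto
  also have "\<dots> \<le> C * sqrt (\<epsilon> + \<delta>)" using k C by (subst mult.commute) (intro mult_left_mono)
  finally have "\<bar>\<integral>x. J x - g x \<partial>torus\<bar> \<le> C * sqrt (\<epsilon> + \<delta>)"
    using integral_abs_bound[of torus "\<lambda>x. J x - g x"] by linarith
  moreover have "(\<integral>x. J x - g x \<partial>torus) = (\<integral>x. J x \<partial>torus) - mutual_energy E y / (2 * pi)"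
    using Ji gi by (simp add: g_def mutual_energy_def)
  ultimately show ?thesis by (simp add: J_def)
qed

lemma occ_second_moment:
  assumes \<epsilon>: "\<epsilon> > 0" and \<delta>: "\<delta> > 0" and C: "C \<ge> 0"
    and W: "\<And>y :: real ^ 'n. (\<integral>\<^sup>+x. inverse (ennreal ((1 - (covariance E x y)\<^sup>2) powr (3/4))) \<partial>torus) \<le> ennreal C"
    and G: "\<And>y :: real ^ 'n. integrable torus (\<lambda>x. inverse (sqrt (1 - (covariance E x y)\<^sup>2)))"
    and I: "integrable torus (mutual_energy E :: real ^ 'n \<Rightarrow> real)"
  shows "\<bar>expectation (\<lambda>w. occ \<epsilon> w * occ \<delta> w) - (\<integral>y. mutual_energy E (y :: real ^ 'n) \<partial>torus) / (2 * pi)\<bar> \<le> C * sqrt (\<epsilon> + \<delta>)"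
proof -
  define H where "H = (\<lambda>y. \<integral>x. expectation (\<lambda>w. strip \<epsilon> x w * strip \<delta> y w) / (4 * \<epsilon> * \<delta>) \<partial>torus)"
  define s where "s = C * sqrt (\<epsilon> + \<delta>)"
  have s0: "s \<ge> 0" using C \<epsilon> \<delta> by (simp add: s_def)
  have near: "\<bar>H y - mutual_energy E y / (2 * pi)\<bar> \<le> s" for y
    unfolding H_def s_def by (rule strip_pair_density[OF \<epsilon> \<delta> W G C])
  have "(\<lambda>p. strip \<epsilon> (snd (fst p)) (snd p) * strip \<delta> (fst (fst p)) (snd p)) \<in> borel_measurable ((torus \<Otimes>\<^sub>M torus) \<Otimes>\<^sub>M M)"
    by (intro borel_measurable_times measurable_strip measurable_snd
        measurable_compose[OF measurable_compose[OF measurable_fst measurable_fst] torus_ident_measurable]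
        measurable_compose[OF measurable_compose[OF measurable_fst measurable_snd] torus_ident_measurable])
  then have "(\<lambda>p. expectation (\<lambda>w. strip \<epsilon> (snd p) w * strip \<delta> (fst p) w)) \<in> borel_measurable (torus \<Otimes>\<^sub>M torus)"
    by (intro borel_measurable_lebesgue_integral) (simp add: case_prod_unfold)
  then have "(\<lambda>p. expectation (\<lambda>w. strip \<epsilon> (snd p) w * strip \<delta> (fst p) w) / (4 * \<epsilon> * \<delta>)) \<in> borel_measurable (torus \<Otimes>\<^sub>M torus)"
    by simp
  then have Hm: "H \<in> borel_measurable torus" unfolding H_def
    by (intro torus.borel_measurable_lebesgue_integral) (simp add: case_prod_unfold)
  have Di: "integrable torus (\<lambda>y. H y - mutual_energy E y / (2 * pi))"
  proof (rule torus.integrable_const_bound[of _ s])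
    show "(\<lambda>y. H y - mutual_energy E y / (2 * pi)) \<in> borel_measurable torus"
      by (intro borel_measurable_diff borel_measurable_divide borel_measurable_const Hm borel_measurable_mutual_energy)
  qed (use near in simp)
  have Hi: "integrable torus H"
    using Bochner_Integration.integrable_add[OF Di integrable_divide[OF I, of "2 * pi"]] by simp
  have "\<bar>\<integral>y. H y - mutual_energy E y / (2 * pi) \<partial>torus\<bar> \<le> (\<integral>y. \<bar>H y - mutual_energy E y / (2 * pi)\<bar> \<partial>torus)"
    by (rule integral_abs_bound)
  also have "\<dots> \<le> (\<integral>y. s \<partial>(torus :: (real ^ 'n) measure))"
    using Di near by (intro integral_mono) auto
  also have "\<dots> = s" by (simp add: torus.prob_space)
  finally show ?thesis
    unfolding expectation_occ_mult H_def[symmetric] s_def using Hi I by simp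
qed

text \<open>The volume of the strip is monotone in its width, so for every sample point, exceptional
  ones included, the value of \<open>Lim\<close> is decided along the mesh.\<close>

lemma leray_measure_wave:
  assumes w: "w \<in> space M"
  shows "leray_measure (\<lambda>x. wave x w) =
    (if convergent (\<lambda>n. occ (mesh n) w) then lim (\<lambda>n. occ (mesh n) w) else (THE l. False))"
proof -
  define F where "F = (\<lambda>\<epsilon>. \<integral>x. strip \<epsilon> x w \<partial>(torus :: (real ^ 'n) measure))"
  have eq: "measure lborel {x. (\<forall>i. 0 \<le> x $ i \<and> x $ i < 1) \<and> \<bar>wave x w\<bar> < \<epsilon>} = F \<epsilon>" for \<epsilon>
  proof -
    have "(\<lambda>x. wave x w) \<in> borel_measurable borel"
      by (intro measurable_wave measurable_ident measurable_const w) simp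
    then have m: "{x. (\<forall>i. 0 \<le> x $ i \<and> x $ i < 1) \<and> \<bar>wave x w\<bar> < \<epsilon>} \<in> sets lborel"
      by measurable
    have "F \<epsilon> = (\<integral>x. indicator unit_cube x *\<^sub>R strip \<epsilon> x w \<partial>lborel)" unfolding F_def by (rule integral_torus)
    also have "\<dots> = (\<integral>x. indicator {x. (\<forall>i. 0 \<le> x $ i \<and> x $ i < 1) \<and> \<bar>wave x w\<bar> < \<epsilon>} x \<partial>lborel)"
      by (intro Bochner_Integration.integral_cong) (auto simp: strip_def unit_cube_def indicator_def abs_less_iff)
    also have "\<dots> = measure lborel {x. (\<forall>i. 0 \<le> x $ i \<and> x $ i < 1) \<and> \<bar>wave x w\<bar> < \<epsilon>}" by simp
    finally show ?thesis by simp
  qed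
  have mono: "F a \<le> F b" if "a \<le> b" for a b
    unfolding F_def by (intro integral_mono integrable_strip w) (use that in \<open>auto simp: strip_def split: split_indicator\<close>)
  have nn: "0 \<le> F a" for a unfolding F_def using strip_bounds by (intro Bochner_Integration.integral_nonneg) auto
  have "leray_measure (\<lambda>x. wave x w) = Lim (at_right 0) (\<lambda>\<epsilon>. F \<epsilon> / (2 * \<epsilon>))"
    unfolding leray_measure_def eq by simp
  also have "\<dots> = (if convergent (\<lambda>n. F (mesh n) / (2 * mesh n)) then lim (\<lambda>n. F (mesh n) / (2 * mesh n)) else (THE l. False))"
    by (rule Lim_at_right_mesh) (use mono nn in auto)
  finally show ?thesis by (simp add: occ_def F_def)
qed

text \<open>The set where the mesh values converge is measurable by the Cauchy criterion, the limit
  is measurable on it, and off it the value is constant.\<close>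

lemma borel_measurable_leray: "(\<lambda>w. leray_measure (\<lambda>x. wave x w)) \<in> borel_measurable M"
proof -
  have [measurable]: "occ (mesh n) \<in> borel_measurable M" for n by (rule borel_measurable_occ)
  have "{w \<in> space M. Cauchy (\<lambda>n. occ (mesh n) w)} \<in> sets M" by (rule sets_Collect_Cauchy) measurable
  then have [measurable]: "Measurable.pred M (\<lambda>w. convergent (\<lambda>n. occ (mesh n) w))"
    unfolding Cauchy_convergent_iff pred_def .
  have "(\<lambda>w. if convergent (\<lambda>n. occ (mesh n) w) then lim (\<lambda>n. occ (mesh n) w) else (THE l. False)) \<in> borel_measurable M"
    by measurable
  then show ?thesis by (subst measurable_cong[OF leray_measure_wave])
qed

text \<open>The second moment tends to the energy integral over \<open>2 * pi\<close> and the
  squared mean to \<open>1 / (2 * pi)\<close>; the variance is their difference.\<close>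

theorem variance_leray:
  assumes C: "C > 0"
    and W: "\<And>y :: real ^ 'n. (\<integral>\<^sup>+x. inverse (ennreal ((1 - (covariance E x y)\<^sup>2) powr (3/4))) \<partial>torus) \<le> ennreal C"
    and G: "\<And>y :: real ^ 'n. integrable torus (\<lambda>x. inverse (sqrt (1 - (covariance E x y)\<^sup>2)))"
    and I: "integrable torus (mutual_energy E :: real ^ 'n \<Rightarrow> real)"
  shows "variance (\<lambda>w. leray_measure (\<lambda>x. wave x w)) = ((\<integral>y. mutual_energy E (y :: real ^ 'n) \<partial>torus) - 1) / (2 * pi)"
proof -
  define A where "A = (\<integral>y. mutual_energy E (y :: real ^ 'n) \<partial>torus) / (2 * pi)"
  note second = occ_second_moment[OF _ _ less_imp_le[OF C] W G I, folded A_def]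
  \<comment> \<open>Expanding the squared difference, the three moments are each within
    \<open>C * sqrt (2 * mesh n)\<close> of \<open>A\<close> and enter with weights 1, 2 and 1,
    while the multiples of \<open>A\<close> cancel; four such errors are covered by 8. The root of
    \<open>r n\<close> is a multiple of \<open>1 / (n + 1) ^ 2\<close>.\<close>
  define r where "r = (\<lambda>n. 8 * C * sqrt (2 * mesh n))"
  have occ_m: "occ \<epsilon> \<in> borel_measurable M" for \<epsilon> by (rule borel_measurable_occ)
  have occ_bd: "\<bar>occ (mesh n) w\<bar> \<le> 1 / (2 * mesh n)" if "w \<in> space M" for n w
    using occ_nonneg[OF mesh_pos, of n w] occ_le[OF mesh_pos that, of n] by simp
  have int2: "integrable M (\<lambda>w. occ (mesh n) w * occ (mesh m) w)" for n m
  proof (rule integrable_const_bound[of _ "1 / (2 * mesh n) * (1 / (2 * mesh m))"])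
    have "\<bar>occ (mesh n) w * occ (mesh m) w\<bar> \<le> 1 / (2 * mesh n) * (1 / (2 * mesh m))" if "w \<in> space M" for w
      unfolding abs_mult using occ_bd[OF that] mesh_pos by (intro mult_mono) (auto intro: less_imp_le)
    then show "AE w in M. norm (occ (mesh n) w * occ (mesh m) w) \<le> 1 / (2 * mesh n) * (1 / (2 * mesh m))"
      by (auto simp: real_norm_def)
  qed (intro borel_measurable_times occ_m)
  have "variance (\<lambda>w. leray_measure (\<lambda>x. wave x w)) = A - (1 / sqrt (2 * pi))\<^sup>2"
  proof (rule L2_Cauchy_limit[where X = "\<lambda>n. occ (mesh n)" and r = r and K = "\<lambda>n. 1 / (2 * mesh n)"])
    show "occ (mesh n) \<in> borel_measurable M" for n by (rule occ_m)
    show "(\<lambda>w. leray_measure (\<lambda>x. wave x w)) \<in> borel_measurable M" by (rule borel_measurable_leray)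
    show "\<bar>occ (mesh n) w\<bar> \<le> 1 / (2 * mesh n)" if "w \<in> space M" for n w by (rule occ_bd[OF that])
    show "r n > 0" for n using C mesh_pos[of n] by (simp add: r_def)
    show "summable (\<lambda>n. sqrt (r n))"
    proof -
      have "sqrt (r n) = sqrt (8 * C * sqrt 2) * (1 / (real n + 1) ^ 2)" for n
      proof -
        have "mesh n = ((1 / (real n + 1) ^ 2) ^ 2) ^ 2" by (simp add: mesh_def power_divide flip: power_mult)
        then have "sqrt (mesh n) = (1 / (real n + 1) ^ 2) ^ 2" by (simp only: real_sqrt_abs) simp
        then have "sqrt (sqrt (mesh n)) = 1 / (real n + 1) ^ 2" by (simp only: real_sqrt_abs) simp
        then show ?thesis by (simp add: r_def real_sqrt_mult)
      qed
      moreover have "summable (\<lambda>n. sqrt (8 * C * sqrt 2) * (1 / (real n + 1) ^ 2))"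
        by (rule summable_mult)
           (use summable_Suc_iff[THEN iffD2, OF inverse_power_summable[of 2, where 'a = real]] in \<open>simp add: inverse_eq_divide add.commute\<close>)
      ultimately show ?thesis by (simp only:)
    qed
    show "(\<lambda>n. occ (mesh n) w) \<longlonglongrightarrow> leray_measure (\<lambda>x. wave x w)" if "w \<in> space M" "convergent (\<lambda>n. occ (mesh n) w)" for w
      using that by (simp add: leray_measure_wave convergent_LIMSEQ_iff)
    show "(\<lambda>n. expectation (occ (mesh n))) \<longlonglongrightarrow> 1 / sqrt (2 * pi)"
    proof (rule LIM_zero_cancel, rule Lim_null_comparison[OF always_eventually], rule allI)
      show "norm (expectation (occ (mesh n)) - 1 / sqrt (2 * pi)) \<le> (mesh n)\<^sup>2" for n
        using expectation_occ[OF mesh_pos, of n] by simp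
      show "(\<lambda>n. (mesh n)\<^sup>2) \<longlonglongrightarrow> 0" using tendsto_power[OF mesh_tendsto, of 2] by simp
    qed
    show "(\<lambda>n. expectation (\<lambda>w. (occ (mesh n) w)\<^sup>2)) \<longlonglongrightarrow> A"
    proof (rule LIM_zero_cancel, rule Lim_null_comparison[OF always_eventually], rule allI)
      show "norm (expectation (\<lambda>w. (occ (mesh n) w)\<^sup>2) - A) \<le> C * sqrt (mesh n + mesh n)" for n
        using second[OF mesh_pos mesh_pos, of n n] by (simp add: power2_eq_square)
      have "(\<lambda>n. C * sqrt (mesh n + mesh n)) \<longlonglongrightarrow> C * sqrt (0 + 0)" by (intro tendsto_intros mesh_tendsto)
      then show "(\<lambda>n. C * sqrt (mesh n + mesh n)) \<longlonglongrightarrow> 0" by simp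
    qed
    show "expectation (\<lambda>w. (occ (mesh m) w - occ (mesh n) w)\<^sup>2) \<le> r n" if "n \<le> m" for n m
    proof -
      have "(occ (mesh m) w - occ (mesh n) w)\<^sup>2 = occ (mesh m) w * occ (mesh m) w - 2 * (occ (mesh m) w * occ (mesh n) w) + occ (mesh n) w * occ (mesh n) w" for w
        by (simp add: power2_eq_square algebra_simps)
      then have "expectation (\<lambda>w. (occ (mesh m) w - occ (mesh n) w)\<^sup>2)
        = expectation (\<lambda>w. occ (mesh m) w * occ (mesh m) w) - 2 * expectation (\<lambda>w. occ (mesh m) w * occ (mesh n) w) + expectation (\<lambda>w. occ (mesh n) w * occ (mesh n) w)"
        using int2 by simp
      moreover have "\<bar>expectation (\<lambda>w. occ (mesh a) w * occ (mesh b) w) - A\<bar> \<le> C * sqrt (2 * mesh n)" if "n \<le> a" "n \<le> b" for a b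
      proof -
        have "\<bar>expectation (\<lambda>w. occ (mesh a) w * occ (mesh b) w) - A\<bar> \<le> C * sqrt (mesh a + mesh b)"
          by (rule second[OF mesh_pos mesh_pos])
        also have "\<dots> \<le> C * sqrt (2 * mesh n)"
          using C mesh_antimono[OF that(1)] mesh_antimono[OF that(2)] by (intro mult_left_mono real_sqrt_le_mono) auto
        finally show ?thesis .
      qed
      from this[of m m] this[of m n] this[of n n] that
      have "\<bar>expectation (\<lambda>w. occ (mesh m) w * occ (mesh m) w) - A\<bar> \<le> C * sqrt (2 * mesh n)"
        "\<bar>expectation (\<lambda>w. occ (mesh m) w * occ (mesh n) w) - A\<bar> \<le> C * sqrt (2 * mesh n)"
        "\<bar>expectation (\<lambda>w. occ (mesh n) w * occ (mesh n) w) - A\<bar> \<le> C * sqrt (2 * mesh n)" by auto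
      moreover have "0 \<le> C * sqrt (2 * mesh n)" using C mesh_pos[of n] by simp
      ultimately show ?thesis unfolding r_def by linarith
    qed
  qed
  then show ?thesis by (simp add: A_def power_divide diff_divide_distrib)
qed

end

theorem theorem1p1:
  fixes E :: "nat \<Rightarrow> nat"
    and R :: "nat \<Rightarrow> (real ^ 'n::finite) set"
    and M :: "nat \<Rightarrow> 'w measure"
    and b c :: "nat \<Rightarrow> real ^ 'n \<Rightarrow> 'w \<Rightarrow> real"
  assumes "CARD('n) = 2 \<or> CARD('n) \<ge> 5"
    and "\<And>k. E k \<ge> 1"
    and "filterlim (\<lambda>k. freq_count TYPE('n) (E k)) at_top sequentially"
    and "\<And>k. representatives (E k) (R k)"
    and "\<And>k. gaussian_coefficients (M k) (R k) (b k) (c k)"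
  shows "(\<lambda>k. 4 * pi * real (freq_count TYPE('n) (E k)) *
            prob_space.variance (M k)
              (\<lambda>w. leray_measure (eigenfunction (E k) (R k) (\<lambda>l. b k l w) (\<lambda>l. c k l w))))
         \<longlonglongrightarrow> 1"
proof -
  have d2: "CARD('n) \<ge> 2" using assms(1) by auto
  obtain C where C: "C > 0" and int: "\<And>E (y :: real ^ 'n). E > 0 \<Longrightarrow> freq_count TYPE('n) E > 0 \<Longrightarrow>
    (\<integral>\<^sup>+x. inverse (ennreal ((1 - (covariance E x y)\<^sup>2) powr (3/4))) \<partial>torus) \<le> ennreal C \<and>
    integrable torus (\<lambda>x. inverse (sqrt (1 - (covariance E x y)\<^sup>2))) \<and>
    \<bar>(\<integral>x. inverse (sqrt (1 - (covariance E x y)\<^sup>2)) \<partial>torus) - 1 - 1 / (2 * real (freq_count TYPE('n) E))\<bar>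
      \<le> C * (\<integral>x. (covariance E x y) ^ 4 \<partial>torus)"
    using covariance_integrals[OF d2] by blast
  define N where "N = (\<lambda>k. real (freq_count TYPE('n) (E k)))"
  define Q where "Q = (\<lambda>k. real (card (zero_sum_quadruples (frequencies (E k) :: (real ^ 'n) set))))"
  define V where "V = (\<lambda>k. prob_space.variance (M k)
              (\<lambda>w. leray_measure (eigenfunction (E k) (R k) (\<lambda>l. b k l w) (\<lambda>l. c k l w))))"
  \<comment> \<open>The left side is \<open>2 * N\<close> times the error in the energy, which is at
    most \<open>C * Q / N ^ 4\<close>; so one power of \<open>N\<close> is lost and
    \<open>Q / N ^ 3\<close> remains.\<close>
  have main: "\<bar>4 * pi * N k * V k - 1\<bar> \<le> 2 * C * (Q k / N k ^ 3)" if N0: "freq_count TYPE('n) (E k) > 0" for k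
  proof -
    have E0: "E k > 0" using assms(2)[of k] by simp
    have "prob_space (M k)" using assms(5)[of k] by (simp add: gaussian_coefficients_def)
    then interpret random_wave "M k" "E k" "R k" "b k" "c k"
      unfolding random_wave_def random_wave_axioms_def using d2 E0 N0 assms(4,5) by blast
    define q where "q = C * (Q k / N k ^ 4)"
    have near: "\<bar>mutual_energy (E k) y - 1 - 1 / (2 * N k)\<bar> \<le> q" for y :: "real ^ 'n"
      using int[OF E0 N0, of y] unfolding integral_covariance_fourth
      by (simp add: mutual_energy_def q_def Q_def N_def)
    \<comment> \<open>The energy is within \<open>q\<close> of a constant for every
      \<open>y\<close>, so boundedness gives integrability over the second variable.\<close>
    have Ni: "integrable torus (\<lambda>y :: real ^ 'n. mutual_energy (E k) y - 1 - 1 / (2 * N k))"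
    proof (rule torus.integrable_const_bound[of _ q])
      show "(\<lambda>y :: real ^ 'n. mutual_energy (E k) y - 1 - 1 / (2 * N k)) \<in> borel_measurable torus"
        by (intro borel_measurable_diff borel_measurable_const borel_measurable_mutual_energy)
    qed (use near in simp)
    have I: "integrable torus (mutual_energy (E k) :: real ^ 'n \<Rightarrow> real)"
      using Bochner_Integration.integrable_add[OF Ni, of "\<lambda>_. 1 + 1 / (2 * N k)"] by simp
    have "V k = variance (\<lambda>w. leray_measure (\<lambda>x. wave x w))"
      unfolding V_def wave_def by (simp add: eta_contract_eq)
    also have "\<dots> = ((\<integral>y. mutual_energy (E k) (y :: real ^ 'n) \<partial>torus) - 1) / (2 * pi)"
      by (rule variance_leray[OF C]) (use int[OF E0 N0] I in auto)
    finally have V: "V k = ((\<integral>y. mutual_energy (E k) (y :: real ^ 'n) \<partial>torus) - 1) / (2 * pi)" .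
    have Np: "N k > 0" using N0 by (simp add: N_def)
    have "(\<integral>y. mutual_energy (E k) (y :: real ^ 'n) - 1 - 1 / (2 * N k) \<partial>torus) = (\<integral>y. mutual_energy (E k) (y :: real ^ 'n) \<partial>torus) - 1 - 1 / (2 * N k)"
      using I by (simp add: torus.prob_space)
    moreover have "\<bar>\<integral>y. mutual_energy (E k) (y :: real ^ 'n) - 1 - 1 / (2 * N k) \<partial>torus\<bar> \<le> (\<integral>y. \<bar>mutual_energy (E k) (y :: real ^ 'n) - 1 - 1 / (2 * N k)\<bar> \<partial>torus)"
      by (rule integral_abs_bound)
    moreover have "\<dots> \<le> (\<integral>y. q \<partial>(torus :: (real ^ 'n) measure))"
      using Ni near by (intro integral_mono) auto
    ultimately have le: "\<bar>(\<integral>y. mutual_energy (E k) (y :: real ^ 'n) \<partial>torus) - 1 - 1 / (2 * N k)\<bar> \<le> q"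
      by (simp add: torus.prob_space)
    have "4 * pi * N k * V k - 1 = 2 * N k * ((\<integral>y. mutual_energy (E k) (y :: real ^ 'n) \<partial>torus) - 1 - 1 / (2 * N k))"
      unfolding V using Np by (simp add: field_simps)
    also have "\<bar>\<dots>\<bar> = 2 * N k * \<bar>(\<integral>y. mutual_energy (E k) (y :: real ^ 'n) \<partial>torus) - 1 - 1 / (2 * N k)\<bar>"
      using Np by (simp add: abs_mult)
    also have "\<dots> \<le> 2 * N k * q" using le Np by (intro mult_left_mono) auto
    also have "\<dots> = 2 * C * (Q k / N k ^ 3)" using Np by (simp add: q_def eval_nat_numeral)
    finally show ?thesis .
  qed
  have "(\<lambda>k. 4 * pi * N k * V k) \<longlonglongrightarrow> 1"
  proof (rule LIM_zero_cancel, rule Lim_null_comparison)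
    \<comment> \<open>Early members of the sequence may have no frequencies at all; the estimate is
      asserted only once there are some.\<close>
    have "eventually (\<lambda>k. 1 \<le> freq_count TYPE('n) (E k)) sequentially"
      using assms(3) by (simp add: filterlim_at_top)
    then show "eventually (\<lambda>k. norm (4 * pi * N k * V k - 1) \<le> 2 * C * (Q k / N k ^ 3)) sequentially"
      by eventually_elim (use main in auto)
    show "(\<lambda>k. 2 * C * (Q k / N k ^ 3)) \<longlonglongrightarrow> 0"
      unfolding Q_def N_def by (rule tendsto_mult_right_zero[OF zero_sum_quadruples_limit[OF assms(1,3)]])
  qed
  then show ?thesis by (simp only: N_def V_def)
qed

end
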